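(* Let $(E,\rho)$ be a weighted space and $(P(t))_{t\ge0}$ a generalized Feller semigroup on $\mathscr{B}^\rho(E)$ such that $P(t)1=1$ for all $t\ge0$. Then for every probability measure $\nu\in\mathcal{M}^\rho(E)$ there exist a probability measure $\mathbb{P}_\nu$ on the measurable space $(E^{\mathbb{R}_+},\mathcal{B}(E)^{\mathbb{R}_+})$ (product σ-algebra) and a complete, right-continuous filtration $(\mathcal{F}_t)_{t\ge0}$ containing the natural filtration of the canonical (coordinate) process $(\lambda_t)_{t\ge0}$, such that $(\lambda_t)$ is $(\mathcal{F}_t)$-adapted, $\mathbb{P}_\nu\circ\lambda_0^{-1}=\nu$, and for all $t\ge s\ge0$ and all $f\in\mathscr{B}^\rho(E)$, $$\mathbb{E}_\nu[f(\lambda_t)\mid\mathcal{F}_s]=P(t-s)f(\lambda_s)\quad \mathbb{P}_\nu\text{-a.s.}$$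
   Context: A weighted space is a pair $(E,\rho)$ where $E$ is a completely regular Hausdorff topological space and $\rho:E\to(0,\infty)$ is an admissible weight function, meaning that for every $R\ge 0$ the sublevel set $K_R:=\{x\in E:\rho(x)\le R\}$ is compact. For $f:E\to\mathbb{R}$ put $\|f\|_\rho:=\sup_{x\in E}|f(x)|/\rho(x)$; $\mathscr{B}^\rho(E)$ denotes the closure of $C_b(E)$ with respect to $\|\cdot\|_\rho$ inside $\{f:E\to\mathbb{R}:\|f\|_\rho<\infty\}$. A generalized Feller semigroup on $\mathscr{B}^\rho(E)$ is a family $(P(t))_{t\ge0}$ of bounded linear operators on $\mathscr{B}^\rho(E)$ such that (P1) $P(0)=\mathrm{Id}$; (P2) $P(t+s)=P(s)P(t)$ for all $s,t\ge0$; (P3) $\lim_{t\downarrow0}P(t)f(x)=f(x)$ for all $f\in\mathscr{B}^\rho(E)$, $x\in E$; (P4) there exist $\varepsilon>0$, $C<\infty$ with $\|P(t)\|_{L(\mathscr{B}^\rho(E))}\le C$ for all $t\in[0,\varepsilon]$; (P5) each $P(t)$ is a positive operator. $\mathcal{M}^\rho(E)$ denotes the set of signed Radon measures $\mu$ on the Borel σ-algebra $\mathcal{B}(E)$ with $\int_E\rho\,d|\mu|<\infty$. $\mathcal{B}(E)$ is the Borel σ-algebra of $E$. *)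

theory Defs
  imports "HOL-Analysis.Analysis" "HOL-Probability.Probability"
begin

definition weighted_space :: "('a::topological_space \<Rightarrow> real) \<Rightarrow> bool" where
  "weighted_space \<rho> \<longleftrightarrow>
     completely_regular_space (euclidean :: 'a topology) \<and>
     Hausdorff_space (euclidean :: 'a topology) \<and>
     (\<forall>x. \<rho> x > 0) \<and>
     (\<forall>R\<ge>0. compact {x. \<rho> x \<le> R})"

text \<open>The weighted sup-norm (meaningful when the set below is bounded above).\<close>
definition wnorm :: "('a \<Rightarrow> real) \<Rightarrow> ('a \<Rightarrow> real) \<Rightarrow> real" where
  "wnorm \<rho> f = (SUP x. \<bar>f x\<bar> / \<rho> x)"

definition wbounded :: "('a \<Rightarrow> real) \<Rightarrow> ('a \<Rightarrow> real) \<Rightarrow> bool" where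
  "wbounded \<rho> f \<longleftrightarrow> bdd_above (range (\<lambda>x. \<bar>f x\<bar> / \<rho> x))"

definition Brho :: "('a::topological_space \<Rightarrow> real) \<Rightarrow> ('a \<Rightarrow> real) set" where
  "Brho \<rho> = {f. wbounded \<rho> f \<and>
      (\<forall>\<epsilon>>0. \<exists>g. continuous_on UNIV g \<and> bounded (range g) \<and>
                  wnorm \<rho> (\<lambda>x. f x - g x) < \<epsilon>)}"

definition gen_feller_semigroup ::
  "('a::topological_space \<Rightarrow> real) \<Rightarrow> (real \<Rightarrow> ('a \<Rightarrow> real) \<Rightarrow> ('a \<Rightarrow> real)) \<Rightarrow> bool" where
  "gen_feller_semigroup \<rho> P \<longleftrightarrow>
     \<comment> \<open>each P(t), t \<ge> 0, is a bounded linear operator on B^rho(E)\<close>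
     (\<forall>t\<ge>0. (\<forall>f\<in>Brho \<rho>. P t f \<in> Brho \<rho>) \<and>
        (\<forall>f\<in>Brho \<rho>. \<forall>g\<in>Brho \<rho>. P t (\<lambda>x. f x + g x) = (\<lambda>x. P t f x + P t g x)) \<and>
        (\<forall>f\<in>Brho \<rho>. \<forall>c. P t (\<lambda>x. c * f x) = (\<lambda>x. c * P t f x)) \<and>
        (\<exists>C. \<forall>f\<in>Brho \<rho>. wnorm \<rho> (P t f) \<le> C * wnorm \<rho> f)) \<and>
     \<comment> \<open>(P1)\<close>
     (\<forall>f\<in>Brho \<rho>. P 0 f = f) \<and>
     \<comment> \<open>(P2)\<close>
     (\<forall>s\<ge>0. \<forall>t\<ge>0. \<forall>f\<in>Brho \<rho>. P (t + s) f = P s (P t f)) \<and>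
     \<comment> \<open>(P3)\<close>
     (\<forall>f\<in>Brho \<rho>. \<forall>x. ((\<lambda>t. P t f x) \<longlongrightarrow> f x) (at_right 0)) \<and>
     \<comment> \<open>(P4)\<close>
     (\<exists>\<epsilon>>0. \<exists>C. \<forall>t\<in>{0..\<epsilon>}. \<forall>f\<in>Brho \<rho>. wnorm \<rho> (P t f) \<le> C * wnorm \<rho> f) \<and>
     \<comment> \<open>(P5)\<close>
     (\<forall>t\<ge>0. \<forall>f\<in>Brho \<rho>. (\<forall>x. f x \<ge> 0) \<longrightarrow> (\<forall>x. P t f x \<ge> 0))"

definition prob_in_Mrho :: "('a::topological_space \<Rightarrow> real) \<Rightarrow> 'a measure \<Rightarrow> bool" where
  "prob_in_Mrho \<rho> \<nu> \<longleftrightarrow>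
     sets \<nu> = sets borel \<and> prob_space \<nu> \<and>
     (\<forall>A\<in>sets borel. emeasure \<nu> A = (SUP K\<in>{K. compact K \<and> K \<subseteq> A}. emeasure \<nu> K)) \<and>
     integrable \<nu> \<rho>"

end

theory Submission
  imports Defs
begin

text \<open>
  The Riesz representation theorem turns \<open>f \<mapsto> P t f x\<close> into integration against a Radon probability
  measure \<open>kernel t x\<close>. Since \<open>E\<close> need not be metrizable, measurability in \<open>x\<close>, the Chapman-Kolmogorov equation
  on Borel sets and the Radon property of the one-dimensional laws are not automatic: all three follow from
  \<open>\<tau>\<close>-additivity, that is, Radon measures commute with directed suprema of \<open>[0,1]\<close>-valued functions that are
  continuous on every sublevel set of \<open>\<rho>\<close>. The Radon marginals make finite-dimensional laws inner regular with
  respect to compact sets, and Tychonoff's theorem gives the Kolmogorov extension.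

  The Markov property for the natural filtration must be passed on to its right-continuous completion without
  continuity of paths. Pointwise right continuity of \<open>t \<mapsto> P t f x\<close> gives right stochastic continuity of the
  process. It also makes the orbit \<open>t \<mapsto> P t f\<close> norm separable, so that all but countably many times are
  approximated in norm from the left; boundedness of the operators carries this to every positive time. Hence
  \<open>P (t - u) f (\<lambda>\<^sub>u)\<close> tends to \<open>P (t - s) f (\<lambda>\<^sub>s)\<close> in mean along a sequence \<open>u \<down> s\<close>.
\<close>

section \<open>Weighted spaces\<close>

text \<open>At a time u > s the Markov property gives P(t-u) f(\<lambda>_u). As u decreases to s,
  the operator time t-u increases to t-s, whereas (P3) with the semigroup law yields limits from the
  right only, and only pointwise in x. This mismatch forces the left approximation, and it must be
  in norm because the argument \<lambda>_u moves as well. One sequence of times suffices, since a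
  set of the augmented sigma-algebra at s is measurable at every later time. Stochastic continuity
  rests on second moments: the mean of (g(\<lambda>_{s+h}) - g(\<lambda>_s))^2 is the mean of
  P(h)(g^2) - 2 g P(h)g + g^2 at \<lambda>_s, which tends to 0 by (P3) and dominated convergence.
  They are replaced by the estimate P(t) f(x) \<le> C M \<rho>(x) for f \<le> M \<rho>: a function
  bounded by 1 is at most \<rho>/R where \<rho> > R, so the region of large weight contributes
  little.\<close>

lemma compact_decseq_Inter_nonempty:
  fixes C :: "nat \<Rightarrow> 'a::topological_space set"
  assumes "compact S" "\<And>n. closed (C n)" "decseq C" "\<And>n. S \<inter> C n \<noteq> {}"
  shows "S \<inter> (\<Inter>n. C n) \<noteq> {}"
proof -
  have "S \<inter> (\<Inter>n\<in>J. C n) \<noteq> {}" if "finite J" for J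
  proof -
    have "C (Max (insert 0 J)) \<subseteq> C n" if "n \<in> J" for n
      using \<open>decseq C\<close> \<open>finite J\<close> that by (auto simp: decseq_def)
    then show ?thesis using assms(4)[of "Max (insert 0 J)"] by blast
  qed
  then show ?thesis
    using compact_imp_fip_image[OF assms(1), of UNIV C] assms(2) by auto
qed

section \<open>Bounded continuous functions and test functions below an indicator\<close>

definition Cb :: "('a::topological_space \<Rightarrow> real) set" where
  "Cb = {g. continuous_on UNIV g \<and> bounded (range g)}"

lemma Cb_abs_bound:
  assumes "g \<in> Cb" obtains B where "B > 0" "\<And>x. \<bar>g x\<bar> \<le> B"
proof -
  obtain B where "B > 0 \<and> (\<forall>x. \<bar>g x\<bar> \<le> B)" using assms by (auto simp: Cb_def bounded_pos)
  then show thesis using that by blast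
qed

lemma CbI:
  assumes "continuous_on UNIV g" "\<And>x. \<bar>g x\<bar> \<le> B"
  shows "g \<in> Cb"
  using assms unfolding Cb_def bounded_iff by auto

lemma Cb_const: "(\<lambda>x. c) \<in> Cb"
  by (rule CbI[of _ "\<bar>c\<bar>"]) auto

lemma Cb_add: "f \<in> Cb \<Longrightarrow> g \<in> Cb \<Longrightarrow> (\<lambda>x. f x + g x) \<in> Cb"
  unfolding Cb_def using bounded_plus_comp[of f UNIV g] by (auto intro!: continuous_intros)

text \<open>Domination by the indicator takes the place of compact support, since the space need not
  be locally compact; smallness at infinity will come from \<open>\<rho>\<close>.\<close>

definition subunit :: "'a::topological_space set \<Rightarrow> ('a \<Rightarrow> real) set" where
  "subunit U = {f. continuous_on UNIV f \<and> (\<forall>x. 0 \<le> f x \<and> f x \<le> indicator U x)}"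

lemma subunitI:
  "continuous_on UNIV f \<Longrightarrow> (\<And>x. 0 \<le> f x) \<Longrightarrow> (\<And>x. f x \<le> 1) \<Longrightarrow> (\<And>x. x \<notin> U \<Longrightarrow> f x = 0) \<Longrightarrow> f \<in> subunit U"
  by (auto simp: subunit_def indicator_def)

lemma subunitD:
  assumes "f \<in> subunit U"
  shows "continuous_on UNIV f" "0 \<le> f x" "f x \<le> 1" "x \<notin> U \<Longrightarrow> f x = 0" "f \<in> Cb"
proof -
  show *: "continuous_on UNIV f" "0 \<le> f x" "x \<notin> U \<Longrightarrow> f x = 0"
    using assms by (auto simp: subunit_def) (metis indicator_simps(2) order_antisym_conv)
  show **: "f x \<le> 1" for x
    using assms unfolding subunit_def by (metis (mono_tags, lifting) indicator_le_1 mem_Collect_eq order_trans)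
  show "f \<in> Cb" using * ** assms by (intro CbI[of _ 1]) (auto simp: subunit_def)
qed

lemma subunit_max: "f \<in> subunit U \<Longrightarrow> g \<in> subunit U \<Longrightarrow> (\<lambda>x. max (f x) (g x)) \<in> subunit U"
  by (rule subunitI) (auto intro!: continuous_intros simp: le_max_iff_disj subunitD)

lemma subunit_mono: "U \<subseteq> V \<Longrightarrow> f \<in> subunit U \<Longrightarrow> f \<in> subunit V"
  by (rule subunitI) (auto dest: subunitD)

lemma zero_subunit: "(\<lambda>x. 0) \<in> subunit U"
  by (rule subunitI) auto

section \<open>Sublevel sets of the weight and the weighted norm\<close>

locale weighted =
  fixes \<rho> :: "'a::topological_space \<Rightarrow> real"
  assumes weighted_space: "weighted_space \<rho>"
begin

lemma rho_pos: "\<rho> x > 0"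
  using weighted_space by (auto simp: weighted_space_def)

lemma compact_sublevel: "compact {x. \<rho> x \<le> R}"
proof (cases "R \<ge> 0")
  case False
  then have "{x. \<rho> x \<le> R} = {}" using less_trans[OF _ rho_pos] by (auto simp: not_le)
  then show ?thesis by simp
qed (use weighted_space in \<open>auto simp: weighted_space_def\<close>)

lemma compact_imp_closed_Hausdorff:
  fixes S :: "'a set" shows "compact S \<Longrightarrow> closed S"
  using weighted_space compactin_imp_closedin[of euclidean S] by (auto simp: weighted_space_def)

lemma closed_sublevel: "closed {x. \<rho> x \<le> R}"
  by (intro compact_imp_closed_Hausdorff compact_sublevel)

lemma rho_borel[measurable]: "\<rho> \<in> borel_measurable borel"
  by (rule borel_measurableI_le) (use closed_sublevel in auto)

text \<open>If \<open>\<rho>\<close> came arbitrarily close to 0, the nested closed sets where it is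
  at most 1/(n+1) would, by compactness, share a point at which \<open>\<rho>\<close> is not
  positive.\<close>

lemma rho_bounded_below: "\<exists>c>0. \<forall>x. c \<le> \<rho> x"
proof (rule ccontr)
  assume "\<not> ?thesis"
  then have *: "\<exists>x. \<rho> x \<le> c" if "c > 0" for c using that by (meson le_cases)
  have "{x. \<rho> x \<le> 1} \<inter> (\<Inter>n. {x. \<rho> x \<le> 1 / real (Suc n)}) \<noteq> {}"
  proof (rule compact_decseq_Inter_nonempty[OF compact_sublevel closed_sublevel])
    show "decseq (\<lambda>n. {x. \<rho> x \<le> 1 / real (Suc n)})"
    proof (rule decseq_SucI, safe)
      fix n x assume "\<rho> x \<le> 1 / real (Suc (Suc n))"
      also have "\<dots> \<le> 1 / real (Suc n)" by (simp add: frac_le)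
      finally show "\<rho> x \<le> 1 / real (Suc n)" .
    qed
    fix n
    obtain x where x: "\<rho> x \<le> 1 / real (Suc n)" using *[of "1 / real (Suc n)"] by auto
    moreover have "\<rho> x \<le> 1" by (rule order_trans[OF x]) simp
    ultimately have "x \<in> {x. \<rho> x \<le> 1} \<inter> {x. \<rho> x \<le> 1 / real (Suc n)}" by blast
    then show "{x. \<rho> x \<le> 1} \<inter> {x. \<rho> x \<le> 1 / real (Suc n)} \<noteq> {}" by blast
  qed
  then obtain x where x: "\<And>n. \<rho> x \<le> 1 / real (Suc n)" by auto
  obtain n where "1 / real (Suc n) < \<rho> x"
    using reals_Archimedean[OF rho_pos[of x]] by (auto simp: inverse_eq_divide)
  with x[of n] show False by simp
qed

text \<open>Some positive lower bound, not necessarily the attained minimum. It converts uniform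
  bounds into weighted ones: \<open>B \<le> B / rho_min * \<rho> x\<close> for nonnegative
  \<open>B\<close>.\<close>

definition rho_min :: real where
  "rho_min = (SOME c. c > 0 \<and> (\<forall>x. c \<le> \<rho> x))"

lemma rho_min: "rho_min > 0" "rho_min \<le> \<rho> x"
  using someI_ex[OF rho_bounded_below] unfolding rho_min_def by auto

lemma wnorm_bound: assumes "wbounded \<rho> f" shows "\<bar>f x\<bar> \<le> wnorm \<rho> f * \<rho> x"
proof -
  have "\<bar>f x\<bar> / \<rho> x \<le> wnorm \<rho> f"
    using assms unfolding wbounded_def wnorm_def by (intro cSUP_upper) auto
  then show ?thesis using rho_pos[of x] by (simp add: divide_le_eq)
qed

lemma
  assumes "\<And>x. \<bar>f x\<bar> \<le> M * \<rho> x"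
  shows wboundedI: "wbounded \<rho> f" and wnorm_le: "wnorm \<rho> f \<le> M"
proof -
  have *: "\<bar>f x\<bar> / \<rho> x \<le> M" for x
    using assms[of x] rho_pos[of x] by (simp add: divide_le_eq)
  show "wbounded \<rho> f" unfolding wbounded_def using * by (auto intro!: bdd_aboveI[of _ M])
  show "wnorm \<rho> f \<le> M" unfolding wnorm_def using * by (intro cSUP_least) auto
qed

lemma le_rho_if_bounded: assumes "B \<ge> 0" "\<bar>y\<bar> \<le> B" shows "\<bar>y\<bar> \<le> B / rho_min * \<rho> x"
proof -
  have "B \<le> B / rho_min * \<rho> x"
    using rho_min(1) mult_left_mono[OF rho_min(2)[of x] \<open>B \<ge> 0\<close>]
    by (auto simp: field_simps)
  then show ?thesis using assms by linarith
qed

text \<open>Pointwise inequalities replace the supremum \<open>wnorm\<close>, which carries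
  information only for weighted-bounded functions. Hence the first half must bound
  \<open>f - g\<close> by a multiple of \<open>\<rho>\<close> before the norm inequality can be read
  pointwise.\<close>

lemma Brho_iff:
  "f \<in> Brho \<rho> \<longleftrightarrow> (\<forall>\<epsilon>>0. \<exists>g\<in>Cb. \<forall>x. \<bar>f x - g x\<bar> \<le> \<epsilon> * \<rho> x)" (is "?l = ?r")
proof
  assume f: ?l
  then have wb: "wbounded \<rho> f" by (simp add: Brho_def)
  show ?r
  proof (intro allI impI)
    fix \<epsilon> :: real assume "\<epsilon> > 0"
    then obtain g where g: "continuous_on UNIV g" "bounded (range g)" "wnorm \<rho> (\<lambda>x. f x - g x) < \<epsilon>"
      using f unfolding Brho_def by blast
    then have gC: "g \<in> Cb" by (simp add: Cb_def)
    obtain B where B: "B > 0" "\<And>x. \<bar>g x\<bar> \<le> B" using Cb_abs_bound[OF gC] by blast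
    have "\<bar>f x - g x\<bar> \<le> (wnorm \<rho> f + B / rho_min) * \<rho> x" for x
      using wnorm_bound[OF wb, of x] le_rho_if_bounded[of B "g x" x] B(1) B(2)[of x]
      unfolding ring_distribs by linarith
    then have "wbounded \<rho> (\<lambda>x. f x - g x)" by (rule wboundedI)
    then have "\<bar>f x - g x\<bar> \<le> \<epsilon> * \<rho> x" for x
      using wnorm_bound[of "\<lambda>x. f x - g x" x] g(3) rho_pos[of x]
      by (meson less_imp_le mult_right_mono order_trans)
    with gC show "\<exists>g\<in>Cb. \<forall>x. \<bar>f x - g x\<bar> \<le> \<epsilon> * \<rho> x" by blast
  qed
next
  assume r: ?r
  then obtain g where g: "g \<in> Cb" "\<And>x. \<bar>f x - g x\<bar> \<le> 1 * \<rho> x"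
    using zero_less_one by blast
  obtain B where B: "B > 0" "\<And>x. \<bar>g x\<bar> \<le> B" using Cb_abs_bound[OF g(1)] by blast
  have "\<bar>f x\<bar> \<le> (1 + B / rho_min) * \<rho> x" for x
    using g(2)[of x] le_rho_if_bounded[of B "g x" x] B(1) B(2)[of x]
    unfolding ring_distribs by linarith
  then have "wbounded \<rho> f" by (rule wboundedI)
  moreover have "\<exists>g. continuous_on UNIV g \<and> bounded (range g) \<and> wnorm \<rho> (\<lambda>x. f x - g x) < \<epsilon>" if \<epsilon>: "\<epsilon> > 0" for \<epsilon>
  proof -
    obtain g where g: "g \<in> Cb" "\<And>x. \<bar>f x - g x\<bar> \<le> \<epsilon> / 2 * \<rho> x"
      using r \<epsilon> half_gt_zero by blast
    from wnorm_le[OF g(2)] \<epsilon> have "wnorm \<rho> (\<lambda>x. f x - g x) < \<epsilon>" by linarith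
    with g(1) show ?thesis by (auto simp: Cb_def)
  qed
  ultimately show ?l unfolding Brho_def by blast
qed

lemma Brho_approx:
  assumes "f \<in> Brho \<rho>" "\<epsilon> > 0"
  obtains g where "g \<in> Cb" "\<And>x. \<bar>f x - g x\<bar> \<le> \<epsilon> * \<rho> x"
  using assms Brho_iff by blast

lemma Brho_bound:
  assumes "f \<in> Brho \<rho>" shows "\<bar>f x\<bar> \<le> wnorm \<rho> f * \<rho> x"
  using assms wnorm_bound by (auto simp: Brho_def)

lemma Cb_Brho: "f \<in> Cb \<Longrightarrow> f \<in> Brho \<rho>"
  unfolding Brho_iff using rho_pos by (auto intro!: bexI[of _ f] simp: less_imp_le)

lemma subunit_Brho: "f \<in> subunit U \<Longrightarrow> f \<in> Brho \<rho>"
  by (intro Cb_Brho subunitD(5))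

lemma Brho_const: "(\<lambda>x. c) \<in> Brho \<rho>"
  by (intro Cb_Brho Cb_const)

lemma Brho_add:
  assumes "f \<in> Brho \<rho>" "g \<in> Brho \<rho>" shows "(\<lambda>x. f x + g x) \<in> Brho \<rho>"
  unfolding Brho_iff
proof (intro allI impI)
  fix \<epsilon> :: real assume "\<epsilon> > 0"
  then obtain a b where ab: "a \<in> Cb" "b \<in> Cb" "\<And>x. \<bar>f x - a x\<bar> \<le> \<epsilon>/2 * \<rho> x" "\<And>x. \<bar>g x - b x\<bar> \<le> \<epsilon>/2 * \<rho> x"
    using Brho_approx assms half_gt_zero by metis
  have "\<bar>f x + g x - (a x + b x)\<bar> \<le> \<epsilon> * \<rho> x" for x
    using ab(3)[of x] ab(4)[of x] by linarith
  then show "\<exists>h\<in>Cb. \<forall>x. \<bar>f x + g x - h x\<bar> \<le> \<epsilon> * \<rho> x"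
    using Cb_add[OF ab(1,2)] by (intro bexI[of _ "\<lambda>x. a x + b x"]) auto
qed

text \<open>A Lipschitz map sends an approximating function in \<open>Cb\<close> to another one in
  \<open>Cb\<close> and multiplies the error by at most \<open>l\<close>. Scalar multiples, positive
  parts and truncated squares are instances.\<close>

lemma Brho_Lipschitz_comp:
  assumes f: "f \<in> Brho \<rho>" and l: "l \<ge> 0" "\<And>x y. \<bar>\<phi> x - \<phi> y\<bar> \<le> l * \<bar>x - y\<bar>"
  shows "(\<lambda>x. \<phi> (f x)) \<in> Brho \<rho>"
  unfolding Brho_iff
proof (intro allI impI)
  fix \<epsilon> :: real assume e: "\<epsilon> > 0"
  \<comment> \<open>Dividing by \<open>l + 1\<close> instead of \<open>l\<close> also covers
    \<open>l = 0\<close>.\<close>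
  obtain a where a: "a \<in> Cb" "\<And>x. \<bar>f x - a x\<bar> \<le> \<epsilon>/(l + 1) * \<rho> x"
    using Brho_approx[OF f, of "\<epsilon> / (l+1)"] e l(1) by (metis add_nonneg_pos divide_pos_pos zero_less_one)
  obtain B where B: "B > 0" "\<And>x. \<bar>a x\<bar> \<le> B" using Cb_abs_bound[OF a(1)] by blast
  have "l-lipschitz_on UNIV \<phi>" using l by (simp add: lipschitz_on_def dist_real_def)
  then have c: "continuous_on UNIV \<phi>" by (rule lipschitz_on_continuous_on)
  have "\<bar>\<phi> (a x)\<bar> \<le> \<bar>\<phi> 0\<bar> + l * B" for x
    using l(2)[of "a x" 0] mult_left_mono[OF B(2)[of x] l(1)] by (simp; linarith)
  then have "(\<lambda>x. \<phi> (a x)) \<in> Cb"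
    using a(1) c by (intro CbI[of _ "\<bar>\<phi> 0\<bar> + l * B"] continuous_on_compose2[OF c]) (auto simp: Cb_def)
  moreover have "\<bar>\<phi> (f x) - \<phi> (a x)\<bar> \<le> \<epsilon> * \<rho> x" for x
  proof -
    have "\<bar>\<phi> (f x) - \<phi> (a x)\<bar> \<le> l * (\<epsilon>/(l + 1) * \<rho> x)"
      using l(2)[of "f x" "a x"] mult_left_mono[OF a(2)[of x] l(1)] by linarith
    also have "\<dots> = (l / (l+1)) * (\<epsilon> * \<rho> x)" by simp
    also have "\<dots> \<le> 1 * (\<epsilon> * \<rho> x)"
      using l e rho_pos[of x] by (intro mult_right_mono) auto
    finally show ?thesis by simp
  qed
  ultimately show "\<exists>h\<in>Cb. \<forall>x. \<bar>\<phi> (f x) - h x\<bar> \<le> \<epsilon> * \<rho> x"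
    by (intro bexI[of _ "\<lambda>x. \<phi> (a x)"]) auto
qed

lemma Brho_cmult: "f \<in> Brho \<rho> \<Longrightarrow> (\<lambda>x. c * f x) \<in> Brho \<rho>"
  by (rule Brho_Lipschitz_comp[of f "\<bar>c\<bar>"]) (auto simp flip: abs_mult right_diff_distrib)

lemma Brho_diff: "f \<in> Brho \<rho> \<Longrightarrow> g \<in> Brho \<rho> \<Longrightarrow> (\<lambda>x. f x - g x) \<in> Brho \<rho>"
  using Brho_add[of f "\<lambda>x. (-1) * g x"] Brho_cmult[of g "-1"] by simp

lemma Brho_pos_part: "f \<in> Brho \<rho> \<Longrightarrow> (\<lambda>x. max 0 (f x)) \<in> Brho \<rho>"
  by (rule Brho_Lipschitz_comp[of f 1]) (auto simp: max_def)

text \<open>Squaring is Lipschitz only on bounded sets, so values are first clamped between -B and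
  B, where the constant is \<open>2 * B\<close>. Squares enter through the second moments of the
  process.\<close>

lemma Brho_square:
  assumes f: "f \<in> Brho \<rho>" and B: "\<And>x. \<bar>f x\<bar> \<le> B"
  shows "(\<lambda>x. (f x)\<^sup>2) \<in> Brho \<rho>"
proof -
  have B0: "B \<ge> 0" using B by (meson abs_ge_zero order_trans)
  define \<phi> where "\<phi> = (\<lambda>y. (max (-B) (min B y))\<^sup>2)"
  have "\<bar>\<phi> x - \<phi> y\<bar> \<le> (2 * B) * \<bar>x - y\<bar>" for x y
  proof -
    define a b where ab: "a = max (-B) (min B x)" "b = max (-B) (min B y)"
    have "\<bar>a\<^sup>2 - b\<^sup>2\<bar> = \<bar>a + b\<bar> * \<bar>a - b\<bar>"
      by (simp add: power2_eq_square abs_mult[symmetric] algebra_simps)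
    also have "\<dots> \<le> (2 * B) * \<bar>x - y\<bar>"
      using B0 by (intro mult_mono) (auto simp: ab)
    finally show ?thesis by (simp add: \<phi>_def ab)
  qed
  then have "(\<lambda>x. \<phi> (f x)) \<in> Brho \<rho>" using B0 by (intro Brho_Lipschitz_comp[OF f, of "2*B"]) auto
  moreover have "\<phi> (f x) = (f x)\<^sup>2" for x
    using B[of x] by (auto simp: \<phi>_def abs_le_iff max_def min_def)
  ultimately show ?thesis by simp
qed

text \<open>On a sublevel set the error \<open>\<epsilon> * \<rho>\<close> is at most
  \<open>\<epsilon> * R\<close>, so weighted approximation is uniform there. On the whole space
  continuity may fail.\<close>

lemma Brho_continuous_on: assumes f: "f \<in> Brho \<rho>" shows "continuous_on {x. \<rho> x \<le> R} f"
proof -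
  obtain g where g: "\<And>n. g n \<in> Cb" "\<And>n x. \<bar>f x - g n x\<bar> \<le> 1 / real (Suc n) * \<rho> x"
  proof -
    have "\<exists>g\<in>Cb. \<forall>x. \<bar>f x - g x\<bar> \<le> 1 / real (Suc n) * \<rho> x" for n
      using f[unfolded Brho_iff, rule_format, of "1 / real (Suc n)"] by simp
    then show thesis using that by metis
  qed
  have "uniform_limit {x. \<rho> x \<le> R} g f sequentially"
    unfolding uniform_limit_iff
  proof (intro allI impI)
    fix e :: real assume e: "e > 0"
    have "(\<lambda>n. 1 / real (Suc n) * \<bar>R\<bar>) \<longlonglongrightarrow> 0 * \<bar>R\<bar>"
      by (intro tendsto_intros LIMSEQ_Suc[OF lim_1_over_n])
    then have "\<forall>\<^sub>F n in sequentially. 1 / real (Suc n) * \<bar>R\<bar> < e"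
      using e by (intro order_tendstoD(2)[where y = "0 * \<bar>R\<bar>"]) auto
    then show "\<forall>\<^sub>F n in sequentially. \<forall>x\<in>{x. \<rho> x \<le> R}. dist (g n x) (f x) < e"
    proof eventually_elim
      case (elim n)
      show ?case
      proof safe
        fix x assume "\<rho> x \<le> R"
        then have "1 / real (Suc n) * \<rho> x \<le> 1 / real (Suc n) * \<bar>R\<bar>" by (intro mult_left_mono) auto
        then show "dist (g n x) (f x) < e"
          using g(2)[of x n] elim by (auto simp: dist_real_def abs_minus_commute)
      qed
    qed
  qed
  moreover have "continuous_on {x. \<rho> x \<le> R} (g n)" for n
    using g(1)[of n] by (auto simp: Cb_def intro: continuous_on_subset)
  ultimately show ?thesis by (intro uniform_limit_theorem[where f = g and F = sequentially]) auto
qed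

section \<open>Borel measurability through sublevel sets\<close>

lemma borel_measurable_sublevelI:
  fixes f :: "'a \<Rightarrow> real"
  assumes "\<And>n r. {x. \<rho> x \<le> real n \<and> r < f x} \<in> sets borel"
  shows "f \<in> borel_measurable borel"
proof (rule borel_measurableI_greater)
  fix r
  have "{x. \<rho> x \<le> real n \<and> r < f x} \<in> sets borel" for n by fact
  then have "(\<Union>n. {x. \<rho> x \<le> real n \<and> r < f x}) \<in> sets borel" by blast
  also have "(\<Union>n. {x. \<rho> x \<le> real n \<and> r < f x}) = {x \<in> space borel. r < f x}"
    using real_arch_simple by auto
  finally show "{x \<in> space borel. r < f x} \<in> sets borel" .
qed

text \<open>Each superlevel set is relatively open in a closed set, so even an uncountable union is
  an open set intersected with a closed one. This is what makes suprema over uncountable families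
  measurable.\<close>

lemma sublevel_greater_borel:
  assumes c: "\<And>i. i \<in> I \<Longrightarrow> continuous_on {x. \<rho> x \<le> R} (f i :: 'a \<Rightarrow> real)"
  shows "{x. \<rho> x \<le> R \<and> (\<exists>i\<in>I. r < f i x)} \<in> sets borel"
proof -
  have "\<exists>W. open W \<and> W \<inter> {x. \<rho> x \<le> R} = f i -` {r<..} \<inter> {x. \<rho> x \<le> R}" if "i \<in> I" for i
    using continuous_on_open_invariant[THEN iffD1, OF c[OF that], rule_format, of "{r<..}"] by simp
  then obtain W where W: "\<And>i. i \<in> I \<Longrightarrow> open (W i)"
     "\<And>i. i \<in> I \<Longrightarrow> W i \<inter> {x. \<rho> x \<le> R} = f i -` {r<..} \<inter> {x. \<rho> x \<le> R}"
    by metis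
  have "{x. \<rho> x \<le> R \<and> (\<exists>i\<in>I. r < f i x)} = (\<Union>i\<in>I. W i) \<inter> {x. \<rho> x \<le> R}"
    using W(2) by blast
  moreover have "open (\<Union>i\<in>I. W i)" using W(1) by blast
  ultimately show ?thesis using closed_sublevel[of R] by auto
qed

lemma Brho_borel[measurable]: assumes "f \<in> Brho \<rho>" shows "f \<in> borel_measurable borel"
  by (rule borel_measurable_sublevelI)
     (use sublevel_greater_borel[of "{()}" _ "\<lambda>_. f"] Brho_continuous_on[OF assms] in auto)

lemma completely_regular_open:
  fixes x :: 'a assumes "open U" "x \<in> U"
  obtains f where "f \<in> subunit U" "f x = 1"
proof -
  have "closedin euclidean (-U)" using assms by auto
  then obtain f where f: "continuous_map euclidean (top_of_set {0..1}) f" "f x = (0::real)" "f ` (-U) \<subseteq> {1}"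
    using weighted_space assms(2) unfolding weighted_space_def completely_regular_space_def
    by (metis Compl_iff Diff_iff UNIV_I topspace_euclidean)
  have c: "continuous_on UNIV f" "\<And>y. f y \<in> {0..1}"
    using f(1) by (auto simp: continuous_map_in_subtopology)
  then have "(\<lambda>y. 1 - f y) \<in> subunit U"
    using f(3) by (intro subunitI continuous_intros) (auto simp: image_subset_iff)
  then show thesis using f(2) that by fastforce
qed

end

section \<open>Riesz representation\<close>

text \<open>The sum is \<open>\<delta>\<close> times the number of grid levels below
  \<open>y\<close>, that is, \<open>y\<close> rounded up to the grid and capped at height
  \<open>n * \<delta>\<close>.\<close>

lemma step_sum_bounds:
  fixes y \<delta> :: real
  assumes y: "0 \<le> y" "0 < \<delta>"
  shows step_sum_le: "(\<Sum>i<n. if real i * \<delta> < y then \<delta> else 0) \<le> y + \<delta>"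
    and step_sum_ge: "min y (real n * \<delta>) \<le> (\<Sum>i<n. if real i * \<delta> < y then \<delta> else 0)"
proof -
  define S where "S n = (\<Sum>i<n. if real i * \<delta> < y then \<delta> else 0)" for n
  have S: "S 0 = 0" "S (Suc n) = S n + (if real n * \<delta> < y then \<delta> else 0)" for n
    by (auto simp: S_def)
  have "S n \<le> y + \<delta> \<and> S n \<le> real n * \<delta>"
    using y by (induction n) (auto simp: S algebra_simps)
  then show "(\<Sum>i<n. if real i * \<delta> < y then \<delta> else 0) \<le> y + \<delta>" by (simp add: S_def)
  have "min y (real n * \<delta>) \<le> S n"
    using y by (induction n) (auto simp: S algebra_simps min_def split: if_splits)
  then show "min y (real n * \<delta>) \<le> (\<Sum>i<n. if real i * \<delta> < y then \<delta> else 0)" by (simp add: S_def)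
qed

lemma slice_sum:
  fixes y \<delta> :: real
  assumes "0 \<le> y" "0 < \<delta>"
  shows "(\<Sum>i<n. max 0 (min (y - real i * \<delta>) \<delta>)) = min y (real n * \<delta>)"
  using assms by (induction n) (auto simp: algebra_simps min_def max_def)

text \<open>Discretised layer-cake formula, obtained by integrating the pointwise bounds on the step
  sum. The condition \<open>n * \<delta> = 1\<close> makes the grid reach the upper bound 1 of
  \<open>f\<close>.\<close>

lemma (in prob_space) step_sum_measure_bounds:
  assumes f[measurable]: "f \<in> borel_measurable M" and b: "\<And>x. 0 \<le> f x" "\<And>x. f x \<le> (1::real)"
    and \<delta>: "\<delta> > 0" "real n * \<delta> = 1"
  shows "(\<Sum>i<n. \<delta> * measure M {x\<in>space M. real i * \<delta> < f x}) \<le> (\<integral>x. f x \<partial>M) + \<delta>"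
    and "(\<integral>x. f x \<partial>M) \<le> (\<Sum>i<n. \<delta> * measure M {x\<in>space M. real i * \<delta> < f x})"
proof -
  have int: "integrable M f" using b by (intro integrable_const_bound[of _ 1]) auto
  define S where "S x = (\<Sum>i<n. \<delta> * indicator {x\<in>space M. real i * \<delta> < f x} x)" for x
  have S: "integrable M S"
    unfolding S_def by (intro Bochner_Integration.integrable_sum integrable_mult_right) (auto simp: emeasure_eq_measure)
  have eq: "(\<Sum>i<n. \<delta> * measure M {x\<in>space M. real i * \<delta> < f x}) = (\<integral>x. S x \<partial>M)"
    unfolding S_def by (subst Bochner_Integration.integral_sum) (auto simp: emeasure_eq_measure)
  have Sx: "S x = (\<Sum>i<n. if real i * \<delta> < f x then \<delta> else 0)" if "x \<in> space M" for x
    unfolding S_def using that by (intro sum.cong) (auto simp: indicator_def)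
  have "(\<integral>x. S x \<partial>M) \<le> (\<integral>x. f x + \<delta> \<partial>M)"
    using S int step_sum_le[OF b(1) \<delta>(1)] Sx by (intro integral_mono) auto
  then show "(\<Sum>i<n. \<delta> * measure M {x\<in>space M. real i * \<delta> < f x}) \<le> (\<integral>x. f x \<partial>M) + \<delta>"
    using int by (simp add: eq prob_space)
  have "(\<integral>x. f x \<partial>M) \<le> (\<integral>x. S x \<partial>M)"
  proof (rule integral_mono[OF int S])
    show "f x \<le> S x" if "x \<in> space M" for x
      unfolding Sx[OF that]
      using step_sum_ge[OF b(1)[of x] \<delta>(1), of n] b(2)[of x] \<delta>(2) by (simp add: min_def)
  qed
  then show "(\<integral>x. f x \<partial>M) \<le> (\<Sum>i<n. \<delta> * measure M {x\<in>space M. real i * \<delta> < f x})"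
    by (simp add: eq)
qed

context weighted
begin

text \<open>Serves as a partition of unity. Each point of \<open>C\<close> gets a function equal to
  1 there and living in one \<open>U n\<close>; finitely many half-level sets cover
  \<open>C\<close>, and functions with the same index are added and cut off at 1.\<close>

lemma compact_cover_subunit:
  fixes U :: "nat \<Rightarrow> 'a set"
  assumes C: "compact C" "C \<subseteq> (\<Union>n. U n)" and U: "\<And>n. open (U n)"
  obtains N g where "\<And>n. g n \<in> subunit (U n)" "\<And>x. x \<in> C \<Longrightarrow> 1 \<le> (\<Sum>n<N. g n x)"
proof -
  have "\<exists>n h. x \<in> C \<longrightarrow> h \<in> subunit (U n) \<and> h x = 1" for x
    using C(2) completely_regular_open[OF U] by (cases "x \<in> C") (blast, blast)
  then obtain \<nu> h where h: "\<And>x. x \<in> C \<Longrightarrow> h x \<in> subunit (U (\<nu> x))" "\<And>x. x \<in> C \<Longrightarrow> h x x = 1"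
    by metis
  have op: "open {y. 1/2 < h x y}" if "x \<in> C" for x
    using subunitD(1)[OF h(1)[OF that]] by (intro open_Collect_less) auto
  have "C \<subseteq> (\<Union>x\<in>C. {y. 1/2 < h x y})" using h(2) by force
  then obtain D where D: "D \<subseteq> C" "finite D" "C \<subseteq> (\<Union>x\<in>D. {y. 1/2 < h x y})"
    using compactE_image[OF C(1), of C "\<lambda>x. {y. 1/2 < h x y}"] op by auto
  \<comment> \<open>The factor 2 lifts values above 1/2 to at least 1; the minimum with 1 keeps the
    grouped sum in \<open>subunit (U n)\<close>.\<close>
  define g where "g n y = min 1 (\<Sum>x\<in>{x\<in>D. \<nu> x = n}. 2 * h x y)" for n y
  define N where "N = Suc (Max (insert 0 (\<nu> ` D)))"
  show thesis
  proof
    show "g n \<in> subunit (U n)" for n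
    proof (rule subunitI)
      show "continuous_on UNIV (g n)"
        unfolding g_def using h(1) D(1) by (intro continuous_intros) (auto dest: subunitD)
      show "0 \<le> g n x" for x
        unfolding g_def using D(1) subunitD(2)[OF h(1)] by (auto intro!: sum_nonneg)
      show "g n x \<le> 1" for x by (simp add: g_def)
      show "g n x = 0" if "x \<notin> U n" for x
      proof -
        have "(\<Sum>z\<in>{z\<in>D. \<nu> z = n}. 2 * h z x) = 0"
          using D(1) that subunitD(4)[OF h(1)] by (intro sum.neutral) auto
        then show ?thesis by (simp add: g_def)
      qed
    qed
    fix y assume "y \<in> C"
    then obtain x where x: "x \<in> D" "1/2 < h x y" using D(3) by auto
    have gn: "0 \<le> g n z" for n z
        unfolding g_def using D(1) subunitD(2)[OF h(1)] by (auto intro!: sum_nonneg)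
    have "2 * h x y \<le> (\<Sum>z\<in>{z\<in>D. \<nu> z = \<nu> x}. 2 * h z y)"
      using D(1,2) x(1) subunitD(2)[OF h(1)] by (intro member_le_sum[of x]) auto
    then have "1 \<le> g (\<nu> x) y" using x(2) by (auto simp: g_def)
    also have "\<dots> \<le> (\<Sum>n<N. g n y)"
      using x(1) D(2) gn by (intro member_le_sum) (auto simp: N_def less_Suc_eq_le)
    finally show "1 \<le> (\<Sum>n<N. g n y)" .
  qed
qed

end

text \<open>Models \<open>f \<mapsto> P t f x\<close> for fixed t and x; there \<open>c\<close> is
  \<open>C * \<rho> x\<close> with \<open>C\<close> an operator bound.\<close>

locale weighted_functional = weighted \<rho> for \<rho> :: "'a::topological_space \<Rightarrow> real" +
  fixes L :: "('a \<Rightarrow> real) \<Rightarrow> real" and c :: real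
  assumes L_add: "\<And>f g. f \<in> Brho \<rho> \<Longrightarrow> g \<in> Brho \<rho> \<Longrightarrow> L (\<lambda>x. f x + g x) = L f + L g"
    and L_cmult: "\<And>f a. f \<in> Brho \<rho> \<Longrightarrow> L (\<lambda>x. a * f x) = a * L f"
    and L_nonneg: "\<And>f. f \<in> Brho \<rho> \<Longrightarrow> (\<And>x. 0 \<le> f x) \<Longrightarrow> 0 \<le> L f"
    and L_one: "L (\<lambda>x. 1) = 1"
    and L_wnorm: "\<And>f. f \<in> Brho \<rho> \<Longrightarrow> L f \<le> c * wnorm \<rho> f"
    and c_nonneg: "c \<ge> 0"
begin

lemma L_diff: "f \<in> Brho \<rho> \<Longrightarrow> g \<in> Brho \<rho> \<Longrightarrow> L (\<lambda>x. f x - g x) = L f - L g"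
  using L_add[of f "\<lambda>x. (-1) * g x"] Brho_cmult[of g "-1"] L_cmult[of g "-1"] by simp

lemma L_mono: "f \<in> Brho \<rho> \<Longrightarrow> g \<in> Brho \<rho> \<Longrightarrow> (\<And>x. f x \<le> g x) \<Longrightarrow> L f \<le> L g"
  using L_nonneg[of "\<lambda>x. g x - f x"] L_diff[of g f] Brho_diff[of g f] by simp

lemma L_const: "L (\<lambda>x. a) = a"
  using L_cmult[OF Brho_const[of 1], of a] L_one by simp

lemma Brho_sum: "(\<And>i. i \<in> A \<Longrightarrow> f i \<in> Brho \<rho>) \<Longrightarrow> (\<lambda>x. \<Sum>i\<in>A. f i x) \<in> Brho \<rho>"
  by (induction A rule: infinite_finite_induct) (auto simp: Brho_const intro: Brho_add)

lemma L_sum: "(\<And>i. i \<in> A \<Longrightarrow> f i \<in> Brho \<rho>) \<Longrightarrow> L (\<lambda>x. \<Sum>i\<in>A. f i x) = (\<Sum>i\<in>A. L (f i))"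
  by (induction A rule: infinite_finite_induct) (auto simp: L_const L_add Brho_sum)

text \<open>Passing to the positive part makes a one-sided bound sufficient. This is the tightness
  estimate: a function at most \<open>\<rho> / R\<close> has value at most
  \<open>c / R\<close>.\<close>

lemma L_tight:
  assumes f: "f \<in> Brho \<rho>" and M: "M \<ge> 0" "\<And>x. f x \<le> M * \<rho> x"
  shows "L f \<le> c * M"
proof -
  have "L f \<le> L (\<lambda>x. max 0 (f x))" by (intro L_mono Brho_pos_part f) auto
  also have "\<dots> \<le> c * wnorm \<rho> (\<lambda>x. max 0 (f x))" by (intro L_wnorm Brho_pos_part f)
  also have "\<dots> \<le> c * M"
    using M rho_pos by (intro mult_left_mono wnorm_le c_nonneg) (auto simp: max_def less_imp_le)
  finally show ?thesis .
qed

lemma L_subunit: assumes "f \<in> subunit U" shows "0 \<le> L f" "L f \<le> 1"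
  using L_nonneg[OF subunit_Brho[OF assms]] L_mono[OF subunit_Brho[OF assms] Brho_const[of 1]]
    subunitD[OF assms] L_one by auto

section \<open>Inner and outer content of a positive functional\<close>

definition inner_content :: "'a set \<Rightarrow> ennreal" where
  "inner_content U = (SUP f\<in>subunit U. ennreal (L f))"

definition outer_content :: "'a set \<Rightarrow> ennreal" where
  "outer_content A = (INF U\<in>{U. open U \<and> A \<subseteq> U}. inner_content U)"

lemma inner_content_le_1: "inner_content U \<le> 1"
  unfolding inner_content_def using L_subunit(2) by (auto intro!: SUP_least)

lemma inner_content_mono: "U \<subseteq> V \<Longrightarrow> inner_content U \<le> inner_content V"
  unfolding inner_content_def by (intro SUP_subset_mono) (auto intro: subunit_mono)

lemma L_le_inner_content: "f \<in> subunit U \<Longrightarrow> ennreal (L f) \<le> inner_content U"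
  unfolding inner_content_def by (intro SUP_upper)

lemma inner_content_approx:
  assumes "e > 0" shows "\<exists>f\<in>subunit U. inner_content U \<le> ennreal (L f + e)"
proof -
  have "\<exists>f\<in>subunit U. inner_content U < ennreal (L f) + ennreal e"
    using inner_content_le_1[of U] zero_subunit[of U]
    by (intro SUP_approx_ennreal[OF assms]) (auto simp: inner_content_def[symmetric] top_unique)
  then show ?thesis using L_subunit(1) assms by (auto simp: ennreal_plus intro: less_imp_le)
qed

text \<open>On the compact set \<open>C\<close>, where \<open>\<rho> \<le> R\<close> and
  \<open>f \<ge> e / 2\<close>, a finite sum \<open>s\<close> of functions subordinate to the
  \<open>U n\<close> dominates \<open>f\<close>. Off \<open>C\<close>, either
  \<open>f < e / 2\<close> or \<open>f \<le> 1 \<le> \<rho> / R\<close>. So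
  \<open>f - (e / 2 + s) \<le> \<rho> / R\<close> everywhere, and \<open>L_tight\<close>
  applies.\<close>

lemma inner_content_subadditive:
  assumes U: "\<And>n. open (U n)"
  shows "inner_content (\<Union>n. U n) \<le> (\<Sum>n. inner_content (U n))"
  unfolding inner_content_def[of "\<Union>n. U n"]
proof (rule SUP_least)
  fix f assume f: "f \<in> subunit (\<Union>n. U n)"
  show "ennreal (L f) \<le> (\<Sum>n. inner_content (U n))"
  proof (rule ennreal_le_epsilon)
    fix e :: real assume e: "e > 0"
    \<comment> \<open>Gives \<open>c / R \<le> e / 2\<close>; the summand 1 keeps \<open>R\<close>
      positive when \<open>c = 0\<close>.\<close>
    define R where "R = 2 * (c + 1) / e"
    have R: "R > 0" "c / R \<le> e / 2" using e c_nonneg by (auto simp: R_def field_simps)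
    define C where "C = {x. \<rho> x \<le> R} \<inter> {x. e / 2 \<le> f x}"
    have "compact C" unfolding C_def
      using subunitD(1)[OF f] by (intro compact_Int_closed compact_sublevel closed_Collect_le) auto
    moreover have "C \<subseteq> (\<Union>n. U n)"
    proof
      fix x assume "x \<in> C"
      then have "f x \<noteq> 0" using e by (auto simp: C_def)
      then show "x \<in> (\<Union>n. U n)" using subunitD(4)[OF f] by blast
    qed
    ultimately obtain N g where g: "\<And>n. g n \<in> subunit (U n)" "\<And>x. x \<in> C \<Longrightarrow> 1 \<le> (\<Sum>n<N. g n x)"
      using compact_cover_subunit[where U = U and C = C] U by metis
    define s where "s = (\<lambda>x. \<Sum>n<N. g n x)"
    have sB: "s \<in> Brho \<rho>" unfolding s_def using g(1) by (intro Brho_sum subunit_Brho)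
    have s0: "0 \<le> s x" for x unfolding s_def using subunitD(2)[OF g(1)] by (intro sum_nonneg) auto
    define h where "h = (\<lambda>x. f x - (e / 2 + s x))"
    have hB: "h \<in> Brho \<rho>" unfolding h_def
      by (intro Brho_diff Brho_add sB Brho_const subunit_Brho[OF f])
    have "h x \<le> 1 / R * \<rho> x" for x
    proof (cases "x \<in> C")
      case True
      then have "h x \<le> 0" using g(2)[OF True] subunitD(3)[OF f, of x] e by (auto simp: h_def s_def)
      then show ?thesis using R rho_pos[of x] by (meson order_trans less_imp_le mult_pos_pos zero_less_divide_1_iff)
    next
      case False
      then consider "\<rho> x > R" | "f x < e / 2" by (auto simp: C_def)
      then show ?thesis
      proof cases
        case 1
        then have "1 \<le> 1 / R * \<rho> x" using R by (auto simp: field_simps)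
        then show ?thesis using s0[of x] subunitD(3)[OF f, of x] e by (auto simp: h_def)
      next
        case 2
        then have "h x \<le> 0" using s0[of x] by (auto simp: h_def)
        then show ?thesis using R rho_pos[of x] by (meson order_trans less_imp_le mult_pos_pos zero_less_divide_1_iff)
      qed
    qed
    then have "L h \<le> c * (1 / R)" using R by (intro L_tight hB) auto
    then have "L h \<le> e / 2" using R(2) by (metis mult.right_neutral times_divide_eq_right order_trans)
    moreover have "L h = L f - (e / 2 + (\<Sum>n<N. L (g n)))"
      using L_diff[OF subunit_Brho[OF f] Brho_add[OF Brho_const[of "e/2"] sB]]
        L_add[OF Brho_const[of "e/2"] sB] L_sum[of "{..<N}" g] subunit_Brho[OF g(1)]
      by (simp add: h_def s_def L_const)
    ultimately have "L f \<le> (\<Sum>n<N. L (g n)) + e" by linarith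
    then have "ennreal (L f) \<le> ennreal (\<Sum>n<N. L (g n)) + ennreal e"
      using e L_subunit(1)[OF g(1)] by (subst ennreal_plus[symmetric]) (auto intro!: sum_nonneg ennreal_leI)
    also have "ennreal (\<Sum>n<N. L (g n)) = (\<Sum>n<N. ennreal (L (g n)))"
      using L_subunit(1)[OF g(1)] by (intro sum_ennreal[symmetric]) auto
    also have "\<dots> \<le> (\<Sum>n<N. inner_content (U n))"
      by (intro sum_mono L_le_inner_content g)
    also have "\<dots> \<le> (\<Sum>n. inner_content (U n))" by (intro sum_le_suminf) auto
    finally show "ennreal (L f) \<le> (\<Sum>n. inner_content (U n)) + ennreal e" by (simp add: add_mono)
  qed
qed

lemma outer_content_open: "open U \<Longrightarrow> outer_content U = inner_content U"
  unfolding outer_content_def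
  by (intro antisym INF_lower2[of U] INF_greatest inner_content_mono) auto

lemma outer_content_mono: "A \<subseteq> B \<Longrightarrow> outer_content A \<le> outer_content B"
  unfolding outer_content_def by (intro INF_superset_mono) auto

lemma outer_content_le_1: "outer_content A \<le> 1"
  using outer_content_mono[of A UNIV] inner_content_le_1[of UNIV] outer_content_open[of UNIV] by auto

lemma outer_content_approx:
  assumes "e > 0" shows "\<exists>U. open U \<and> A \<subseteq> U \<and> inner_content U \<le> outer_content A + ennreal e"
proof -
  have "\<exists>U\<in>{U. open U \<and> A \<subseteq> U}. inner_content U < outer_content A + ennreal e"
    using outer_content_le_1[of A]
    by (intro INF_approx_ennreal[OF assms]) (auto simp: outer_content_def[symmetric] top_unique)
  then show ?thesis by (auto intro: less_imp_le)
qed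

lemma outer_content_subadditive: "outer_content (\<Union>n. A n) \<le> (\<Sum>n. outer_content (A (n::nat)))"
proof (rule ennreal_le_epsilon)
  fix e :: real assume e: "e > 0"
  have "\<exists>U. open U \<and> A n \<subseteq> U \<and> inner_content U \<le> outer_content (A n) + e * (1/2)^Suc n" for n
    using outer_content_approx[of "e * (1/2)^Suc n" "A n"] e by auto
  then obtain U where U: "\<And>n. open (U n)" "\<And>n. A n \<subseteq> U n"
     "\<And>n. inner_content (U n) \<le> outer_content (A n) + e * (1/2)^Suc n" by metis
  have "outer_content (\<Union>n. A n) \<le> outer_content (\<Union>n. U n)"
    using U(2) by (intro outer_content_mono) blast
  also have "\<dots> = inner_content (\<Union>n. U n)" using U(1) by (intro outer_content_open) auto
  also have "\<dots> \<le> (\<Sum>n. inner_content (U n))" by (rule inner_content_subadditive) fact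
  also have "\<dots> \<le> (\<Sum>n. outer_content (A n) + e * (1/2) ^ Suc n)"
    by (intro suminf_le U) auto
  also have "... = (\<Sum>n. outer_content (A n)) + (\<Sum>n. ennreal e * ennreal ((1/2) ^ Suc n))"
    using e by (subst suminf_add[symmetric])
               (auto simp del: ennreal_suminf_cmult simp add: ennreal_mult[symmetric])
  also have "\<dots> = (\<Sum>n. outer_content (A n)) + e"
    unfolding ennreal_suminf_cmult
    by (subst suminf_ennreal_eq[OF zero_le_power power_half_series]) auto
  finally show "outer_content (\<Union>n. A n) \<le> (\<Sum>n. outer_content (A n)) + e" .
qed

lemma outer_content_empty: "outer_content {} = 0"
proof -
  have "L f = 0" if "f \<in> subunit {}" for f
  proof -
    have "f = (\<lambda>x. 0)" using subunitD(4)[OF that] by auto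
    then show ?thesis using L_const[of 0] by simp
  qed
  then have "inner_content {} \<le> 0" unfolding inner_content_def by (intro SUP_least) auto
  then show ?thesis by (simp add: outer_content_open)
qed

lemma outer_content_add: "outer_content (A \<union> B) \<le> outer_content A + outer_content B"
proof -
  have "outer_content (A \<union> B) = outer_content (\<Union>n. binaryset A B n)" by (simp add: UN_binaryset_eq)
  also have "\<dots> \<le> (\<Sum>n. outer_content (binaryset A B n))" by (rule outer_content_subadditive)
  also have "\<dots> = outer_content A + outer_content B"
    using suminf_binaryset_eq[of outer_content A B] outer_content_empty by simp
  finally show ?thesis .
qed

text \<open>One half of Caratheodory's condition for open sets. A near-optimal \<open>f\<close> for
  \<open>U \<inter> V\<close>, lowered by \<open>e\<close>, vanishes off the closed set
  \<open>F\<close> where \<open>f \<ge> e\<close>, while a near-optimal \<open>h\<close> for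
  \<open>U - F\<close> vanishes on \<open>F\<close>. So their sum is a test function for
  \<open>U\<close>, and the two values add up.\<close>

lemma outer_content_split_open:
  assumes V: "open V"
  shows "outer_content (A \<inter> V) + outer_content (A - V) \<le> outer_content A"
proof (rule ennreal_le_epsilon)
  fix e' :: real assume "e' > 0"
  \<comment> \<open>Four losses of size \<open>e\<close>: the choices of \<open>U\<close>,
    \<open>f\<close> and \<open>h\<close>, and the lowering of \<open>f\<close>.\<close>
  define e where "e = e' / 4"
  have e: "e > 0" "e' = 4 * e" using \<open>e' > 0\<close> by (auto simp: e_def)
  obtain U where U: "open U" "A \<subseteq> U" "inner_content U \<le> outer_content A + ennreal e"
    using outer_content_approx[OF e(1)] by blast
  obtain f where f: "f \<in> subunit (U \<inter> V)" "inner_content (U \<inter> V) \<le> ennreal (L f + e)"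
    using inner_content_approx[OF e(1)] by blast
  define F where "F = {x. e \<le> f x}"
  have F: "closed F" "F \<subseteq> U \<inter> V"
    using subunitD(1,4)[OF f(1)] e(1) by (force simp: F_def intro!: closed_Collect_le)+
  obtain h where h: "h \<in> subunit (U - F)" "inner_content (U - F) \<le> ennreal (L h + e)"
    using inner_content_approx[OF e(1)] by blast
  define k where "k = (\<lambda>x. max 0 (f x - e) + h x)"
  have fB: "(\<lambda>x. max 0 (f x - e)) \<in> Brho \<rho>"
    by (intro Brho_pos_part Brho_diff Brho_const subunit_Brho[OF f(1)])
  have k: "k \<in> subunit U"
  proof (rule subunitI)
    show "continuous_on UNIV k" unfolding k_def
      using subunitD(1)[OF f(1)] subunitD(1)[OF h(1)] by (intro continuous_intros)
    show "0 \<le> k x" for x using subunitD(2)[OF h(1)] by (simp add: k_def)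
    show "k x \<le> 1" for x
      using subunitD(4)[OF h(1), of x] subunitD(3)[OF f(1), of x] subunitD(3)[OF h(1), of x] e(1)
      by (cases "x \<in> F") (auto simp: k_def F_def)
    show "k x = 0" if "x \<notin> U" for x
      using subunitD(4)[OF h(1), of x] subunitD(4)[OF f(1), of x] that e(1) by (auto simp: k_def)
  qed
  have "L f - e = L (\<lambda>x. f x - e)" using L_diff[OF subunit_Brho[OF f(1)] Brho_const[of e]] L_const by simp
  also have "\<dots> \<le> L (\<lambda>x. max 0 (f x - e))"
    by (intro L_mono fB Brho_diff Brho_const subunit_Brho[OF f(1)]) auto
  finally have Lk: "L f + L h \<le> L k + e"
    using L_add[OF fB subunit_Brho[OF h(1)]] by (simp add: k_def)
  have "outer_content (A \<inter> V) + outer_content (A - V) \<le> inner_content (U \<inter> V) + inner_content (U - F)"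
    using U F V by (intro add_mono; subst outer_content_open[symmetric]; (intro outer_content_mono)?) auto
  also have "\<dots> \<le> ennreal (L f + e) + ennreal (L h + e)" by (intro add_mono f h)
  also have "\<dots> = ennreal (L f + L h + 2 * e)"
    using L_subunit(1)[OF f(1)] L_subunit(1)[OF h(1)] e by (subst ennreal_plus[symmetric]) auto
  also have "\<dots> \<le> ennreal (L k + 3 * e)" using Lk by (intro ennreal_leI) auto
  also have "\<dots> = ennreal (L k) + ennreal (3 * e)" using L_subunit(1)[OF k] e by (subst ennreal_plus) auto
  also have "\<dots> \<le> (outer_content A + ennreal e) + ennreal (3 * e)"
    by (intro add_mono order_trans[OF L_le_inner_content[OF k]] U order_refl)
  also have "\<dots> = outer_content A + ennreal e'"
    using e by (simp add: add.assoc e(2) flip: ennreal_plus)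
  finally show "outer_content (A \<inter> V) + outer_content (A - V) \<le> outer_content A + ennreal e'" .
qed

section \<open>The representing measure\<close>

definition riesz_measure :: "'a measure" where
  "riesz_measure = measure_of UNIV (sets borel) outer_content"

lemma sets_riesz[simp, measurable_cong]: "sets riesz_measure = sets borel"
  unfolding riesz_measure_def by (metis sets.sigma_sets_eq sets_measure_of space_borel subset_UNIV Pow_UNIV)

lemma space_riesz[simp]: "space riesz_measure = UNIV"
  using sets_eq_imp_space_eq[OF sets_riesz] by simp

text \<open>Open sets, hence all Borel sets, lie in the Caratheodory system of the outer content, on
  which it is countably additive.\<close>

lemma emeasure_riesz: assumes "A \<in> sets borel" shows "emeasure riesz_measure A = outer_content A"
proof -
  interpret P: sigma_algebra UNIV "UNIV :: 'a set set" by (metis Pow_UNIV sigma_algebra_Pow)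
  have oms: "outer_measure_space UNIV outer_content"
    unfolding outer_measure_space_def positive_def increasing_def countably_subadditive_def
    using outer_content_empty outer_content_mono outer_content_subadditive by auto
  define S where "S = lambda_system UNIV UNIV outer_content"
  have ms: "measure_space UNIV S outer_content"
    unfolding S_def by (rule P.caratheodory_lemma[OF oms])
  then interpret S: sigma_algebra UNIV S by (simp add: measure_space_def)
  have "V \<in> S" if "open V" for V
    unfolding S_def P.lambda_system_eq
    using outer_content_split_open[OF that] outer_content_add[of "x \<inter> V" "x - V" for x]
    by (auto intro!: antisym simp: Int_Diff_Un)
  then have sub: "sets borel \<subseteq> S"
    unfolding borel_def by (auto intro!: S.sigma_sets_subset)
  show ?thesis
  proof (rule emeasure_measure_of[OF riesz_measure_def])
    show "positive (sets riesz_measure) outer_content"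
      using outer_content_empty by (simp add: positive_def)
    show "countably_additive (sets riesz_measure) outer_content"
      using ms sub unfolding measure_space_def countably_additive_def sets_riesz by blast
  qed (use assms in auto)
qed

lemma prob_space_riesz: "prob_space riesz_measure"
proof
  have "(\<lambda>x. 1) \<in> subunit (UNIV :: 'a set)" by (rule subunitI) auto
  then have "1 \<le> inner_content UNIV" using L_le_inner_content[of "\<lambda>x. 1"] L_one by fastforce
  then show "emeasure riesz_measure (space riesz_measure) = 1"
    using inner_content_le_1[of UNIV] by (simp add: emeasure_riesz outer_content_open)
qed

sublocale riesz: prob_space riesz_measure by (rule prob_space_riesz)

lemma L_le_measure_riesz: assumes "open U" "f \<in> subunit U" shows "L f \<le> measure riesz_measure U"
proof -
  have "ennreal (L f) \<le> ennreal (measure riesz_measure U)"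
    using L_le_inner_content[OF assms(2)] assms(1)
    by (simp add: riesz.emeasure_eq_measure[symmetric] emeasure_riesz outer_content_open)
  then show ?thesis by simp
qed

lemma Cb_integrable_riesz: assumes "f \<in> Cb" shows "integrable riesz_measure f"
proof -
  obtain B where "\<And>x. \<bar>f x\<bar> \<le> B" using Cb_abs_bound[OF assms] by blast
  moreover have "f \<in> borel_measurable borel"
    using assms by (auto simp: Cb_def intro: borel_measurable_continuous_onI)
  ultimately show ?thesis by (intro riesz.integrable_const_bound[of _ B]) auto
qed

text \<open>A layer of \<open>f\<close> of height \<open>\<delta>\<close>, divided by
  \<open>\<delta>\<close>, is a test function for the open set where \<open>f\<close> exceeds the
  bottom of the layer, so its value is at most the measure of that set. Summing the layers costs
  only \<open>\<delta>\<close>.\<close>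

lemma L_le_integral_riesz:
  assumes f: "f \<in> subunit UNIV" shows "L f \<le> (\<integral>x. f x \<partial>riesz_measure)"
proof (rule field_le_epsilon)
  fix e :: real assume "e > 0"
  then obtain k where k: "1 / real (Suc k) < e" using reals_Archimedean by (auto simp: inverse_eq_divide)
  define \<delta> where "\<delta> = 1 / real (Suc k)"
  have \<delta>: "\<delta> > 0" "real (Suc k) * \<delta> = 1" "1 / \<delta> = real (Suc k)" by (auto simp: \<delta>_def)
  define s where "s i x = max 0 (min (f x - real i * \<delta>) \<delta>)" for i x
  have cf: "continuous_on UNIV f" by (rule subunitD(1)[OF f])
  have sU: "(\<lambda>x. (1 / \<delta>) * s i x) \<in> subunit {x. real i * \<delta> < f x}" for i
    using \<delta>(1) cf unfolding s_def
    by (intro subunitI continuous_intros) (auto simp: max_def min_def divide_simps)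
  have op: "open {x. real i * \<delta> < f x}" for i using cf by (intro open_Collect_less) auto
  have sB: "s i \<in> Brho \<rho>" for i
    using Brho_cmult[OF subunit_Brho[OF sU[of i]], of \<delta>] \<delta>(1) by simp
  have Ls: "L (s i) \<le> \<delta> * measure riesz_measure {x. real i * \<delta> < f x}" for i
  proof -
    have "(1 / \<delta>) * L (s i) \<le> measure riesz_measure {x. real i * \<delta> < f x}"
      using L_le_measure_riesz[OF op sU] unfolding L_cmult[OF sB] .
    then show ?thesis using \<delta>(1) by (simp add: divide_le_eq mult.commute)
  qed
  have "f x = (\<Sum>i<Suc k. s i x)" for x
    using slice_sum[OF subunitD(2)[OF f, of x] \<delta>(1), of "Suc k"] subunitD(3)[OF f, of x] \<delta>(2)
    by (simp add: s_def min_def)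
  then have "L f = L (\<lambda>x. \<Sum>i<Suc k. s i x)" by presburger
  also have "\<dots> = (\<Sum>i<Suc k. L (s i))" by (intro L_sum sB)
  also have "\<dots> \<le> (\<Sum>i<Suc k. \<delta> * measure riesz_measure {x. real i * \<delta> < f x})"
    by (intro sum_mono Ls)
  also have "\<dots> \<le> (\<integral>x. f x \<partial>riesz_measure) + \<delta>"
    using riesz.step_sum_measure_bounds(1)[OF borel_measurable_integrable[OF Cb_integrable_riesz[OF subunitD(5)[OF f]]]
        subunitD(2)[OF f] subunitD(3)[OF f] \<delta>(1,2)] by simp
  finally show "L f \<le> (\<integral>x. f x \<partial>riesz_measure) + e" using k by (auto simp: \<delta>_def)
qed

text \<open>The reverse inequality is \<open>L_le_integral_riesz\<close> for
  \<open>1 - f\<close>.\<close>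

lemma integral_riesz_unit:
  assumes f: "f \<in> subunit UNIV" shows "(\<integral>x. f x \<partial>riesz_measure) = L f"
proof (rule antisym)
  have "(\<lambda>x. 1 - f x) \<in> subunit UNIV"
    using subunitD[OF f] by (intro subunitI continuous_intros) auto
  from L_le_integral_riesz[OF this] show "(\<integral>x. f x \<partial>riesz_measure) \<le> L f"
    using L_diff[OF Brho_const[of 1] subunit_Brho[OF f]] L_one Cb_integrable_riesz[OF subunitD(5)[OF f]]
    by (simp add: riesz.prob_space[simplified])
qed (rule L_le_integral_riesz[OF f])

lemma integral_riesz_Cb:
  assumes f: "f \<in> Cb" shows "(\<integral>x. f x \<partial>riesz_measure) = L f"
proof -
  obtain B where B: "B > 0" "\<And>x. \<bar>f x\<bar> \<le> B" using Cb_abs_bound[OF f] by blast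
  \<comment> \<open>Affine rescaling from [-B, B] to [0, 1].\<close>
  define g where "g = (\<lambda>x. 1 / (2 * B) * f x + 1 / 2)"
  have g: "g \<in> subunit UNIV"
    using f B(1) B(2)[THEN abs_le_D1] B(2)[THEN abs_le_D2] unfolding g_def
    by (intro subunitI continuous_intros) (auto simp: Cb_def divide_simps, smt (verit))
  have "(\<integral>x. g x \<partial>riesz_measure) = 1 / (2 * B) * (\<integral>x. f x \<partial>riesz_measure) + 1 / 2"
    unfolding g_def using Cb_integrable_riesz[OF f] by (simp add: riesz.prob_space[simplified])
  moreover have "L g = 1 / (2 * B) * L f + 1 / 2"
    unfolding g_def L_add[OF Brho_cmult[OF Cb_Brho[OF f]] Brho_const] L_cmult[OF Cb_Brho[OF f]] L_const ..
  ultimately show ?thesis using integral_riesz_unit[OF g] B(1) by simp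
qed

text \<open>\<open>\<rho>\<close> itself need not lie in \<open>Brho \<rho>\<close>, so
  \<open>L\<close> cannot be applied to it. It is dominated by the sum of the indicators of the open
  sets where \<open>\<rho> > i\<close>, whose contents are nearly attained by test functions to
  which \<open>L_tight\<close> applies.\<close>

lemma nn_integral_rho_riesz:
  "(\<integral>\<^sup>+x. ennreal (\<rho> x) \<partial>riesz_measure) \<le> ennreal (c * (1 + 1 / rho_min))"
proof -
  have op: "open {x. real i < \<rho> x}" for i
    using closed_sublevel[of "real i"] by (simp add: closed_def Collect_neg_eq[symmetric] not_le)
  have "(\<Sum>i<n. emeasure riesz_measure {x. real i < \<rho> x}) \<le> ennreal (c * (1 + 1 / rho_min))" for n
  proof (rule ennreal_le_epsilon)
    fix e :: real assume e: "e > 0"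
    define e1 where "e1 = e / real (Suc n)"
    have e1: "e1 > 0" "real n * e1 \<le> e" using e by (auto simp: e1_def field_simps)
    have "\<exists>f. f \<in> subunit {x. real i < \<rho> x} \<and> inner_content {x. real i < \<rho> x} \<le> ennreal (L f + e1)" for i
      using inner_content_approx[OF e1(1)] by blast
    then obtain f where f: "\<And>i. f i \<in> subunit {x. real i < \<rho> x}"
      "\<And>i. inner_content {x. real i < \<rho> x} \<le> ennreal (L (f i) + e1)" by metis
    have "(\<Sum>i<n. f i x) \<le> (1 + 1 / rho_min) * \<rho> x" for x
    proof -
      have "(\<Sum>i<n. f i x) \<le> (\<Sum>i<n. if real i * 1 < \<rho> x then 1 else 0)"
        using subunitD(3,4)[OF f(1)] by (intro sum_mono) auto
      also have "\<dots> \<le> \<rho> x + 1" using rho_pos[of x] by (intro step_sum_le) auto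
      \<comment> \<open>The constant comes from absorbing the rounding error 1, as
        \<open>1 \<le> \<rho> x / rho_min\<close>.\<close>
      also have "\<dots> \<le> (1 + 1 / rho_min) * \<rho> x" using rho_min rho_min(2)[of x] by (auto simp: field_simps)
      finally show ?thesis .
    qed
    then have *: "(\<Sum>i<n. L (f i)) \<le> c * (1 + 1 / rho_min)"
      using L_tight[of "\<lambda>x. \<Sum>i<n. f i x" "1 + 1 / rho_min"] Brho_sum[of "{..<n}" f]
        L_sum[of "{..<n}" f] subunit_Brho[OF f(1)] rho_min(1) by auto
    have "(\<Sum>i<n. emeasure riesz_measure {x. real i < \<rho> x}) \<le> (\<Sum>i<n. ennreal (L (f i) + e1))"
      using f(2) op by (intro sum_mono) (auto simp: emeasure_riesz outer_content_open)
    also have "\<dots> = ennreal (\<Sum>i<n. (L (f i) + e1))"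
      using L_subunit(1)[OF f(1)] e1(1) by (intro sum_ennreal) (auto intro: add_nonneg_nonneg less_imp_le)
    also have "\<dots> \<le> ennreal (c * (1 + 1 / rho_min) + e)"
      using * e1 by (intro ennreal_leI) (auto simp: sum.distrib)
    also have "\<dots> = ennreal (c * (1 + 1 / rho_min)) + ennreal e"
      using c_nonneg rho_min(1) e by (intro ennreal_plus) auto
    finally show "(\<Sum>i<n. emeasure riesz_measure {x. real i < \<rho> x}) \<le> ennreal (c * (1 + 1 / rho_min)) + ennreal e" .
  qed
  then have b: "(\<Sum>i. emeasure riesz_measure {x. real i < \<rho> x}) \<le> ennreal (c * (1 + 1 / rho_min))"
    by (intro suminf_le_const) auto
  have "ennreal (\<rho> x) \<le> (\<Sum>i. indicator {x. real i < \<rho> x} x)" for x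
  proof -
    obtain n where n: "\<rho> x \<le> real n" using real_arch_simple by blast
    have "ennreal (\<rho> x) \<le> ennreal (\<Sum>i<n. if real i * 1 < \<rho> x then 1 else 0)"
      using step_sum_ge[of "\<rho> x" 1 n] rho_pos[of x] n by (intro ennreal_leI) auto
    also have "\<dots> = (\<Sum>i<n. indicator {x. real i < \<rho> x} x)"
      by (subst sum_ennreal[symmetric], force, intro sum.cong) (auto simp: indicator_def)
    also have "\<dots> \<le> (\<Sum>i. indicator {x. real i < \<rho> x} x)" by (intro sum_le_suminf) auto
    finally show ?thesis .
  qed
  then have "(\<integral>\<^sup>+x. ennreal (\<rho> x) \<partial>riesz_measure) \<le> (\<integral>\<^sup>+x. (\<Sum>i. indicator {x. real i < \<rho> x} x) \<partial>riesz_measure)"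
    by (intro nn_integral_mono)
  also have "\<dots> = (\<Sum>i. emeasure riesz_measure {x. real i < \<rho> x})"
    using op by (subst nn_integral_suminf) (auto intro!: suminf_cong nn_integral_indicator)
  finally show ?thesis using b by simp
qed

lemma integrable_rho_riesz: "integrable riesz_measure \<rho>"
  using nn_integral_rho_riesz rho_pos
  by (intro integrableI_nonneg) (auto simp: less_imp_le intro: le_less_trans[OF _ ennreal_less_top])

end

section \<open>Inner regularity and directed suprema\<close>

text \<open>The sets which, together with their complements, are approximable from inside by members
  of \<open>\<C>\<close> form a sigma-algebra. The class is abstract because the lemma serves both
  compact subsets of the space and measurable compact subsets of finite products.\<close>

lemma (in finite_measure) inner_approx_sigma_sets:
  assumes sets: "sets M = sigma_sets (space M) G" and G: "G \<subseteq> Pow (space M)"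
    and \<C>: "\<C> \<subseteq> sets M" "{} \<in> \<C>" "\<And>A B. A \<in> \<C> \<Longrightarrow> B \<in> \<C> \<Longrightarrow> A \<union> B \<in> \<C>"
      "\<And>C. range C \<subseteq> \<C> \<Longrightarrow> (\<Inter>n::nat. C n) \<in> \<C>"
    and top: "\<And>e. e > 0 \<Longrightarrow> \<exists>C\<in>\<C>. measure M (space M - C) < e"
    and gen: "\<And>A e. A \<in> G \<Longrightarrow> e > 0 \<Longrightarrow> \<exists>C\<in>\<C>. C \<subseteq> A \<and> measure M (A - C) < e"
      "\<And>A e. A \<in> G \<Longrightarrow> e > 0 \<Longrightarrow> \<exists>C\<in>\<C>. C \<subseteq> space M - A \<and> measure M (space M - A - C) < e"
    and A: "A \<in> sets M" and e: "e > 0"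
  shows "\<exists>C\<in>\<C>. C \<subseteq> A \<and> measure M (A - C) < e"
proof -
  define Q where "Q A \<longleftrightarrow> (\<forall>e>0. \<exists>C\<in>\<C>. C \<subseteq> A \<and> measure M (A - C) < e)" for A
  have fin_Un: "(\<Union>i<n. C i) \<in> \<C>" if "\<And>i. C i \<in> \<C>" for n and C :: "nat \<Rightarrow> _"
    using that by (induction n) (auto simp: lessThan_Suc intro: \<C>)
  have "A \<in> sigma_sets (space M) G" using A sets by simp
  then have "Q A \<and> Q (space M - A)"
  proof induction
    case (Basic a) then show ?case using gen by (auto simp: Q_def)
  next
    case Empty
    have "Q {}" unfolding Q_def using \<C>(2) by (intro allI impI bexI[of _ "{}"]) auto
    moreover have "\<exists>C\<in>\<C>. C \<subseteq> space M \<and> measure M (space M - C) < e" if "e > 0" for e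
      using top[OF that] \<C>(1) sets.sets_into_space[of _ M] by (meson subsetD)
    ultimately show ?case by (simp add: Q_def)
  next
    case (Compl a)
    then have "space M - (space M - a) = a" using sets sets.sets_into_space[of a M] by (auto simp: double_diff)
    then show ?case using Compl by simp
  next
    case (Union a)
    have am: "a i \<in> sets M" for i using Union(1) sets by simp
    \<comment> \<open>Errors with total \<open>e / 2\<close>, so that their sum stays strictly below
      \<open>e\<close>.\<close>
    define q where "q e i = e / 2 * (1/2)^Suc i" for e :: real and i
    have hs: "q e sums (e / 2)" for e
      using sums_mult[OF power_half_series, of "e / 2"] by (simp add: q_def[abs_def])
    have qpos: "q e i > 0" if "e > 0" for e i using that by (simp add: q_def)
    have small: "measure M D < e"
      if "\<And>i. D' i \<in> sets M" "\<And>i. measure M (D' i) < q e i" "e > 0" "D \<subseteq> (\<Union>i. D' i)" for D D' e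
    proof -
      have sm: "summable (\<lambda>i. measure M (D' i))"
        using that(2) by (intro summable_comparison_test'[OF sums_summable[OF hs[of e]], of 0]) (auto simp: less_imp_le)
      have "measure M D \<le> measure M (\<Union>i. D' i)" using that by (intro finite_measure_mono) auto
      also have "\<dots> \<le> (\<Sum>i. measure M (D' i))" using that sm by (intro finite_measure_subadditive_countably) auto
      also have "\<dots> \<le> (\<Sum>i. q e i)" using that(2) by (intro suminf_le sm sums_summable[OF hs] less_imp_le)
      also have "\<dots> = e / 2" using hs by (simp add: sums_iff)
      also have "\<dots> < e" using that by simp
      finally show ?thesis .
    qed
    have "Q (\<Union>i. a i)"
      unfolding Q_def
    proof (intro allI impI)
      fix e :: real assume e: "e > 0"
      have "\<exists>C\<in>\<C>. C \<subseteq> a i \<and> measure M (a i - C) < q e i" for i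
        using Union(2)[of i] qpos[OF e, of i] by (simp add: Q_def)
      then obtain C where C: "\<And>i. C i \<in> \<C>" "\<And>i. C i \<subseteq> a i" "\<And>i. measure M (a i - C i) < q e i" by metis
      have Cm: "C i \<in> sets M" for i using C(1) \<C>(1) by blast
      have 1: "measure M ((\<Union>i. a i) - (\<Union>i. C i)) < e"
        by (rule small[OF sets.Diff[OF am Cm] C(3) e]) blast
      \<comment> \<open>The countable union of the \<open>C i\<close> need not lie in
        \<open>\<C>\<close>; continuity from above lets a finite union take its place.\<close>
      have "(\<lambda>n. measure M ((\<Union>i. a i) - (\<Union>i<n. C i))) \<longlonglongrightarrow> measure M (\<Inter>n. (\<Union>i. a i) - (\<Union>i<n. C i))"
        using am Cm by (intro finite_Lim_measure_decseq) (auto simp: decseq_def)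
      moreover have "(\<Inter>n. (\<Union>i. a i) - (\<Union>i<n. C i)) = (\<Union>i. a i) - (\<Union>i. C i)" by blast
      ultimately have "\<forall>\<^sub>F n in sequentially. measure M ((\<Union>i. a i) - (\<Union>i<n. C i)) < e"
        using 1 by (auto intro: order_tendstoD)
      then obtain n where "measure M ((\<Union>i. a i) - (\<Union>i<n. C i)) < e"
        using eventually_happens by force
      then show "\<exists>C\<in>\<C>. C \<subseteq> (\<Union>i. a i) \<and> measure M ((\<Union>i. a i) - C) < e"
        using fin_Un[of C n, OF C(1)] C(2) by (intro bexI[of _ "\<Union>i<n. C i"]) auto
    qed
    moreover have "Q (space M - (\<Union>i. a i))"
      unfolding Q_def
    proof (intro allI impI)
      fix e :: real assume e: "e > 0"
      have "\<exists>C\<in>\<C>. C \<subseteq> space M - a i \<and> measure M (space M - a i - C) < q e i" for i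
        using Union(2)[of i] qpos[OF e, of i] by (simp add: Q_def)
      then obtain C where C: "\<And>i. C i \<in> \<C>" "\<And>i. C i \<subseteq> space M - a i"
        "\<And>i. measure M (space M - a i - C i) < q e i" by metis
      have Cm: "C i \<in> sets M" for i using C(1) \<C>(1) by blast
      have "measure M (space M - (\<Union>i. a i) - (\<Inter>i. C i)) < e"
        by (rule small[OF sets.Diff[OF sets.compl_sets[OF am] Cm] C(3) e]) blast
      moreover have "(\<Inter>i. C i) \<in> \<C>" "(\<Inter>i. C i) \<subseteq> space M - (\<Union>i. a i)"
        using C(1,2) by (auto intro!: \<C>(4)) blast
      ultimately show "\<exists>C\<in>\<C>. C \<subseteq> space M - (\<Union>i. a i) \<and> measure M (space M - (\<Union>i. a i) - C) < e"
        by blast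
    qed
    ultimately show ?case by blast
  qed
  then show ?thesis using e by (auto simp: Q_def)
qed

context weighted
begin

section \<open>Radon probability measures with integrable weight\<close>

lemma prob_in_MrhoD:
  assumes "prob_in_Mrho \<rho> \<nu>"
  shows "sets \<nu> = sets borel" "space \<nu> = UNIV" "prob_space \<nu>" "integrable \<nu> \<rho>"
  using assms sets_eq_imp_space_eq[of \<nu> borel] by (auto simp: prob_in_Mrho_def)

lemma prob_in_Mrho_approx:
  assumes "prob_in_Mrho \<rho> \<nu>" "A \<in> sets borel" "e > 0"
  shows "\<exists>K. compact K \<and> K \<subseteq> A \<and> measure \<nu> A < measure \<nu> K + e"
proof -
  interpret prob_space \<nu> using prob_in_MrhoD[OF assms(1)] by simp
  have 1: "emeasure \<nu> A = (SUP K\<in>{K. compact K \<and> K \<subseteq> A}. emeasure \<nu> K)"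
    using assms by (auto simp: prob_in_Mrho_def)
  have 2: "{K. compact K \<and> K \<subseteq> A} \<noteq> {}" by (auto intro!: exI[of _ "{}"])
  have "\<exists>K\<in>{K. compact K \<and> K \<subseteq> A}. emeasure \<nu> A < emeasure \<nu> K + ennreal e"
    by (rule SUP_approx_ennreal[OF assms(3) 2 1]) (simp add: emeasure_eq_measure)
  then obtain K where K: "compact K" "K \<subseteq> A" "emeasure \<nu> A < emeasure \<nu> K + ennreal e" by auto
  have "ennreal (measure \<nu> A) < ennreal (measure \<nu> K + e)"
    using K(3) assms(3) by (simp add: emeasure_eq_measure)
  then have "measure \<nu> A < measure \<nu> K + e" using assms(3) by (subst (asm) ennreal_less_iff) auto
  with K show ?thesis by blast
qed

lemma markov_sublevel:
  assumes \<nu>: "sets \<nu> = sets borel" "prob_space \<nu>" "integrable \<nu> \<rho>" and "R > 0"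
  shows "measure \<nu> {x. R < \<rho> x} \<le> (\<integral>x. \<rho> x \<partial>\<nu>) / R"
proof -
  interpret prob_space \<nu> by fact
  have sp: "space \<nu> = UNIV" using sets_eq_imp_space_eq[OF \<nu>(1)] by simp
  have "measure \<nu> {x. R < \<rho> x} \<le> measure \<nu> {x \<in> space \<nu>. R \<le> \<rho> x}"
    using \<nu>(1) sp by (intro finite_measure_mono) (auto simp: measurable_cong_sets[OF \<nu>(1) refl])
  also have "\<dots> \<le> (\<integral>x. \<rho> x \<partial>\<nu>) / R"
    using \<nu> rho_pos \<open>R > 0\<close> by (intro integral_Markov_inequality_measure[of _ _ "{}"]) (auto simp: less_imp_le)
  finally show ?thesis .
qed

lemma sublevel_tight:
  assumes \<nu>: "sets \<nu> = sets borel" "prob_space \<nu>" "integrable \<nu> \<rho>" and e: "e > 0"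
  obtains R where "R > 0" "measure \<nu> {x. R < \<rho> x} < e"
proof -
  define I where "I = (\<integral>x. \<rho> x \<partial>\<nu>)"
  have I: "I \<ge> 0" unfolding I_def using rho_pos by (intro integral_nonneg_AE AE_I2) (auto simp: less_imp_le)
  define R where "R = (I + 1) / e"
  have R: "R > 0" "I / R < e" using I e by (auto simp: R_def field_simps)
  from markov_sublevel[OF \<nu> R(1)] R show thesis by (intro that[of R]) (auto simp: I_def)
qed

text \<open>Open sets are enough: a closed set is approximated by its intersections with sublevel
  sets, which are compact and miss little mass by Markov's inequality, and
  \<open>inner_approx_sigma_sets\<close> extends this to all Borel sets.\<close>

lemma prob_in_MrhoI:
  assumes \<nu>: "sets \<nu> = sets borel" "prob_space \<nu>" "integrable \<nu> \<rho>"
    and op: "\<And>U e. open U \<Longrightarrow> e > 0 \<Longrightarrow> \<exists>K. compact K \<and> K \<subseteq> U \<and> measure \<nu> U < measure \<nu> K + e"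
  shows "prob_in_Mrho \<rho> \<nu>"
proof -
  interpret prob_space \<nu> by fact
  note [measurable_cong] = \<nu>(1)
  have sp: "space \<nu> = UNIV" using sets_eq_imp_space_eq[OF \<nu>(1)] by simp
  have cm: "K \<in> sets \<nu>" if "compact K" for K
    using compact_imp_closed_Hausdorff[OF that] \<nu>(1) by auto
  have *: "\<exists>K\<in>Collect compact. K \<subseteq> A \<and> measure \<nu> (A - K) < e" if A: "A \<in> sets borel" "e > 0" for A e
  proof (rule inner_approx_sigma_sets[where G = "Collect open"])
    show "sets \<nu> = sigma_sets (space \<nu>) (Collect open)" using \<nu>(1) sp by (simp add: borel_def)
    show "(\<Inter>n. C n) \<in> Collect compact" if "range C \<subseteq> Collect compact" for C :: "nat \<Rightarrow> 'a set"
    proof -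
      have "compact (C 0 \<inter> (\<Inter>n. C n))"
      proof (intro compact_Int_closed closed_INT ballI)
        have "compact (C n)" for n using that by auto
        then show "compact (C 0)" "closed (C n)" for n using compact_imp_closed_Hausdorff by auto
      qed
      moreover have "C 0 \<inter> (\<Inter>n. C n) = (\<Inter>n. C n)" by blast
      ultimately show ?thesis by simp
    qed
    show "\<exists>K\<in>Collect compact. K \<subseteq> U \<and> measure \<nu> (U - K) < e" if U: "U \<in> Collect open" "e > 0" for U e
    proof -
      obtain K where K: "compact K" "K \<subseteq> U" "measure \<nu> U < measure \<nu> K + e" using op U by blast
      then show ?thesis using finite_measure_Diff[of U K] cm[of K] U \<nu>(1) by (intro bexI[of _ K]) auto
    qed
    have clos: "\<exists>K\<in>Collect compact. K \<subseteq> F \<and> measure \<nu> (F - K) < e" if F: "closed F" "e > 0" for F e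
    proof -
      obtain R where R: "R > 0" "measure \<nu> {x. R < \<rho> x} < e" using sublevel_tight[OF \<nu> F(2)] by blast
      have "measure \<nu> (F - {x. \<rho> x \<le> R} \<inter> F) \<le> measure \<nu> {x. R < \<rho> x}"
        using F(1) by (intro finite_measure_mono) (auto simp: measurable_cong_sets[OF \<nu>(1) refl] \<nu>(1))
      then show ?thesis using R F(1) compact_Int_closed[OF compact_sublevel[of R] F(1)]
        by (intro bexI[of _ "{x. \<rho> x \<le> R} \<inter> F"]) auto
    qed
    show "\<exists>K\<in>Collect compact. K \<subseteq> space \<nu> - U \<and> measure \<nu> (space \<nu> - U - K) < e" if "U \<in> Collect open" "e > 0" for U e
      using clos[of "space \<nu> - U" e] that sp by (auto simp: Compl_eq_Diff_UNIV[symmetric])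
    show "\<exists>K\<in>Collect compact. measure \<nu> (space \<nu> - K) < e" if "e > 0" for e
      using clos[of UNIV e] that sp by auto
  qed (use A cm \<nu>(1) sp in auto)
  have "emeasure \<nu> A = (SUP K\<in>{K. compact K \<and> K \<subseteq> A}. emeasure \<nu> K)" if A: "A \<in> sets borel" for A
  proof (rule ennreal_approx_SUP)
    show "emeasure \<nu> K \<le> emeasure \<nu> A" if "K \<in> {K. compact K \<and> K \<subseteq> A}" for K
      using that A \<nu>(1) by (auto intro!: emeasure_mono)
    fix e :: real assume e: "e > 0"
    obtain K where K: "compact K" "K \<subseteq> A" "measure \<nu> (A - K) < e" using *[OF A e] by auto
    then have "measure \<nu> A \<le> measure \<nu> K + e"
      using finite_measure_Diff[of A K] cm[of K] A \<nu>(1) by auto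
    then have "ennreal (measure \<nu> A) \<le> ennreal (measure \<nu> K + e)" by (rule ennreal_leI)
    then have "emeasure \<nu> A \<le> emeasure \<nu> K + ennreal e" using e by (simp add: emeasure_eq_measure)
    then show "\<exists>K\<in>{K. compact K \<and> K \<subseteq> A}. emeasure \<nu> A \<le> emeasure \<nu> K + ennreal e" using K by blast
  qed
  then show ?thesis using \<nu> by (simp add: prob_in_Mrho_def)
qed

lemma directed_finite_upper_bound:
  assumes "finite D" "D \<subseteq> \<F>" "\<F> \<noteq> {}"
    and "\<And>f g. f \<in> \<F> \<Longrightarrow> g \<in> \<F> \<Longrightarrow> \<exists>h\<in>\<F>. \<forall>x. f x \<le> h x \<and> g x \<le> (h x :: real)"
  shows "\<exists>h\<in>\<F>. \<forall>f\<in>D. \<forall>x. f x \<le> h x"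
  using assms(1,2)
proof (induction D rule: finite_induct)
  case empty then show ?case using assms(3) by auto
next
  case (insert f D)
  then obtain g where "g \<in> \<F>" "\<forall>f\<in>D. \<forall>x. f x \<le> g x" by auto
  moreover obtain h where "h \<in> \<F>" "\<forall>x. f x \<le> h x \<and> g x \<le> h x"
    using assms(4)[of f g] insert.prems \<open>g \<in> \<F>\<close> by auto
  ultimately show ?case by (intro bexI[of _ h]) (auto intro: order_trans)
qed

text \<open>This is the \<open>\<tau>\<close>-additivity. For one level, a compact subset of the
  superlevel set of the supremum is cut down to a sublevel set of \<open>\<rho>\<close>. There the
  superlevel sets of the members are relatively open, finitely many cover, and directedness supplies
  one member above these. Finitely many levels are combined by the layer-cake bounds.\<close>

lemma directed_SUP_integral:
  fixes \<F> :: "('a \<Rightarrow> real) set"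
  assumes \<nu>: "prob_in_Mrho \<rho> \<nu>" and ne: "\<F> \<noteq> {}"
    and cont: "\<And>f R. f \<in> \<F> \<Longrightarrow> continuous_on {x. \<rho> x \<le> R} f"
    and bd: "\<And>f x. f \<in> \<F> \<Longrightarrow> 0 \<le> f x" "\<And>f x. f \<in> \<F> \<Longrightarrow> f x \<le> 1"
    and dir: "\<And>f g. f \<in> \<F> \<Longrightarrow> g \<in> \<F> \<Longrightarrow> \<exists>h\<in>\<F>. \<forall>x. f x \<le> h x \<and> g x \<le> h x"
    and e: "e > 0"
  shows "\<exists>f\<in>\<F>. (\<integral>x. (SUP f\<in>\<F>. f x) \<partial>\<nu>) \<le> (\<integral>x. f x \<partial>\<nu>) + e"
proof -
  define G where "G x = (SUP f\<in>\<F>. f x)" for x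
  have bdd: "bdd_above ((\<lambda>f. f x) ` \<F>)" for x using bd(2) by (auto intro!: bdd_aboveI[of _ 1])
  have less_G: "r < G x \<longleftrightarrow> (\<exists>f\<in>\<F>. r < f x)" for r x
    unfolding G_def using less_cSUP_iff[OF ne bdd] by simp
  have fG: "f x \<le> G x" if "f \<in> \<F>" for f x unfolding G_def using that bdd by (intro cSUP_upper)
  have G01: "0 \<le> G x" "G x \<le> 1" for x
    using ne bd fG by (auto simp: G_def intro!: cSUP_least) (meson all_not_in_conv order_trans)
  have Gm: "G \<in> borel_measurable borel"
    by (rule borel_measurable_sublevelI)
       (use sublevel_greater_borel[of \<F> _ "\<lambda>f. f"] cont in \<open>simp add: less_G\<close>)
  have fm: "f \<in> borel_measurable borel" if "f \<in> \<F>" for f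
    by (rule borel_measurable_sublevelI)
       (use sublevel_greater_borel[of "{f}" _ "\<lambda>f. f"] cont[OF that] in simp)
  note D = prob_in_MrhoD[OF \<nu>]
  interpret prob_space \<nu> by (rule D)
  have mb: "measurable \<nu> = measurable borel" by (intro ext measurable_cong_sets D refl)
  have level: "\<exists>f\<in>\<F>. measure \<nu> {x. r < G x} \<le> measure \<nu> {x. r < f x} + e" if e: "e > 0" for r e
  proof -
    have e2: "e / 2 > 0" using e by simp
    have gs: "{x. r < G x} \<in> sets borel" using Gm by measurable
    obtain K where K: "compact K" "K \<subseteq> {x. r < G x}" "measure \<nu> {x. r < G x} < measure \<nu> K + e / 2"
      using prob_in_Mrho_approx[OF \<nu> gs e2] by blast
    obtain R where R: "R > 0" "measure \<nu> {x. R < \<rho> x} < e / 2"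
      using sublevel_tight[OF D(1,3,4) e2] by blast
    define C where "C = K \<inter> {x. \<rho> x \<le> R}"
    have Cc: "compact C" unfolding C_def by (intro compact_Int_closed K closed_sublevel)
    have "\<exists>W. open W \<and> W \<inter> {x. \<rho> x \<le> R} = f -` {r<..} \<inter> {x. \<rho> x \<le> R}" if "f \<in> \<F>" for f
      using continuous_on_open_invariant[THEN iffD1, OF cont[OF that], rule_format, of "{r<..}"] by simp
    then obtain W where W: "\<And>f. f \<in> \<F> \<Longrightarrow> open (W f)"
      "\<And>f. f \<in> \<F> \<Longrightarrow> W f \<inter> {x. \<rho> x \<le> R} = f -` {r<..} \<inter> {x. \<rho> x \<le> R}" by metis
    have "C \<subseteq> (\<Union>f\<in>\<F>. W f)"
    proof
      fix x assume x: "x \<in> C"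
      then obtain f where "f \<in> \<F>" "r < f x" using K(2) less_G by (auto simp: C_def)
      then show "x \<in> (\<Union>f\<in>\<F>. W f)" using W(2)[of f] x by (auto simp: C_def)
    qed
    then obtain \<D> where \<D>: "\<D> \<subseteq> \<F>" "finite \<D>" "C \<subseteq> (\<Union>f\<in>\<D>. W f)"
      using compactE_image[OF Cc, of \<F> W] W(1) by auto
    obtain h where h: "h \<in> \<F>" "\<And>f x. f \<in> \<D> \<Longrightarrow> f x \<le> h x"
      using directed_finite_upper_bound[OF \<D>(2,1) ne dir] by blast
    have "C \<subseteq> {x. r < h x}"
    proof
      fix x assume x: "x \<in> C"
      then obtain f where f: "f \<in> \<D>" "x \<in> W f" using \<D>(3) by auto
      then have "r < f x" using W(2)[of f] \<D>(1) x by (auto simp: C_def)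
      then show "x \<in> {x. r < h x}" using h(2)[OF f(1), of x] by auto
    qed
    then have "K \<subseteq> {x. r < h x} \<union> {x. R < \<rho> x}" by (auto simp: C_def)
    moreover have hs: "{x. r < h x} \<in> sets \<nu>" "{x. R < \<rho> x} \<in> sets \<nu>"
      using fm[OF h(1)] D(1) by (auto simp: D(1))
    ultimately have "measure \<nu> K \<le> measure \<nu> ({x. r < h x} \<union> {x. R < \<rho> x})"
      by (intro finite_measure_mono) auto
    also have "\<dots> \<le> measure \<nu> {x. r < h x} + measure \<nu> {x. R < \<rho> x}"
      using hs by (intro measure_Un_le)
    finally show ?thesis using K R h(1) by (intro bexI[of _ h]) auto
  qed
  show "\<exists>f\<in>\<F>. (\<integral>x. (SUP f\<in>\<F>. f x) \<partial>\<nu>) \<le> (\<integral>x. f x \<partial>\<nu>) + e"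
  proof -
    have "e / 2 > 0" using e by simp
    then obtain k where k: "1 / real (Suc k) < e / 2" using reals_Archimedean unfolding inverse_eq_divide by blast
    define \<delta> where "\<delta> = 1 / real (Suc k)"
    have \<delta>: "\<delta> > 0" "real (Suc k) * \<delta> = 1" by (auto simp: \<delta>_def)
    \<comment> \<open>Each level yields its own member of the family; directedness merges them into
      a single \<open>h\<close>.\<close>
    have "\<exists>f. f \<in> \<F> \<and> measure \<nu> {x. real i * \<delta> < G x} \<le> measure \<nu> {x. real i * \<delta> < f x} + e / 2" for i
      using level[of "e/2" "real i * \<delta>"] e by auto
    then obtain F where F: "\<And>i. F i \<in> \<F>"
      "\<And>i. measure \<nu> {x. real i * \<delta> < G x} \<le> measure \<nu> {x. real i * \<delta> < F i x} + e / 2" by metis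
    obtain h where h: "h \<in> \<F>" "\<And>i x. i < Suc k \<Longrightarrow> F i x \<le> h x"
      using directed_finite_upper_bound[of "F ` {..<Suc k}", OF _ _ ne dir] F(1) by blast
    have "(\<integral>x. G x \<partial>\<nu>) \<le> (\<Sum>i<Suc k. \<delta> * measure \<nu> {x\<in>space \<nu>. real i * \<delta> < G x})"
      using Gm G01 \<delta> by (intro step_sum_measure_bounds) (auto simp: mb)
    also have "\<dots> \<le> (\<Sum>i<Suc k. \<delta> * (measure \<nu> {x\<in>space \<nu>. real i * \<delta> < h x} + e / 2))"
    proof (intro sum_mono mult_left_mono)
      fix i assume i: "i \<in> {..<Suc k}"
      have "measure \<nu> {x. real i * \<delta> < F i x} \<le> measure \<nu> {x. real i * \<delta> < h x}"
        using fm[OF h(1)] h(2)[of i] i by (intro finite_measure_mono) (auto simp: D(1) intro: less_le_trans)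
      then show "measure \<nu> {x\<in>space \<nu>. real i * \<delta> < G x} \<le> measure \<nu> {x\<in>space \<nu>. real i * \<delta> < h x} + e / 2"
        using F(2)[of i] D(2) by simp
    qed (use \<delta> in simp)
    also have "\<dots> = (\<Sum>i<Suc k. \<delta> * measure \<nu> {x\<in>space \<nu>. real i * \<delta> < h x}) + real (Suc k) * \<delta> * (e / 2)"
      by (simp add: ring_distribs sum.distrib del: sum.lessThan_Suc)
    also have "\<dots> \<le> ((\<integral>x. h x \<partial>\<nu>) + \<delta>) + e / 2"
      unfolding \<delta>(2) mult_1 using fm[OF h(1)] bd h(1) \<delta>
      by (intro add_right_mono step_sum_measure_bounds) (auto simp: mb)
    finally show ?thesis using k h(1) by (intro bexI[of _ h]) (auto simp: \<delta>_def G_def)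
  qed
qed

lemma Brho_integrable:
  assumes \<nu>: "sets \<nu> = sets borel" "integrable \<nu> \<rho>" and f: "f \<in> Brho \<rho>"
  shows "integrable \<nu> f"
proof (rule Bochner_Integration.integrable_bound)
  show "integrable \<nu> (\<lambda>x. wnorm \<rho> f * \<rho> x)" using \<nu> by simp
  show "f \<in> borel_measurable \<nu>" using Brho_borel[OF f] by (simp add: measurable_cong_sets[OF \<nu>(1) refl])
  show "AE x in \<nu>. norm (f x) \<le> norm (wnorm \<rho> f * \<rho> x)"
    using Brho_bound[OF f] by (intro AE_I2) (auto intro: order_trans[OF _ abs_ge_self])
qed

lemma integral_diff_le_rho:
  assumes "integrable \<nu> f" "integrable \<nu> g" "integrable \<nu> \<rho>" "\<And>x. \<bar>f x - g x\<bar> \<le> \<epsilon> * \<rho> x"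
  shows "\<bar>(\<integral>x. f x \<partial>\<nu>) - (\<integral>x. g x \<partial>\<nu>)\<bar> \<le> \<epsilon> * (\<integral>x. \<rho> x \<partial>\<nu>)"
proof -
  have "\<bar>\<integral>x. f x - g x \<partial>\<nu>\<bar> \<le> (\<integral>x. \<bar>f x - g x\<bar> \<partial>\<nu>)" by (rule integral_abs_bound)
  also have "\<dots> \<le> (\<integral>x. \<epsilon> * \<rho> x \<partial>\<nu>)" using assms by (intro integral_mono) auto
  finally show ?thesis using assms by simp
qed

lemma wnorm_nonneg: "f \<in> Brho \<rho> \<Longrightarrow> 0 \<le> wnorm \<rho> f"
  using Brho_bound[of f undefined] rho_pos[of undefined] abs_ge_zero[of "f undefined"]
  by (meson order_trans zero_le_mult_iff not_le)

end

context weighted_functional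
begin

lemma L_diff_le:
  assumes "f \<in> Brho \<rho>" "g \<in> Brho \<rho>" "\<epsilon> \<ge> 0" "\<And>x. \<bar>f x - g x\<bar> \<le> \<epsilon> * \<rho> x"
  shows "\<bar>L f - L g\<bar> \<le> c * \<epsilon>"
proof -
  have "L (\<lambda>x. f x - g x) \<le> c * \<epsilon>" "L (\<lambda>x. g x - f x) \<le> c * \<epsilon>"
    using assms(4)[THEN abs_le_D1] assms(4)[THEN abs_le_D2] assms by (auto intro!: L_tight Brho_diff)
  then show ?thesis using L_diff[OF assms(1,2)] L_diff[OF assms(2,1)] by linarith
qed

text \<open>Both sides are Lipschitz in the weighted norm, \<open>L\<close> with constant
  \<open>c\<close> and the integral with constant \<open>I\<close>, so the density of
  \<open>Cb\<close> is enough.\<close>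

lemma integral_riesz_Brho:
  assumes f: "f \<in> Brho \<rho>" shows "(\<integral>x. f x \<partial>riesz_measure) = L f"
proof -
  define I where "I = (\<integral>x. \<rho> x \<partial>riesz_measure)"
  have I: "I \<ge> 0" unfolding I_def using rho_pos by (intro integral_nonneg_AE AE_I2) (auto simp: less_imp_le)
  have "\<bar>(\<integral>x. f x \<partial>riesz_measure) - L f\<bar> \<le> 0 + e" if e: "e > 0" for e
  proof -
    define \<epsilon> where "\<epsilon> = e / (I + c + 1)"
    have \<epsilon>: "\<epsilon> > 0" "\<epsilon> * (I + c) \<le> e" using I c_nonneg e by (auto simp: \<epsilon>_def field_simps)
    obtain g where g: "g \<in> Cb" "\<And>x. \<bar>f x - g x\<bar> \<le> \<epsilon> * \<rho> x" using Brho_approx[OF f \<epsilon>(1)] by blast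
    have "\<bar>(\<integral>x. f x \<partial>riesz_measure) - (\<integral>x. g x \<partial>riesz_measure)\<bar> \<le> \<epsilon> * I"
      unfolding I_def by (intro integral_diff_le_rho g integrable_rho_riesz Cb_integrable_riesz
          Brho_integrable[OF sets_riesz integrable_rho_riesz f])
    moreover have "\<bar>L f - L g\<bar> \<le> c * \<epsilon>"
      using \<epsilon>(1) by (intro L_diff_le f Cb_Brho g) auto
    ultimately show ?thesis using integral_riesz_Cb[OF g(1)] \<epsilon>(2) by (auto simp: algebra_simps)
  qed
  then have "\<bar>(\<integral>x. f x \<partial>riesz_measure) - L f\<bar> \<le> 0" by (rule field_le_epsilon)
  then show ?thesis by simp
qed

text \<open>The form on which measurability of the kernel in x and the Chapman-Kolmogorov equation
  rest: a supremum over a directed family.\<close>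

lemma measure_riesz_open:
  assumes U: "open U" shows "measure riesz_measure U = (SUP f\<in>subunit U. L f)"
proof (rule antisym)
  have bdd: "bdd_above (L ` subunit U)" using L_subunit(2) by (auto intro!: bdd_aboveI[of _ 1])
  show "(SUP f\<in>subunit U. L f) \<le> measure riesz_measure U"
    using zero_subunit[of U] L_le_measure_riesz[OF U] by (intro cSUP_least) auto
  show "measure riesz_measure U \<le> (SUP f\<in>subunit U. L f)"
  proof (rule field_le_epsilon)
    fix e :: real assume e: "e > 0"
    obtain f where f: "f \<in> subunit U" "inner_content U \<le> ennreal (L f + e)"
      using inner_content_approx[OF e, of U] by blast
    have "ennreal (measure riesz_measure U) \<le> ennreal (L f + e)"
      using f(2) U by (simp add: riesz.emeasure_eq_measure[symmetric] emeasure_riesz outer_content_open)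
    then have "measure riesz_measure U \<le> L f + e"
      using L_subunit(1)[OF f(1)] e by (subst (asm) ennreal_le_iff) auto
    also have "L f \<le> (SUP f\<in>subunit U. L f)" using f(1) bdd by (intro cSUP_upper)
    finally show "measure riesz_measure U \<le> (SUP f\<in>subunit U. L f) + e" by simp
  qed
qed

end

section \<open>Transition kernels\<close>

locale feller = weighted \<rho> for \<rho> :: "'a::topological_space \<Rightarrow> real" +
  fixes P :: "real \<Rightarrow> ('a \<Rightarrow> real) \<Rightarrow> ('a \<Rightarrow> real)"
  assumes gen_feller: "gen_feller_semigroup \<rho> P"
    and P_one: "\<And>t. t \<ge> 0 \<Longrightarrow> P t (\<lambda>x. 1) = (\<lambda>x. 1)"
begin

section \<open>Algebraic, order and boundedness properties of the operators\<close>

lemma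
  assumes "t \<ge> 0" "f \<in> Brho \<rho>"
  shows P_Brho: "P t f \<in> Brho \<rho>"
    and P_add: "g \<in> Brho \<rho> \<Longrightarrow> P t (\<lambda>x. f x + g x) = (\<lambda>x. P t f x + P t g x)"
    and P_cmult: "P t (\<lambda>x. c * f x) = (\<lambda>x. c * P t f x)"
    and P_nonneg: "(\<And>x. 0 \<le> f x) \<Longrightarrow> 0 \<le> P t f x"
    and P_semigroup: "s \<ge> 0 \<Longrightarrow> P (t + s) f = P s (P t f)"
proof -
  note * = gen_feller[unfolded gen_feller_semigroup_def]
  note ops = *[THEN conjunct1, rule_format, OF assms(1)]
  show "P t f \<in> Brho \<rho>" by (rule ops[THEN conjunct1, rule_format, OF assms(2)])
  show "g \<in> Brho \<rho> \<Longrightarrow> P t (\<lambda>x. f x + g x) = (\<lambda>x. P t f x + P t g x)"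
    by (rule ops[THEN conjunct2, THEN conjunct1, rule_format, OF assms(2)])
  show "P t (\<lambda>x. c * f x) = (\<lambda>x. c * P t f x)"
    by (rule ops[THEN conjunct2, THEN conjunct2, THEN conjunct1, rule_format, OF assms(2)])
  show "s \<ge> 0 \<Longrightarrow> P (t + s) f = P s (P t f)"
    using *[THEN conjunct2, THEN conjunct2, THEN conjunct1] assms by simp
  show "(\<And>x. 0 \<le> f x) \<Longrightarrow> 0 \<le> P t f x"
    using *[THEN conjunct2, THEN conjunct2, THEN conjunct2, THEN conjunct2, THEN conjunct2] assms by simp
qed

lemma P_0: "f \<in> Brho \<rho> \<Longrightarrow> P 0 f = f"
  using gen_feller[unfolded gen_feller_semigroup_def, THEN conjunct2, THEN conjunct1] by simp

lemma P_tendsto: "f \<in> Brho \<rho> \<Longrightarrow> ((\<lambda>t. P t f x) \<longlongrightarrow> f x) (at_right 0)"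
  using gen_feller[unfolded gen_feller_semigroup_def, THEN conjunct2, THEN conjunct2, THEN conjunct2, THEN conjunct1]
  by simp

text \<open>Nonnegativity is built in because the bounds granted by the semigroup are arbitrary
  reals, while the inequalities below multiply by \<open>C\<close>.\<close>

definition opbound :: "real \<Rightarrow> real \<Rightarrow> bool" where
  "opbound t C \<longleftrightarrow> C \<ge> 0 \<and> (\<forall>f\<in>Brho \<rho>. wnorm \<rho> (P t f) \<le> C * wnorm \<rho> f)"

lemma opboundI:
  assumes "\<forall>f\<in>Brho \<rho>. wnorm \<rho> (P t f) \<le> C * wnorm \<rho> f" shows "opbound t (max 0 C)"
  unfolding opbound_def
proof (intro conjI ballI)
  fix f assume f: "f \<in> Brho \<rho>"
  have "C * wnorm \<rho> f \<le> max 0 C * wnorm \<rho> f" using wnorm_nonneg[OF f] by (intro mult_right_mono) auto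
  then show "wnorm \<rho> (P t f) \<le> max 0 C * wnorm \<rho> f" using assms f by fastforce
qed simp

lemma opbound_exists: assumes "t \<ge> 0" shows "\<exists>C. opbound t C"
proof -
  obtain C where "\<forall>f\<in>Brho \<rho>. wnorm \<rho> (P t f) \<le> C * wnorm \<rho> f"
    using gen_feller[unfolded gen_feller_semigroup_def, THEN conjunct1, rule_format, OF assms] by blast
  from opboundI[OF this] show ?thesis by blast
qed

lemma opbound_local: "\<exists>\<epsilon>>0. \<exists>C. \<forall>t\<in>{0..\<epsilon>}. opbound t C"
proof -
  obtain \<epsilon> C where "\<epsilon> > 0" "\<forall>t\<in>{0..\<epsilon>}. \<forall>f\<in>Brho \<rho>. wnorm \<rho> (P t f) \<le> C * wnorm \<rho> f"
    using gen_feller[unfolded gen_feller_semigroup_def, THEN conjunct2, THEN conjunct2, THEN conjunct2, THEN conjunct2, THEN conjunct1]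
    by blast
  then have "\<forall>t\<in>{0..\<epsilon>}. opbound t (max 0 C)" by (intro ballI opboundI) auto
  with \<open>\<epsilon> > 0\<close> show ?thesis by blast
qed

lemma P_functional:
  assumes t: "t \<ge> 0" and C: "opbound t C"
  shows "weighted_functional \<rho> (\<lambda>f. P t f x) (C * \<rho> x)"
proof unfold_locales
  fix f assume f: "f \<in> Brho \<rho>"
  have "P t f x \<le> wnorm \<rho> (P t f) * \<rho> x" using Brho_bound[OF P_Brho[OF t f], of x] by linarith
  also have "\<dots> \<le> (C * wnorm \<rho> f) * \<rho> x"
    using C f rho_pos[of x] by (intro mult_right_mono) (auto simp: opbound_def)
  finally show "P t f x \<le> C * \<rho> x * wnorm \<rho> f" by (simp add: mult_ac)
next
  show "0 \<le> C * \<rho> x" using C rho_pos[of x] by (auto simp: opbound_def)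
next
  fix f g a assume f: "f \<in> Brho \<rho>"
  show "P t (\<lambda>x. a * f x) x = a * P t f x" by (simp only: P_cmult[OF t f])
  show "g \<in> Brho \<rho> \<Longrightarrow> P t (\<lambda>x. f x + g x) x = P t f x + P t g x" by (simp only: P_add[OF t f])
  show "(\<And>x. 0 \<le> f x) \<Longrightarrow> 0 \<le> P t f x" by (rule P_nonneg[OF t f])
next
  show "P t (\<lambda>x. 1) x = 1" by (simp only: P_one[OF t])
qed

lemma P_functional_ex: "t \<ge> 0 \<Longrightarrow> \<exists>c. weighted_functional \<rho> (\<lambda>f. P t f x) c"
  using opbound_exists P_functional by metis

lemma P_mono:
  assumes "t \<ge> 0" "f \<in> Brho \<rho>" "g \<in> Brho \<rho>" "\<And>x. f x \<le> g x" shows "P t f x \<le> P t g x"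
  using P_functional_ex[OF assms(1), of x] by (rule exE) (rule weighted_functional.L_mono[OF _ assms(2-4)])

lemma P_const: assumes "t \<ge> 0" shows "P t (\<lambda>x. a) x = a"
  using P_functional_ex[OF assms, of x] by (rule exE) (rule weighted_functional.L_const)

lemma P_bounded:
  assumes t: "t \<ge> 0" and f: "f \<in> Brho \<rho>" and B: "\<And>x. \<bar>f x\<bar> \<le> B"
  shows "\<bar>P t f x\<bar> \<le> B"
proof -
  have *: "f y \<le> B" "- B \<le> f y" for y using B[of y] by auto
  show ?thesis
    using P_mono[OF t f Brho_const *(1), of x] P_mono[OF t Brho_const f *(2), of x]
    unfolding P_const[OF t] by linarith
qed

section \<open>Kernels obtained from the Riesz representation\<close>

definition kernel :: "real \<Rightarrow> 'a \<Rightarrow> 'a measure" where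
  "kernel t x = weighted_functional.riesz_measure (\<lambda>f. P t f x)"

lemma
  assumes "t \<ge> 0"
  shows kernel_sets[simp]: "sets (kernel t x) = sets borel"
    and kernel_space[simp]: "space (kernel t x) = UNIV"
    and prob_space_kernel: "prob_space (kernel t x)"
    and integrable_rho_kernel: "integrable (kernel t x) \<rho>"
    and integral_kernel: "f \<in> Brho \<rho> \<Longrightarrow> (\<integral>y. f y \<partial>kernel t x) = P t f x"
    and measure_kernel_open: "open U \<Longrightarrow> measure (kernel t x) U = (SUP f\<in>subunit U. P t f x)"
proof -
  obtain c where "weighted_functional \<rho> (\<lambda>f. P t f x) c" using P_functional_ex[OF assms, of x] by (rule exE)
  then interpret weighted_functional \<rho> "\<lambda>f. P t f x" c .
  show "sets (kernel t x) = sets borel" unfolding kernel_def by (rule sets_riesz)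
  show "space (kernel t x) = UNIV" unfolding kernel_def by (rule space_riesz)
  show "prob_space (kernel t x)" unfolding kernel_def by (rule prob_space_riesz)
  show "integrable (kernel t x) \<rho>" unfolding kernel_def by (rule integrable_rho_riesz)
  show "f \<in> Brho \<rho> \<Longrightarrow> (\<integral>y. f y \<partial>kernel t x) = P t f x"
    unfolding kernel_def by (rule integral_riesz_Brho)
  show "open U \<Longrightarrow> measure (kernel t x) U = (SUP f\<in>subunit U. P t f x)"
    unfolding kernel_def by (rule measure_riesz_open)
qed

lemma nn_integral_rho_kernel:
  assumes "t \<ge> 0" "opbound t C"
  shows "(\<integral>\<^sup>+y. ennreal (\<rho> y) \<partial>kernel t x) \<le> ennreal (C * (1 + 1 / rho_min)) * ennreal (\<rho> x)"
proof -
  interpret weighted_functional \<rho> "\<lambda>f. P t f x" "C * \<rho> x" by (rule P_functional[OF assms])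
  have "(\<integral>\<^sup>+y. ennreal (\<rho> y) \<partial>kernel t x) \<le> ennreal (C * \<rho> x * (1 + 1 / rho_min))"
    unfolding kernel_def by (rule nn_integral_rho_riesz)
  also have "C * \<rho> x * (1 + 1 / rho_min) = C * (1 + 1 / rho_min) * \<rho> x" by (simp add: mult_ac)
  also have "ennreal \<dots> = ennreal (C * (1 + 1 / rho_min)) * ennreal (\<rho> x)"
    using assms(2) rho_min(1) rho_pos[of x] by (intro ennreal_mult) (auto simp: opbound_def)
  finally show ?thesis .
qed

lemma
  assumes t: "t \<ge> 0" and f: "f \<in> subunit U"
  shows P_subunit_nonneg: "0 \<le> P t f x" and P_subunit_le_1: "P t f x \<le> 1"
  using P_nonneg[OF t subunit_Brho[OF f]] P_mono[OF t subunit_Brho[OF f] Brho_const[of 1]]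
    P_const[OF t, of 1] subunitD[OF f] by auto

text \<open>The maximum of two test functions is a test function, and positivity of
  \<open>P t\<close> preserves the order.\<close>

lemma P_subunit_directed:
  assumes t: "t \<ge> 0" and fg: "f \<in> P t ` subunit U" "g \<in> P t ` subunit U"
  shows "\<exists>h\<in>P t ` subunit U. \<forall>x. f x \<le> h x \<and> g x \<le> h x"
proof -
  obtain a b where ab: "a \<in> subunit U" "b \<in> subunit U" "f = P t a" "g = P t b" using fg by blast
  note m = subunit_max[OF ab(1,2)]
  show ?thesis
    unfolding ab(3,4) using ab(1,2) m
    by (intro bexI[of _ "P t (\<lambda>x. max (a x) (b x))"]) (auto intro!: P_mono t subunit_Brho)
qed

text \<open>An uncountable supremum of functions continuous on sublevel sets, to which
  \<open>sublevel_greater_borel\<close> applies.\<close>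

lemma measure_kernel_open_measurable:
  assumes t: "t \<ge> 0" and U: "open U"
  shows "(\<lambda>x. measure (kernel t x) U) \<in> borel_measurable borel"
proof (rule borel_measurable_sublevelI)
  fix n :: nat and r
  have "r < measure (kernel t x) U \<longleftrightarrow> (\<exists>f\<in>subunit U. r < P t f x)" for x
    unfolding measure_kernel_open[OF t U] using zero_subunit[of U] P_subunit_le_1[OF t]
    by (intro less_cSUP_iff) (auto intro!: bdd_aboveI[of _ 1])
  then show "{x. \<rho> x \<le> real n \<and> r < measure (kernel t x) U} \<in> sets borel"
    using sublevel_greater_borel[of "subunit U" "real n" "P t" r] Brho_continuous_on[OF P_Brho[OF t subunit_Brho]]
    by simp
qed

lemma kernel_measurable[measurable]:
  assumes t: "t \<ge> 0" shows "kernel t \<in> borel \<rightarrow>\<^sub>M prob_algebra borel"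
proof (rule measurable_prob_algebra_generated[where \<Omega> = UNIV and G = "Collect open"])
  fix U :: "'a set" assume "U \<in> Collect open"
  then have "(\<lambda>x. ennreal (measure (kernel t x) U)) \<in> borel_measurable borel"
    using measure_kernel_open_measurable[OF t, of U] by simp
  moreover have "emeasure (kernel t x) U = ennreal (measure (kernel t x) U)" for x
    using prob_space_kernel[OF t] by (simp add: prob_space_def finite_measure.emeasure_eq_measure)
  ultimately show "(\<lambda>x. emeasure (kernel t x) U) \<in> borel_measurable borel" by simp
qed (use t prob_space_kernel in \<open>auto simp: borel_def Int_stable_def\<close>)

lemma kernel_subprob: "t \<ge> 0 \<Longrightarrow> kernel t \<in> borel \<rightarrow>\<^sub>M subprob_algebra borel"
  by (intro measurable_prob_algebraD kernel_measurable)

lemma kernel_measurable':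
  assumes "sets \<nu> = sets borel" "t \<ge> 0" shows "kernel t \<in> \<nu> \<rightarrow>\<^sub>M subprob_algebra borel"
  using kernel_subprob[OF assms(2)] by (simp add: measurable_cong_sets[OF assms(1) refl])

section \<open>Images of a Radon law under a kernel\<close>

lemma
  assumes \<nu>: "sets \<nu> = sets borel" "prob_space \<nu>" and t: "t \<ge> 0"
  shows sets_bind_kernel: "sets (\<nu> \<bind> kernel t) = sets borel"
    and prob_space_bind_kernel: "prob_space (\<nu> \<bind> kernel t)"
    and measure_bind_kernel: "A \<in> sets borel \<Longrightarrow> measure (\<nu> \<bind> kernel t) A = (\<integral>x. measure (kernel t x) A \<partial>\<nu>)"
    and integral_bind_kernel: "f \<in> Brho \<rho> \<Longrightarrow> (\<And>x. \<bar>f x\<bar> \<le> B) \<Longrightarrow>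
      (\<integral>y. f y \<partial>(\<nu> \<bind> kernel t)) = (\<integral>x. P t f x \<partial>\<nu>)"
    and integrable_rho_bind_kernel: "integrable \<nu> \<rho> \<Longrightarrow> integrable (\<nu> \<bind> kernel t) \<rho>"
proof -
  have \<nu>a: "\<nu> \<in> space (prob_algebra borel)" using \<nu> by (simp add: space_prob_algebra)
  interpret prob_space \<nu> by fact
  note km = kernel_measurable'[OF \<nu>(1) t]
  show s: "sets (\<nu> \<bind> kernel t) = sets borel" by (rule sets_bind'[OF \<nu>a kernel_measurable[OF t]])
  show pr: "prob_space (\<nu> \<bind> kernel t)" by (rule prob_space_bind'[OF \<nu>a kernel_measurable[OF t]])
  show "A \<in> sets borel \<Longrightarrow> measure (\<nu> \<bind> kernel t) A = (\<integral>x. measure (kernel t x) A \<partial>\<nu>)"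
    by (rule measure_bind[OF km])
  show "(\<integral>y. f y \<partial>(\<nu> \<bind> kernel t)) = (\<integral>x. P t f x \<partial>\<nu>)"
    if f: "f \<in> Brho \<rho>" "\<And>x. \<bar>f x\<bar> \<le> B"
  proof -
    have "(\<integral>y. f y \<partial>(\<nu> \<bind> kernel t)) = (\<integral>x. (\<integral>y. f y \<partial>kernel t x) \<partial>\<nu>)"
      using f Brho_borel[OF f(1)] prob_space.emeasure_space_1[OF prob_space_kernel[OF t]]
      by (intro integral_bind[where K = borel and B = B and B' = 1] km finite_measure_axioms) auto
    then show ?thesis using integral_kernel[OF t f(1)] by simp
  qed
  show "integrable (\<nu> \<bind> kernel t) \<rho>" if i: "integrable \<nu> \<rho>"
  proof (rule integrableI_nonneg)
    show "\<rho> \<in> borel_measurable (\<nu> \<bind> kernel t)" by (simp add: measurable_cong_sets[OF s refl])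
    obtain C where C: "opbound t C" using opbound_exists[OF t] by blast
    have "(\<integral>\<^sup>+x. ennreal (\<rho> x) \<partial>(\<nu> \<bind> kernel t)) = (\<integral>\<^sup>+x. (\<integral>\<^sup>+y. ennreal (\<rho> y) \<partial>kernel t x) \<partial>\<nu>)"
      by (intro nn_integral_bind[where B = borel] km) simp
    also have "\<dots> \<le> (\<integral>\<^sup>+x. ennreal (C * (1 + 1 / rho_min)) * ennreal (\<rho> x) \<partial>\<nu>)"
      by (intro nn_integral_mono nn_integral_rho_kernel t C)
    also have "\<dots> = ennreal (C * (1 + 1 / rho_min)) * (\<integral>\<^sup>+x. ennreal (\<rho> x) \<partial>\<nu>)"
      using borel_measurable_integrable[OF i] by (intro nn_integral_cmult) simp
    also have "(\<integral>\<^sup>+x. ennreal (\<rho> x) \<partial>\<nu>) = ennreal (\<integral>x. \<rho> x \<partial>\<nu>)"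
      using rho_pos by (intro nn_integral_eq_integral i AE_I2) (auto simp: less_imp_le)
    finally show "(\<integral>\<^sup>+x. ennreal (\<rho> x) \<partial>(\<nu> \<bind> kernel t)) < \<infinity>"
      by (rule le_less_trans) (auto simp: ennreal_mult_less_top)
  qed (use rho_pos in \<open>auto simp: less_imp_le\<close>)
qed

text \<open>Integrating \<open>measure_kernel_open\<close> over \<open>\<nu>\<close> interchanges an
  integral with an uncountable directed supremum; \<open>directed_SUP_integral\<close> justifies
  this up to \<open>e\<close>.\<close>

lemma measure_bind_kernel_open_approx:
  assumes \<nu>: "prob_in_Mrho \<rho> \<nu>" and t: "t \<ge> 0" and U: "open U" and e: "e > 0"
  shows "\<exists>f\<in>subunit U. measure (\<nu> \<bind> kernel t) U \<le> (\<integral>x. P t f x \<partial>\<nu>) + e"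
proof -
  note D = prob_in_MrhoD[OF \<nu>]
  have "\<exists>g\<in>P t ` subunit U. (\<integral>x. (SUP f\<in>P t ` subunit U. f x) \<partial>\<nu>) \<le> (\<integral>x. g x \<partial>\<nu>) + e"
  proof (rule directed_SUP_integral[OF \<nu> _ _ _ _ _ e])
    show "P t ` subunit U \<noteq> {}" using zero_subunit by blast
  qed (use P_subunit_directed[OF t] P_subunit_nonneg[OF t] P_subunit_le_1[OF t]
        Brho_continuous_on[OF P_Brho[OF t subunit_Brho]] in auto)
  moreover have "measure (\<nu> \<bind> kernel t) U = (\<integral>x. (SUP f\<in>P t ` subunit U. f x) \<partial>\<nu>)"
    using measure_bind_kernel[OF D(1,3) t, of U] U by (simp add: measure_kernel_open[OF t U] image_image)
  ultimately show ?thesis by auto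
qed

text \<open>By \<open>measure_bind_kernel_open_approx\<close> one test function \<open>f\<close>
  captures nearly all the mass of \<open>U\<close>. So does the compact set \<open>K\<close> where
  \<open>f \<ge> e\<close> and \<open>\<rho> \<le> R\<close>, because \<open>f\<close> is at most
  \<open>e\<close> plus the indicators of \<open>K\<close> and of the set where
  \<open>\<rho> > R\<close>.\<close>

lemma prob_in_Mrho_bind_kernel:
  assumes \<nu>: "prob_in_Mrho \<rho> \<nu>" and t: "t \<ge> 0"
  shows "prob_in_Mrho \<rho> (\<nu> \<bind> kernel t)"
proof -
  note D = prob_in_MrhoD[OF \<nu>]
  define m where "m = \<nu> \<bind> kernel t"
  have m: "sets m = sets borel" "prob_space m" "integrable m \<rho>"
    unfolding m_def by (intro sets_bind_kernel prob_space_bind_kernel integrable_rho_bind_kernel D t)+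
  interpret m: prob_space m by fact
  have sp: "space m = UNIV" using sets_eq_imp_space_eq[OF m(1)] by simp
  show ?thesis
    unfolding m_def[symmetric]
  proof (rule prob_in_MrhoI[OF m])
    fix U :: "'a set" and e' :: real assume U: "open U" and "e' > 0"
    \<comment> \<open>Three losses of size \<open>e\<close> occur: the choice of \<open>f\<close>,
      the threshold and the tail; the quarter leaves room.\<close>
    define e where "e = e' / 4"
    have e: "e > 0" "e' = 4 * e" using \<open>e' > 0\<close> by (auto simp: e_def)
    obtain f where f: "f \<in> subunit U" "measure m U \<le> (\<integral>x. P t f x \<partial>\<nu>) + e"
      using measure_bind_kernel_open_approx[OF \<nu> t U e(1)] unfolding m_def by blast
    have fi: "(\<integral>x. P t f x \<partial>\<nu>) = (\<integral>x. f x \<partial>m)"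
      unfolding m_def using subunitD[OF f(1)]
      by (intro integral_bind_kernel[OF D(1,3) t, symmetric, where B = 1] subunit_Brho[OF f(1)]) auto
    obtain R where R: "R > 0" "measure m {x. R < \<rho> x} < e" using sublevel_tight[OF m e(1)] by blast
    define K where "K = {x. \<rho> x \<le> R} \<inter> {x. e \<le> f x}"
    have K: "compact K" unfolding K_def
      using subunitD(1)[OF f(1)] by (intro compact_Int_closed compact_sublevel closed_Collect_le) auto
    have Km: "K \<in> sets m" using compact_imp_closed_Hausdorff[OF K] m(1) by auto
    have Rm: "{x. R < \<rho> x} \<in> sets m" by (auto simp: m(1))
    have KU: "K \<subseteq> U" using subunitD(4)[OF f(1)] e(1) by (force simp: K_def)
    have "(\<integral>x. f x \<partial>m) \<le> (\<integral>x. e + (indicator K x + indicator {x. R < \<rho> x} x) \<partial>m)"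
    proof (rule integral_mono)
      show "integrable m f" by (rule Brho_integrable[OF m(1,3) subunit_Brho[OF f(1)]])
      show "integrable m (\<lambda>x. e + (indicator K x + indicator {x. R < \<rho> x} x))"
        using Km Rm by (intro Bochner_Integration.integrable_add) (auto simp: m.emeasure_eq_measure)
      show "f x \<le> e + (indicator K x + indicator {x. R < \<rho> x} x)" for x
        using subunitD(3)[OF f(1), of x] e(1) by (auto simp: indicator_def K_def)
    qed
    also have "\<dots> = e + (measure m K + measure m {x. R < \<rho> x})"
      using Km Rm m.prob_space sp by (subst Bochner_Integration.integral_add) (auto simp: m.emeasure_eq_measure)
    finally have "measure m U < measure m K + e'" using f(2) fi R(2) e by auto
    then show "\<exists>K. compact K \<and> K \<subseteq> U \<and> measure m U < measure m K + e'" using K KU by blast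
  qed
qed

lemma prob_in_Mrho_return: "prob_in_Mrho \<rho> (return borel x)"
proof (rule prob_in_MrhoI)
  show "prob_space (return borel x)" by (rule prob_space_return) simp
  show "integrable (return borel x) \<rho>"
    using rho_pos[of x] by (intro integrableI_nonneg) (auto simp: nn_integral_return less_imp_le rho_pos)
  fix U :: "'a set" and e :: real assume "open U" "e > 0"
  then show "\<exists>K. compact K \<and> K \<subseteq> U \<and> measure (return borel x) U < measure (return borel x) K + e"
    using compact_imp_closed_Hausdorff[of "{x}"]
    by (intro exI[of _ "if x \<in> U then {x} else {}"]) (auto simp: measure_return)
qed simp

text \<open>The Riesz construction works with open sets; regularity by compact sets is obtained by
  viewing the kernel as the image of a point mass.\<close>

lemma prob_in_Mrho_kernel: assumes t: "t \<ge> 0" shows "prob_in_Mrho \<rho> (kernel t x)"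
  using prob_in_Mrho_bind_kernel[OF prob_in_Mrho_return t, of x] bind_return[OF kernel_subprob[OF t], of x] by simp

lemma measure_eqI_open:
  fixes M N :: "'a measure"
  assumes M: "sets M = sets borel" "prob_space M" and N: "sets N = sets borel" "prob_space N"
    and op: "\<And>U. open U \<Longrightarrow> measure M U = measure N U"
  shows "M = N"
proof (rule measure_eqI_generator_eq[where E = "Collect open" and \<Omega> = UNIV and A = "\<lambda>_. UNIV"])
  interpret M: prob_space M by fact
  interpret N: prob_space N by fact
  show "emeasure M X = emeasure N X" if "X \<in> Collect open" for X
    using op that by (simp add: M.emeasure_eq_measure N.emeasure_eq_measure)
  show "emeasure M UNIV \<noteq> \<infinity>" by simp
qed (use M N in \<open>auto simp: Int_stable_def borel_def\<close>)

text \<open>By the semigroup law a test function for \<open>U\<close> has the same integral under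
  both measures. One inequality on \<open>U\<close> is then immediate; for the other,
  \<open>measure_bind_kernel_open_approx\<close> replaces the supremum inside the integral by a
  single test function.\<close>

lemma chapman_kolmogorov:
  assumes s: "s \<ge> 0" and t: "t \<ge> 0"
  shows "kernel s x \<bind> kernel t = kernel (s + t) x"
proof (rule measure_eqI_open)
  have st: "s + t \<ge> 0" using s t by simp
  note D = prob_in_MrhoD[OF prob_in_Mrho_kernel[OF s, of x]]
  show sb: "sets (kernel s x \<bind> kernel t) = sets borel" by (rule sets_bind_kernel[OF D(1,3) t])
  show pb: "prob_space (kernel s x \<bind> kernel t)" by (rule prob_space_bind_kernel[OF D(1,3) t])
  show "sets (kernel (s + t) x) = sets borel" "prob_space (kernel (s + t) x)"
    using st prob_space_kernel by auto
  fix U :: "'a set" assume U: "open U"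
  have eq: "(\<integral>y. P t f y \<partial>kernel s x) = P (s + t) f x" if "f \<in> subunit U" for f
    using integral_kernel[OF s P_Brho[OF t]] P_semigroup[OF t _ s] subunit_Brho[OF that] by (simp add: add.commute)
  have bdd: "bdd_above ((\<lambda>f. P (s + t) f x) ` subunit U)"
    using P_subunit_le_1[OF st] by (auto intro!: bdd_aboveI[of _ 1])
  show "measure (kernel s x \<bind> kernel t) U = measure (kernel (s + t) x) U"
  proof (rule antisym)
    show "measure (kernel s x \<bind> kernel t) U \<le> measure (kernel (s + t) x) U"
    proof (rule field_le_epsilon)
      fix e :: real assume e: "e > 0"
      obtain f where f: "f \<in> subunit U" "measure (kernel s x \<bind> kernel t) U \<le> (\<integral>y. P t f y \<partial>kernel s x) + e"
        using measure_bind_kernel_open_approx[OF prob_in_Mrho_kernel[OF s] t U e] by blast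
      then show "measure (kernel s x \<bind> kernel t) U \<le> measure (kernel (s + t) x) U + e"
        unfolding measure_kernel_open[OF st U] eq[OF f(1)] using cSUP_upper[OF f(1) bdd] by linarith
    qed
    show "measure (kernel (s + t) x) U \<le> measure (kernel s x \<bind> kernel t) U"
      unfolding measure_kernel_open[OF st U]
    proof (rule cSUP_least)
      fix f assume f: "f \<in> subunit U"
      interpret B: prob_space "kernel s x \<bind> kernel t" by fact
      have "P (s + t) f x = (\<integral>y. f y \<partial>(kernel s x \<bind> kernel t))"
        unfolding eq[OF f, symmetric] using subunitD[OF f]
        by (intro integral_bind_kernel[OF D(1,3) t, symmetric, where B = 1] subunit_Brho[OF f]) auto
      also have "\<dots> \<le> (\<integral>y. indicator U y \<partial>(kernel s x \<bind> kernel t))"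
        using f U integrable_rho_bind_kernel[OF D(1,3) t D(4)]
        by (intro integral_mono Brho_integrable[OF sb _ subunit_Brho[OF f]])
          (auto simp: sb subunit_def B.emeasure_eq_measure)
      also have "\<dots> = measure (kernel s x \<bind> kernel t) U"
        using U by (simp add: sb sets_eq_imp_space_eq[OF sb])
      finally show "P (s + t) f x \<le> measure (kernel s x \<bind> kernel t) U" .
    qed (use zero_subunit in blast)
  qed
qed

text \<open>By complete regularity, the supremum at \<open>x\<close> of the test functions for
  \<open>U\<close> is 1 if \<open>x \<in> U\<close> and 0 otherwise.\<close>

lemma kernel_0: "kernel 0 x = return borel x"
proof (rule measure_eqI_open)
  show "prob_space (kernel 0 x)" "prob_space (return borel x)"
    using prob_space_kernel[of 0 x] prob_space_return[of x borel] by simp_all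
  fix U :: "'a set" assume U: "open U"
  have "(SUP f\<in>subunit U. P 0 f x) = (SUP f\<in>subunit U. f x)"
    using P_0 subunit_Brho by (intro SUP_cong) auto
  also have "\<dots> = indicator U x"
  proof (cases "x \<in> U")
    case True
    obtain f where f: "f \<in> subunit U" "f x = 1" using completely_regular_open[OF U True] by blast
    have "bdd_above ((\<lambda>f. f x) ` subunit U)" using subunitD(3) by (intro bdd_aboveI2[of _ _ 1])
    from cSUP_upper[OF f(1) this] have "1 \<le> (SUP f\<in>subunit U. f x)" by (simp add: f(2))
    moreover have "(SUP f\<in>subunit U. f x) \<le> 1" using f(1) subunitD(3) by (intro cSUP_least) auto
    ultimately show ?thesis using True by simp
  next
    case False
    then have "(SUP f\<in>subunit U. f x) = (SUP f\<in>subunit U. 0)" using subunitD(4) by (intro SUP_cong) auto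
    then show ?thesis using False zero_subunit[of U] by (metis cSUP_const empty_iff indicator_simps(2))
  qed
  finally show "measure (kernel 0 x) U = measure (return borel x) U"
    using U by (simp add: measure_kernel_open measure_return)
qed auto

end

section \<open>Kolmogorov extension with compactly inner regular marginals\<close>

abbreviation (input) borel_PiM :: "'i set \<Rightarrow> ('i \<Rightarrow> 'a::topological_space) measure" where
  "borel_PiM I \<equiv> PiM I (\<lambda>_. borel)"

text \<open>Regularity is required of the one-dimensional marginals only; for finite products it is
  derived in \<open>compact_approx\<close>.\<close>

locale regular_projective_family = projective_family I P "\<lambda>_. borel"
  for I :: "'i set" and P :: "'i set \<Rightarrow> ('i \<Rightarrow> 'a::topological_space) measure" +
  assumes Hausdorff: "Hausdorff_space (euclidean :: 'a topology)"
    and regular: "\<And>i A e. i \<in> I \<Longrightarrow> A \<in> sets borel \<Longrightarrow> e > 0 \<Longrightarrow>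
      \<exists>K. compact K \<and> K \<subseteq> A \<and> measure (P {i}) {w \<in> space (P {i}). w i \<in> A - K} < e"
begin

abbreviation "prodtop J \<equiv> product_topology (\<lambda>_. euclidean :: 'a topology) J"

text \<open>Measurability is demanded explicitly: the product of the Borel sigma-algebras can be
  smaller than the Borel sigma-algebra of the product topology, so a compact set need not belong to
  it.\<close>

abbreviation "compacts J \<equiv> {C \<in> sets (borel_PiM J). compactin (prodtop J) C}"

lemma Hausdorff_prodtop: "Hausdorff_space (prodtop J)"
  using Hausdorff by (simp add: Hausdorff_space_product_topology)

lemma compact_borel: "compact (K :: 'a set) \<Longrightarrow> K \<in> sets borel"
  using compactin_imp_closedin[OF Hausdorff, of K] by auto

lemma space_P_PiE: "finite J \<Longrightarrow> J \<subseteq> I \<Longrightarrow> space (P J) = (\<Pi>\<^sub>E i\<in>J. UNIV)"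
  by (simp add: space_P space_PiM)

lemma measure_marginal:
  assumes J: "finite J" "J \<subseteq> I" "i \<in> J" and B: "B \<in> sets borel"
  shows "measure (P J) {w \<in> space (P J). w i \<in> B} = measure (P {i}) {w \<in> space (P {i}). w i \<in> B}"
proof -
  have i: "{i} \<subseteq> I" using J by auto
  note [measurable_cong] = sets_P[OF J(1,2)]
  have [measurable]: "{w \<in> space (borel_PiM {i}). w i \<in> B} \<in> sets (borel_PiM {i})"
    using B by measurable
  have "measure (P {i}) {w \<in> space (P {i}). w i \<in> B} =
    measure (distr (P J) (borel_PiM {i}) (\<lambda>f. restrict f {i})) {w \<in> space (borel_PiM {i}). w i \<in> B}"
    using P[of "{i}" J] J i space_P[of "{i}"] by simp
  also have "\<dots> = measure (P J) ((\<lambda>f. restrict f {i}) -` {w \<in> space (borel_PiM {i}). w i \<in> B} \<inter> space (P J))"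
    using J by (intro measure_distr) (auto intro!: measurable_restrict_subset)
  also have "(\<lambda>f. restrict f {i}) -` {w \<in> space (borel_PiM {i}). w i \<in> B} \<inter> space (P J) = {w \<in> space (P J). w i \<in> B}"
    by (auto simp: space_PiM)
  finally show ?thesis ..
qed

text \<open>Single-coordinate events generate the product sigma-algebra, and compact boxes
  approximate them because every coordinate can be confined to a compact set at small cost.\<close>

lemma compact_approx:
  assumes J: "finite J" "J \<subseteq> I" and X: "X \<in> sets (borel_PiM J)" and e: "e > 0"
  shows "\<exists>C\<in>compacts J. C \<subseteq> X \<and> measure (P J) (X - C) < e"
proof -
  interpret PJ: prob_space "P J" by (rule prob_space_P[OF J])
  have sets[measurable_cong]: "sets (P J) = sets (borel_PiM J)" by (rule sets_P[OF J])
  have sp: "space (P J) = (\<Pi>\<^sub>E i\<in>J. UNIV)" by (rule space_P_PiE[OF J])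
  have box: "(\<Pi>\<^sub>E i\<in>J. K i) \<in> compacts J"
    if "\<And>i. i \<in> J \<Longrightarrow> compact (K i)" for K
    using that J compact_borel by (auto simp: compactin_PiE intro!: sets_PiM_I_finite)
  have reg: "\<exists>K. compact K \<and> K \<subseteq> A \<and> measure (P J) {w \<in> space (P J). w i \<in> A - K} < e"
    if i: "i \<in> J" "A \<in> sets borel" "e > 0" for i A e
  proof -
    obtain K where K: "compact K" "K \<subseteq> A" "measure (P {i}) {w \<in> space (P {i}). w i \<in> A - K} < e"
      using regular[of i A e] i J by blast
    have "A - K \<in> sets borel" using i(2) compact_borel[OF K(1)] by blast
    from measure_marginal[OF J i(1) this] K show ?thesis by auto
  qed
  have big: "\<exists>K. (\<forall>i\<in>J. compact (K i)) \<and> measure (P J) (space (P J) - (\<Pi>\<^sub>E i\<in>J. K i)) < e" if e: "e > 0" for e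
  proof -
    \<comment> \<open>The total over the coordinates stays below \<open>e\<close>; the summand 1
      covers empty \<open>J\<close> and gives strictness.\<close>
    define d where "d = e / (real (card J) + 1)"
    have d: "d > 0" "real (card J) * d < e" using e by (auto simp: d_def field_simps)
    have "\<forall>i\<in>J. \<exists>K. compact K \<and> measure (P J) {w \<in> space (P J). w i \<in> UNIV - K} < d"
    proof
      fix i assume "i \<in> J"
      from reg[OF this _ d(1), of UNIV]
      show "\<exists>K. compact K \<and> measure (P J) {w \<in> space (P J). w i \<in> UNIV - K} < d" by auto
    qed
    from bchoice[OF this] obtain K where
      "\<forall>i\<in>J. compact (K i) \<and> measure (P J) {w \<in> space (P J). w i \<in> UNIV - K i} < d" ..
    then have K: "\<And>i. i \<in> J \<Longrightarrow> compact (K i)"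
      "\<And>i. i \<in> J \<Longrightarrow> measure (P J) {w \<in> space (P J). w i \<in> UNIV - K i} < d" by auto
    have m: "{w \<in> space (P J). w i \<in> UNIV - K i} \<in> sets (P J)" if "i \<in> J" for i
      using compact_borel[OF K(1)[OF that]] that by measurable
    have "measure (P J) (space (P J) - (\<Pi>\<^sub>E i\<in>J. K i)) \<le> measure (P J) (\<Union>i\<in>J. {w \<in> space (P J). w i \<in> UNIV - K i})"
      using m J(1) by (intro PJ.finite_measure_mono) (auto simp: sp PiE_iff)
    also have "\<dots> \<le> (\<Sum>i\<in>J. measure (P J) {w \<in> space (P J). w i \<in> UNIV - K i})"
      using m J(1) by (intro PJ.finite_measure_subadditive_finite) auto
    also have "\<dots> \<le> (\<Sum>i\<in>J. d)" by (intro sum_mono less_imp_le K)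
    also have "\<dots> < e" using d by simp
    finally show ?thesis using K(1) by (intro exI[of _ K]) simp
  qed
  have gen: "\<exists>C\<in>compacts J. C \<subseteq> {w \<in> space (P J). w i \<in> A} \<and>
      measure (P J) ({w \<in> space (P J). w i \<in> A} - C) < e"
    if i: "i \<in> J" "A \<in> sets borel" and e: "e > 0" for i A e
  proof -
    have e2: "e / 2 > 0" using e by simp
    obtain K where K: "\<And>i. i \<in> J \<Longrightarrow> compact (K i)" "measure (P J) (space (P J) - (\<Pi>\<^sub>E i\<in>J. K i)) < e / 2"
      using big[OF e2] by auto
    obtain K' where K': "compact K'" "K' \<subseteq> A" "measure (P J) {w \<in> space (P J). w i \<in> A - K'} < e / 2"
      using reg[OF i e2] by auto
    \<comment> \<open>Coordinate \<open>i\<close> is confined and also forced into \<open>A\<close>;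
      the other coordinates are only confined.\<close>
    define C where "C = (\<Pi>\<^sub>E j\<in>J. if j = i then K i \<inter> K' else K j)"
    have "compact (K i \<inter> K')"
      using K(1)[OF i(1)] K'(1) compactin_imp_closedin[OF Hausdorff, of K'] by (intro compact_Int_closed) auto
    then have C: "C \<in> compacts J"
      unfolding C_def using K(1) by (intro box) auto
    have "measure (P J) ({w \<in> space (P J). w i \<in> A} - C) \<le>
      measure (P J) ((space (P J) - (\<Pi>\<^sub>E i\<in>J. K i)) \<union> {w \<in> space (P J). w i \<in> A - K'})"
    proof (rule PJ.finite_measure_mono)
      show "{w \<in> space (P J). w i \<in> A} - C \<subseteq> (space (P J) - (\<Pi>\<^sub>E i\<in>J. K i)) \<union> {w \<in> space (P J). w i \<in> A - K'}"
        using i by (auto simp: C_def PiE_iff split: if_splits)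
      show "(space (P J) - (\<Pi>\<^sub>E i\<in>J. K i)) \<union> {w \<in> space (P J). w i \<in> A - K'} \<in> sets (P J)"
        using i compact_borel[OF K'(1)] box[of K] K(1) sets by (intro sets.Un sets.Diff) (auto, measurable)
    qed
    also have "\<dots> \<le> measure (P J) (space (P J) - (\<Pi>\<^sub>E i\<in>J. K i)) + measure (P J) {w \<in> space (P J). w i \<in> A - K'}"
      using i compact_borel[OF K'(1)] box[of K] K(1) sets by (intro measure_Un_le) (auto, measurable)
    also have "\<dots> < e" using K(2) K'(3) by simp
    finally have "measure (P J) ({w \<in> space (P J). w i \<in> A} - C) < e" .
    moreover have "C \<subseteq> {w \<in> space (P J). w i \<in> A}"
      using i K'(2) by (auto simp: C_def sp PiE_iff split: if_splits)
    ultimately show ?thesis using C by blast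
  qed
  show ?thesis
  proof (rule PJ.inner_approx_sigma_sets[where G = "{{f\<in>\<Pi>\<^sub>E i\<in>J. UNIV. f i \<in> A} | i A. i \<in> J \<and> A \<in> sets borel}"])
    show "sets (P J) = sigma_sets (space (P J)) {{f\<in>\<Pi>\<^sub>E i\<in>J. UNIV. f i \<in> A} | i A. i \<in> J \<and> A \<in> sets borel}"
      using sets_PiM_single[of J "\<lambda>_. borel :: 'a measure"] sets sp by simp
    show "{{f\<in>\<Pi>\<^sub>E i\<in>J. UNIV. f i \<in> A} | i A. i \<in> J \<and> A \<in> sets borel} \<subseteq> Pow (space (P J))"
      using sp by auto
    show "(\<Inter>n. C n) \<in> compacts J"
      if C: "range C \<subseteq> compacts J" for C :: "nat \<Rightarrow> _"
    proof -
      have "C n \<in> sets (borel_PiM J)" "compactin (prodtop J) (C n)" for n using C by auto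
      then show ?thesis using compactin_imp_closedin[OF Hausdorff_prodtop]
        by (auto intro!: sets.countable_INT' closed_compactin_Inter[of _ "C 0"])
    qed
    show "\<exists>C\<in>compacts J. measure (P J) (space (P J) - C) < e" if e0: "e > 0" for e
    proof -
      obtain K where "\<And>i. i \<in> J \<Longrightarrow> compact (K i)" "measure (P J) (space (P J) - (\<Pi>\<^sub>E i\<in>J. K i)) < e"
        using big[OF e0] by auto
      then show ?thesis using box[of K] by (intro bexI[of _ "\<Pi>\<^sub>E i\<in>J. K i"]) auto
    qed
    fix A :: "('i \<Rightarrow> 'a) set" and e :: real assume "A \<in> {{f\<in>\<Pi>\<^sub>E i\<in>J. UNIV. f i \<in> A} | i A. i \<in> J \<and> A \<in> sets borel}" and e: "e > 0"
    then obtain i B where A: "A = {f \<in> space (P J). f i \<in> B}" "i \<in> J" "B \<in> sets borel" using sp by auto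
    show "\<exists>C\<in>compacts J. C \<subseteq> A \<and> measure (P J) (A - C) < e"
      using gen[OF A(2,3) e] unfolding A(1) .
    have "space (P J) - A = {f \<in> space (P J). f i \<in> - B}" unfolding A(1) by blast
    moreover have "- B \<in> sets borel" using A(3) by (simp add: Compl_eq_Diff_UNIV)
    ultimately show "\<exists>C\<in>compacts J. C \<subseteq> space (P J) - A \<and>
        measure (P J) (space (P J) - A - C) < e"
      using gen[OF A(2) _ e, of "- B"] by simp
  qed (use X sets e in \<open>auto intro: compactin_Un\<close>)
qed

lemma restrict_continuous_map: "J \<subseteq> I \<Longrightarrow> continuous_map (prodtop I) (prodtop J) (\<lambda>w. restrict w J)"
  by (subst continuous_map_componentwise) (auto intro!: continuous_map_product_projection simp: Pi_iff)

text \<open>Continuity at the empty set, in the form required by \<open>emeasure_lim\<close>.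
  Compact sets \<open>Z n\<close> inside the \<open>X n\<close> lose in total less mass than the
  infimum, so any finitely many of these constraints are compatible; compactness of one infinite
  product of compact sets then yields a point satisfying all of them.\<close>

lemma emb_Inter_nonempty:
  fixes J :: "nat \<Rightarrow> 'i set" and X :: "nat \<Rightarrow> ('i \<Rightarrow> 'a) set"
  assumes J: "\<And>n. J n \<subseteq> I" "incseq J" "\<And>n. finite (J n)"
    and X: "\<And>n. X n \<in> sets (borel_PiM (J n))" "decseq (\<lambda>n. emb I (J n) (X n))"
    and pos: "0 < (INF n. emeasure (P (J n)) (X n))"
  shows "(\<Inter>n. emb I (J n) (X n)) \<noteq> {}"
proof -
  \<comment> \<open>A number strictly between 0 and the infimum is finite, so the estimates can be
    made in the reals.\<close>
  obtain b where b: "0 < b" "b < (INF n. emeasure (P (J n)) (X n))" using dense[OF pos] by blast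
  define a where "a = enn2real b"
  have "ennreal a = b" unfolding a_def using b(2) by (intro ennreal_enn2real) (auto intro: less_le_trans)
  then have a: "0 < a" "ennreal a < (INF n. emeasure (P (J n)) (X n))"
    using b by (auto simp: ennreal_less_zero_iff)
  define q where "q n = a / 2 * (1/2)^Suc n" for n
  have hs: "q sums (a / 2)"
    using sums_mult[OF power_half_series, of "a / 2"] by (simp add: q_def[abs_def])
  have q0: "q n > 0" for n using a by (simp add: q_def)
  have "\<exists>Z. Z \<in> sets (borel_PiM (J n)) \<and> compactin (prodtop (J n)) Z \<and> Z \<subseteq> X n \<and> measure (P (J n)) (X n - Z) < q n" for n
    using compact_approx[OF J(3,1) X(1) q0, of n n] by blast
  then obtain Z where Z: "\<And>n. Z n \<in> sets (borel_PiM (J n))" "\<And>n. compactin (prodtop (J n)) (Z n)"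
    "\<And>n. Z n \<subseteq> X n" "\<And>n. measure (P (J n)) (X n - Z n) < q n" by metis
  \<comment> \<open>Otherwise \<open>X n\<close> would be covered by the lifted differences
    \<open>X m - Z m\<close> with \<open>m \<le> n\<close>, of total mass at most
    \<open>a / 2\<close>.\<close>
  have ne: "\<exists>w\<in>\<Pi>\<^sub>E i\<in>I. UNIV. \<forall>m\<le>n. restrict w (J m) \<in> Z m" for n
  proof (rule ccontr)
    assume no: "\<not> ?thesis"
    interpret Pn: prob_space "P (J n)" by (rule prob_space_P[OF J(3,1)])
    have sub: "J m \<subseteq> J n" if "m \<le> n" for m using J(2) that by (auto simp: incseq_def)
    have "emb I (J n) (X n) \<subseteq> emb I (J n) (\<Union>m\<le>n. emb (J n) (J m) (X m - Z m))"
    proof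
      fix w assume w: "w \<in> emb I (J n) (X n)"
      then have wI: "w \<in> (\<Pi>\<^sub>E i\<in>I. UNIV)" by (auto simp: prod_emb_def)
      then obtain m where m: "m \<le> n" "restrict w (J m) \<notin> Z m" using no by blast
      have "w \<in> emb I (J m) (X m)" using X(2) m(1) w by (auto simp: decseq_def)
      then have "restrict w (J m) \<in> X m - Z m" using m by (auto simp: prod_emb_def)
      then have "restrict (restrict w (J n)) (J m) \<in> X m - Z m"
        using sub[OF m(1)] by (simp add: Int_absorb1 restrict_restrict)
      then show "w \<in> emb I (J n) (\<Union>m\<le>n. emb (J n) (J m) (X m - Z m))"
        using m(1) wI by (auto simp: prod_emb_def)
    qed
    moreover have ms': "emb (J n) (J m) (X m - Z m) \<in> sets (borel_PiM (J n))" if "m \<le> n" for m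
      by (intro measurable_prod_emb sub[OF that] sets.Diff X Z)
    then have "(\<Union>m\<le>n. emb (J n) (J m) (X m - Z m)) \<in> sets (borel_PiM (J n))"
      by (intro sets.finite_UN) auto
    ultimately have Xn: "X n \<subseteq> (\<Union>m\<le>n. emb (J n) (J m) (X m - Z m))"
      using emb_preserve_mono[OF J(1) order_refl X(1)] by blast
    have ms: "emb (J n) (J m) (X m - Z m) \<in> sets (P (J n))" if "m \<le> n" for m
      using ms'[OF that] by (simp add: sets_P[OF J(3,1)])
    have "measure (P (J n)) (X n) \<le> measure (P (J n)) (\<Union>m\<le>n. emb (J n) (J m) (X m - Z m))"
      by (intro Pn.finite_measure_mono Xn sets.finite_UN ms) auto
    also have "\<dots> \<le> (\<Sum>m\<le>n. measure (P (J n)) (emb (J n) (J m) (X m - Z m)))"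
      using ms by (intro Pn.finite_measure_subadditive_finite) auto
    also have "\<dots> = (\<Sum>m\<le>n. measure (P (J m)) (X m - Z m))"
    proof (intro sum.cong refl)
      fix m assume "m \<in> {..n}"
      then have "emeasure (P (J n)) (emb (J n) (J m) (X m - Z m)) = emeasure (P (J m)) (X m - Z m)"
        by (intro emeasure_P sub J sets.Diff X Z) auto
      then show "measure (P (J n)) (emb (J n) (J m) (X m - Z m)) = measure (P (J m)) (X m - Z m)"
        by (simp add: measure_def)
    qed
    also have "\<dots> \<le> (\<Sum>m\<le>n. q m)" by (intro sum_mono less_imp_le Z)
    also have "\<dots> \<le> (\<Sum>m. q m)" using q0 by (intro sum_le_suminf sums_summable[OF hs]) (auto simp: less_imp_le)
    also have "\<dots> = a / 2" using hs by (simp add: sums_iff)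
    finally have "measure (P (J n)) (X n) \<le> a" using a(1) by simp
    then have "emeasure (P (J n)) (X n) \<le> ennreal a" by (simp add: Pn.emeasure_eq_measure ennreal_leI)
    moreover have "(INF n. emeasure (P (J n)) (X n)) \<le> emeasure (P (J n)) (X n)" by (rule INF_lower) simp
    ultimately show False using a(2) by (meson leD order_trans)
  qed
  \<comment> \<open>The first stage that involves coordinate \<open>t\<close>; projecting its
    compact set gives a compact range \<open>K t\<close>. Coordinates that are never involved get a
    singleton.\<close>
  define \<phi> where "\<phi> t = (LEAST n. t \<in> J n)" for t
  define K where "K t = (if \<exists>n. t \<in> J n then (\<lambda>f. f t) ` Z (\<phi> t) else {undefined})" for t
  have \<phi>: "t \<in> J (\<phi> t)" "\<phi> t \<le> n" if "t \<in> J n" for t n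
    unfolding \<phi>_def using that by (auto intro: LeastI Least_le)
  have Kc: "compact (K t)" for t
  proof (cases "\<exists>n. t \<in> J n")
    case True
    then have "compactin euclidean ((\<lambda>f. f t) ` Z (\<phi> t))"
      using \<phi>(1) by (intro image_compactin[OF Z(2)] continuous_map_product_projection) blast
    then show ?thesis using True by (simp add: K_def)
  qed (simp add: K_def)
  have Kne: "K t \<noteq> {}" for t
  proof (cases "\<exists>n. t \<in> J n")
    case True
    then show ?thesis using ne[of "\<phi> t"] by (auto simp: K_def)
  qed (simp add: K_def)
  define D where "D n = {w \<in> topspace (prodtop I). restrict w (J n) \<in> Z n}" for n
  have Dc: "closedin (prodtop I) (D n)" for n
    unfolding D_def using compactin_imp_closedin[OF Hausdorff_prodtop Z(2)] J(1)
    by (intro closedin_continuous_map_preimage[OF restrict_continuous_map]) auto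
  have Qc: "compactin (prodtop I) (\<Pi>\<^sub>E t\<in>I. K t)" using Kc by (simp add: compactin_PiE)
  have fip: "(\<Pi>\<^sub>E t\<in>I. K t) \<inter> \<Inter>\<F> \<noteq> {}" if \<F>: "finite \<F>" "\<F> \<subseteq> range D" for \<F>
  proof -
    obtain S where S: "finite S" "\<F> = D ` S" using finite_subset_image[OF \<F>] by blast
    obtain n where n: "\<And>m. m \<in> S \<Longrightarrow> m \<le> n" using S(1)[unfolded finite_nat_set_iff_bounded_le] by auto
    obtain w where w: "w \<in> (\<Pi>\<^sub>E i\<in>I. UNIV)" "\<And>m. m \<le> n \<Longrightarrow> restrict w (J m) \<in> Z m"
      using ne[of n] by (elim bexE) auto
    \<comment> \<open>Outside \<open>J n\<close> the point \<open>w\<close> is unconstrained and may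
      leave the compact product, so these coordinates are refilled from \<open>K t\<close>.\<close>
    define w' where "w' = (\<lambda>t\<in>I. if t \<in> J n then w t else (SOME x. x \<in> K t))"
    have "w' t \<in> K t" if t: "t \<in> I" for t
    proof (cases "t \<in> J n")
      case True
      have "restrict w (J (\<phi> t)) \<in> Z (\<phi> t)" by (rule w(2)[OF \<phi>(2)[OF True]])
      moreover have "t \<in> J (\<phi> t)" by (rule \<phi>(1)[OF True])
      ultimately have "w t \<in> (\<lambda>f. f t) ` Z (\<phi> t)" by (intro image_eqI[of _ _ "restrict w (J (\<phi> t))"]) auto
      then show ?thesis using True t unfolding w'_def K_def by auto
    next
      case False
      then show ?thesis using t Kne[of t] by (simp add: w'_def some_in_eq)
    qed
    moreover have "w' \<in> D m" if "m \<in> S" for m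
    proof -
      have "J m \<subseteq> J n" using J(2) n[OF that] by (auto simp: incseq_def)
      then have "restrict w' (J m) = restrict w (J m)" using J(1)[of n] by (intro ext) (auto simp: w'_def restrict_def)
      then show ?thesis using w(2)[OF n[OF that]] by (auto simp: D_def w'_def)
    qed
    ultimately have "w' \<in> (\<Pi>\<^sub>E t\<in>I. K t) \<inter> \<Inter>\<F>" by (auto simp: S(2) w'_def)
    then show ?thesis by blast
  qed
  have "(\<Pi>\<^sub>E t\<in>I. K t) \<inter> \<Inter>(range D) \<noteq> {}"
    using Qc[unfolded compactin_fip, THEN conjunct2, rule_format, of "range D"] Dc fip by blast
  then obtain w where "\<And>n. w \<in> D n" by blast
  then have "w \<in> emb I (J n) (X n)" for n using Z(3)[of n] by (auto simp: D_def prod_emb_def)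
  then show ?thesis by blast
qed

lemma emeasure_lim_regular:
  assumes "finite J" "J \<subseteq> I" "X \<in> sets (borel_PiM J)"
  shows "emeasure lim (emb I J X) = emeasure (P J) X"
  using assms emb_Inter_nonempty by (rule emeasure_lim)

lemma prob_space_lim: "prob_space lim"
proof
  interpret P0: prob_space "P {}" by (rule prob_space_P) auto
  have "emeasure lim (emb I {} (space (borel_PiM {}))) = 1"
    using P0.emeasure_space_1 by (subst emeasure_lim_regular) (auto simp: space_P)
  moreover have "emb I {} (space (borel_PiM {})) = space lim"
    by (auto simp: prod_emb_def space_PiM restrict_def)
  ultimately show "emeasure lim (space lim) = 1" by simp
qed

lemma distr_lim:
  assumes J: "finite J" "J \<subseteq> I"
  shows "distr lim (borel_PiM J) (\<lambda>w. restrict w J) = P J"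
proof (rule measure_eqI)
  fix X assume "X \<in> sets (distr lim (borel_PiM J) (\<lambda>w. restrict w J))"
  then have X: "X \<in> sets (borel_PiM J)" by simp
  then show "emeasure (distr lim (borel_PiM J) (\<lambda>w. restrict w J)) X = emeasure (P J) X"
    using emeasure_lim_regular[OF J X] J
    by (subst emeasure_distr) (auto simp: prod_emb_def space_PiM measurable_cong_sets[OF sets_lim refl] intro!: measurable_restrict_subset)
qed (simp add: sets_P[OF J])

end

section \<open>Finite-dimensional laws\<close>

lemma coordinate_compose_measurable:
  assumes "i \<in> I" "g \<in> borel \<rightarrow>\<^sub>M N"
  shows "(\<lambda>w. g (w i)) \<in> borel_PiM I \<rightarrow>\<^sub>M N"
proof -
  have "(\<lambda>w. w i) \<in> borel_PiM I \<rightarrow>\<^sub>M borel"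
    using measurable_component_singleton[OF assms(1), of "\<lambda>_. borel"] .
  from measurable_compose[OF this assms(2)] show ?thesis .
qed

context feller
begin

section \<open>Iterated kernels along a list of times\<close>

abbreviation paths :: "(real \<Rightarrow> 'a) measure" where
  "paths \<equiv> borel_PiM {0..}"

text \<open>The path started from \<open>x\<close> at time \<open>s\<close> and sampled at the
  listed times. All other coordinates hold a default value, the last sampled state (\<open>x\<close>
  if there is none); \<open>fdd\<close> keeps only the listed ones.\<close>

primrec path_law :: "real list \<Rightarrow> real \<Rightarrow> 'a \<Rightarrow> (real \<Rightarrow> 'a) measure" where
  "path_law [] = (\<lambda>s x. return paths (\<lambda>t\<in>{0..}. x))"
| "path_law (t # ts) = (\<lambda>s x. kernel (t - s) x \<bind> (\<lambda>y. distr (path_law ts t y) paths (\<lambda>w. fun_upd w t y)))"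

text \<open>The expectation of the product of the factors \<open>g t\<close> over the listed times,
  given state \<open>x\<close> at time \<open>s\<close>.\<close>

primrec iter :: "(real \<Rightarrow> 'a \<Rightarrow> ennreal) \<Rightarrow> real list \<Rightarrow> real \<Rightarrow> 'a \<Rightarrow> ennreal" where
  "iter g [] = (\<lambda>s x. 1)"
| "iter g (t # ts) = (\<lambda>s x. \<integral>\<^sup>+y. g t y * iter g ts t y \<partial>kernel (t - s) x)"

text \<open>The first time may equal \<open>s\<close>, so that time 0 can be listed for a start at
  0.\<close>

definition times :: "real \<Rightarrow> real list \<Rightarrow> bool" where
  "times s ts \<longleftrightarrow> 0 \<le> s \<and> sorted_wrt (<) ts \<and> (\<forall>t\<in>set ts. s \<le> t)"

lemma times_Cons: "times s (t # ts) \<longleftrightarrow> 0 \<le> s \<and> s \<le> t \<and> times t ts \<and> t \<notin> set ts"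
  by (auto simp: times_def order.strict_iff_order)

lemma fun_upd_paths_measurable:
  assumes "0 \<le> t" shows "(\<lambda>(y, w). fun_upd w t y) \<in> borel \<Otimes>\<^sub>M paths \<rightarrow>\<^sub>M paths"
proof -
  have "(\<lambda>p. fun_upd (snd p) t (fst p)) \<in> borel \<Otimes>\<^sub>M paths \<rightarrow>\<^sub>M paths"
    using assms by (intro measurable_fun_upd[where J = "{0..}"]) auto
  then show ?thesis by (simp add: case_prod_unfold)
qed

lemma path_law_measurable: "times s ts \<Longrightarrow> path_law ts s \<in> borel \<rightarrow>\<^sub>M prob_algebra paths"
proof (induction ts arbitrary: s)
  case Nil
  have "(\<lambda>x. \<lambda>t\<in>{0..}. x) \<in> borel \<rightarrow>\<^sub>M paths" by (intro measurable_restrict) auto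
  from measurable_compose[OF this measurable_return_prob_space] show ?case by simp
next
  case (Cons t ts)
  then have t: "0 \<le> s" "s \<le> t" "times t ts" by (auto simp: times_Cons)
  have "(\<lambda>y. distr (path_law ts t y) paths (\<lambda>w. fun_upd w t y)) \<in> borel \<rightarrow>\<^sub>M prob_algebra paths"
    using t by (intro measurable_distr_prob_space2[OF Cons.IH[OF t(3)]] fun_upd_paths_measurable) auto
  from measurable_bind_prob_space[OF kernel_measurable this] show ?case using t by simp
qed

lemma path_law_subprob: "times s ts \<Longrightarrow> path_law ts s \<in> borel \<rightarrow>\<^sub>M subprob_algebra paths"
  by (intro measurable_prob_algebraD path_law_measurable)

lemma sets_path_law: "times s ts \<Longrightarrow> sets (path_law ts s x) = sets paths"
  using measurable_space[OF path_law_measurable, of s ts x] by (simp add: space_prob_algebra)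

lemma nn_integral_path_law_Cons:
  assumes t: "times s (t # ts)" and F: "F \<in> borel_measurable paths"
  shows "(\<integral>\<^sup>+w. F w \<partial>path_law (t # ts) s x) =
    (\<integral>\<^sup>+y. (\<integral>\<^sup>+w. F (fun_upd w t y) \<partial>path_law ts t y) \<partial>kernel (t - s) x)"
proof -
  have t': "0 \<le> s" "s \<le> t" "times t ts" using t by (auto simp: times_Cons)
  have u: "(\<lambda>w. fun_upd w t y) \<in> paths \<rightarrow>\<^sub>M paths" for y
    using t' by (intro measurable_fun_upd[where J = "{0..}"]) auto
  have m: "(\<lambda>y. distr (path_law ts t y) paths (\<lambda>w. fun_upd w t y)) \<in> borel \<rightarrow>\<^sub>M subprob_algebra paths"
    using t' by (intro measurable_prob_algebraD measurable_distr_prob_space2[OF path_law_measurable[OF t'(3)]] fun_upd_paths_measurable) auto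
  have "(\<integral>\<^sup>+w. F w \<partial>path_law (t # ts) s x) =
    (\<integral>\<^sup>+y. (\<integral>\<^sup>+w. F w \<partial>distr (path_law ts t y) paths (\<lambda>w. fun_upd w t y)) \<partial>kernel (t - s) x)"
    unfolding path_law.simps using m t'
    by (intro nn_integral_bind[OF F]) (simp add: measurable_cong_sets[OF kernel_sets refl])
  also have "\<dots> = (\<integral>\<^sup>+y. (\<integral>\<^sup>+w. F (fun_upd w t y) \<partial>path_law ts t y) \<partial>kernel (t - s) x)"
    using F u by (intro nn_integral_cong nn_integral_distr)
      (auto simp: measurable_cong_sets[OF sets_path_law[OF t'(3)] refl])
  finally show ?thesis .
qed

lemma nn_integral_kernel_measurable:
  assumes "0 \<le> t" "f \<in> borel_measurable borel"
  shows "(\<lambda>x. \<integral>\<^sup>+y. f y \<partial>kernel t x) \<in> borel_measurable borel"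
  using measurable_compose[OF kernel_subprob[OF assms(1)] nn_integral_measurable_subprob_algebra[OF assms(2)]] .

lemma iter_measurable:
  assumes "times s ts" "\<And>t. g t \<in> borel_measurable borel"
  shows "iter g ts s \<in> borel_measurable borel"
  using assms(1)
proof (induction ts arbitrary: s)
  case (Cons t ts)
  then show ?case using assms(2)
    by (auto simp: times_Cons intro!: nn_integral_kernel_measurable borel_measurable_times_ennreal)
qed simp

lemma nn_integral_path_law:
  assumes "times s ts" "\<And>t. g t \<in> borel_measurable borel"
  shows "(\<integral>\<^sup>+w. (\<Prod>t\<in>set ts. g t (w t)) \<partial>path_law ts s x) = iter g ts s x"
  using assms(1)
proof (induction ts arbitrary: s x)
  case Nil
  interpret prob_space "path_law [] s x"
    using measurable_space[OF path_law_measurable[OF Nil], of x] by (simp add: space_prob_algebra)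
  show ?case using emeasure_space_1 by simp
next
  case (Cons t ts)
  then have t: "0 \<le> s" "s \<le> t" "times t ts" "t \<notin> set ts" by (auto simp: times_Cons)
  have pos: "0 \<le> r" if "r \<in> set ts \<or> r = t" for r using t that by (auto simp: times_def)
  have meas: "(\<lambda>w. g r (w r)) \<in> borel_measurable paths" if "r \<in> set ts \<or> r = t" for r
    using pos[OF that] by (intro coordinate_compose_measurable assms(2)) auto
  have "(\<integral>\<^sup>+w. (\<Prod>r\<in>set (t # ts). g r (w r)) \<partial>path_law (t # ts) s x) =
    (\<integral>\<^sup>+y. (\<integral>\<^sup>+w. (\<Prod>r\<in>set (t # ts). g r ((fun_upd w t y) r)) \<partial>path_law ts t y) \<partial>kernel (t - s) x)"
    using meas by (intro nn_integral_path_law_Cons Cons.prems borel_measurable_prod_ennreal) auto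
  also have "\<dots> = (\<integral>\<^sup>+y. g t y * iter g ts t y \<partial>kernel (t - s) x)"
  proof (intro nn_integral_cong)
    fix y
    have "(\<Prod>r\<in>set (t # ts). g r ((fun_upd w t y) r)) = g t y * (\<Prod>r\<in>set ts. g r (w r))" for w
    proof -
      have "(\<Prod>r\<in>set ts. g r ((fun_upd w t y) r)) = (\<Prod>r\<in>set ts. g r (w r))"
        using t(4) by (intro prod.cong) auto
      then show ?thesis using t(4) by simp
    qed
    then have "(\<integral>\<^sup>+w. (\<Prod>r\<in>set (t # ts). g r ((fun_upd w t y) r)) \<partial>path_law ts t y) =
      (\<integral>\<^sup>+w. g t y * (\<Prod>r\<in>set ts. g r (w r)) \<partial>path_law ts t y)" by presburger
    also have "\<dots> = g t y * (\<integral>\<^sup>+w. (\<Prod>r\<in>set ts. g r (w r)) \<partial>path_law ts t y)"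
      using meas by (intro nn_integral_cmult borel_measurable_prod_ennreal)
        (auto simp: measurable_cong_sets[OF sets_path_law[OF t(3)] refl])
    finally show "(\<integral>\<^sup>+w. (\<Prod>r\<in>set (t # ts). g r ((fun_upd w t y) r)) \<partial>path_law ts t y) = g t y * iter g ts t y"
      using Cons.IH[OF t(3)] by simp
  qed
  finally show ?case by simp
qed

lemma nn_integral_kernel_kernel:
  assumes "0 \<le> s" "0 \<le> t" "f \<in> borel_measurable borel"
  shows "(\<integral>\<^sup>+y. (\<integral>\<^sup>+z. f z \<partial>kernel t y) \<partial>kernel s x) = (\<integral>\<^sup>+z. f z \<partial>kernel (s + t) x)"
  unfolding chapman_kolmogorov[OF assms(1,2), symmetric]
  using kernel_measurable'[OF kernel_sets[OF assms(1)] assms(2)] assms(3)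
  by (intro nn_integral_bind[symmetric])

lemma times_filter: "times s ts \<Longrightarrow> times s (filter Q ts)"
  by (auto simp: times_def sorted_wrt_filter)

lemma iter_filter:
  assumes "times s ts" and g: "\<And>t. g t \<in> borel_measurable borel"
    and "\<And>t. t \<in> set ts \<Longrightarrow> t \<notin> J \<Longrightarrow> g t = (\<lambda>_. 1)"
  shows "iter g ts s x = iter g (filter (\<lambda>t. t \<in> J) ts) s x"
  using assms(1,3)
proof (induction ts arbitrary: s x)
  case (Cons t ts)
  then have t: "0 \<le> s" "s \<le> t" "times t ts" by (auto simp: times_Cons)
  have IH: "iter g ts t y = iter g (filter (\<lambda>t. t \<in> J) ts) t y" for y
    using Cons.IH[OF t(3)] Cons.prems(2) by auto
  show ?case
  proof (cases "t \<in> J")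
    case True
    then show ?thesis by (simp add: IH)
  next
    case False
    then have "g t = (\<lambda>_. 1)" using Cons.prems(2) by auto
    then have "iter g (t # ts) s x = (\<integral>\<^sup>+y. iter g (filter (\<lambda>t. t \<in> J) ts) t y \<partial>kernel (t - s) x)"
      by (simp add: IH)
    also have "\<dots> = iter g (filter (\<lambda>t. t \<in> J) ts) s x"
    proof (cases "filter (\<lambda>t. t \<in> J) ts")
      case Nil
      then show ?thesis using prob_space.emeasure_space_1[OF prob_space_kernel, of "t - s" x] t by simp
    next
      case (Cons r rs)
      have tr: "t \<le> r" "times r rs" using times_filter[OF t(3), of "\<lambda>t. t \<in> J"] by (auto simp: Cons times_Cons)
      have "(\<lambda>z. g r z * iter g rs r z) \<in> borel_measurable borel"
        by (intro borel_measurable_times_ennreal g iter_measurable tr)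
      from nn_integral_kernel_kernel[OF _ _ this, of "t - s" "r - t" x] show ?thesis
        using t tr by (simp add: Cons)
    qed
    finally show ?thesis using False by simp
  qed
qed simp

lemma times_sorted_list_of_set: "finite J \<Longrightarrow> J \<subseteq> {0..} \<Longrightarrow> times 0 (sorted_list_of_set J)"
  by (auto simp: times_def)

lemma filter_sorted_list_of_set:
  fixes H :: "real set"
  assumes "finite H" "J \<subseteq> H" shows "filter (\<lambda>t. t \<in> J) (sorted_list_of_set H) = sorted_list_of_set J"
  using assms finite_subset[OF assms(2,1)]
  by (intro sorted_distinct_set_unique) (auto intro: sorted_wrt_filter)

definition fdd :: "'a measure \<Rightarrow> real set \<Rightarrow> (real \<Rightarrow> 'a) measure" where
  "fdd \<nu> J = distr (\<nu> \<bind> path_law (sorted_list_of_set J) 0) (borel_PiM J) (\<lambda>w. restrict w J)"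

context
  fixes \<nu> :: "'a measure" assumes \<nu>: "prob_in_Mrho \<rho> \<nu>"
begin

lemma nu_in_prob_algebra: "\<nu> \<in> space (prob_algebra borel)"
  using prob_in_MrhoD[OF \<nu>] by (simp add: space_prob_algebra)

lemma
  assumes "finite J" "J \<subseteq> {0..}"
  shows sets_bind_path_law: "sets (\<nu> \<bind> path_law (sorted_list_of_set J) 0) = sets paths"
    and prob_space_bind_path_law: "prob_space (\<nu> \<bind> path_law (sorted_list_of_set J) 0)"
  using sets_bind'[OF nu_in_prob_algebra path_law_measurable[OF times_sorted_list_of_set[OF assms]]]
    prob_space_bind'[OF nu_in_prob_algebra path_law_measurable[OF times_sorted_list_of_set[OF assms]]]
  by simp_all

lemma sets_fdd: "sets (fdd \<nu> J) = sets (borel_PiM J)"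
  by (simp add: fdd_def)

lemma restrict_measurable_bind_path_law:
  assumes J: "finite J" "J \<subseteq> {0..}"
  shows "(\<lambda>w. restrict w J) \<in> (\<nu> \<bind> path_law (sorted_list_of_set J) 0) \<rightarrow>\<^sub>M borel_PiM J"
  using measurable_restrict_subset[OF J(2), of "\<lambda>_. borel"]
  by (simp add: measurable_cong_sets[OF sets_bind_path_law[OF J] refl])

lemma prob_space_fdd: "finite J \<Longrightarrow> J \<subseteq> {0..} \<Longrightarrow> prob_space (fdd \<nu> J)"
  unfolding fdd_def
  by (intro prob_space.prob_space_distr prob_space_bind_path_law restrict_measurable_bind_path_law)

lemma nn_integral_fdd:
  assumes J: "finite J" "J \<subseteq> {0..}" and g: "\<And>t. g t \<in> borel_measurable borel"
  shows "(\<integral>\<^sup>+w. (\<Prod>t\<in>J. g t (w t)) \<partial>fdd \<nu> J) = (\<integral>\<^sup>+x. iter g (sorted_list_of_set J) 0 x \<partial>\<nu>)"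
proof -
  note ts = times_sorted_list_of_set[OF J]
  have mJ: "(\<lambda>w. \<Prod>t\<in>J. g t (w t)) \<in> borel_measurable (borel_PiM J)"
    by (intro borel_measurable_prod_ennreal coordinate_compose_measurable g)
  have mP: "(\<lambda>w. \<Prod>t\<in>J. g t (w t)) \<in> borel_measurable paths"
    using J by (intro borel_measurable_prod_ennreal coordinate_compose_measurable g) auto
  have "(\<integral>\<^sup>+w. (\<Prod>t\<in>J. g t (w t)) \<partial>fdd \<nu> J) =
      (\<integral>\<^sup>+w. (\<Prod>t\<in>J. g t (restrict w J t)) \<partial>(\<nu> \<bind> path_law (sorted_list_of_set J) 0))"
    unfolding fdd_def using mJ by (intro nn_integral_distr restrict_measurable_bind_path_law J) simp
  also have "\<dots> = (\<integral>\<^sup>+w. (\<Prod>t\<in>J. g t (w t)) \<partial>(\<nu> \<bind> path_law (sorted_list_of_set J) 0))"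
    by (intro nn_integral_cong prod.cong) auto
  also have "\<dots> = (\<integral>\<^sup>+x. (\<integral>\<^sup>+w. (\<Prod>t\<in>J. g t (w t)) \<partial>path_law (sorted_list_of_set J) 0 x) \<partial>\<nu>)"
    using path_law_subprob[OF ts] prob_in_MrhoD[OF \<nu>]
    by (intro nn_integral_bind[OF mP]) (simp add: measurable_cong_sets[OF prob_in_MrhoD(1)[OF \<nu>] refl])
  also have "\<dots> = (\<integral>\<^sup>+x. iter g (sorted_list_of_set J) 0 x \<partial>\<nu>)"
    using nn_integral_path_law[OF ts g] J(1) by simp
  finally show ?thesis .
qed

lemma prod_indicator_PiE:
  assumes "finite J" "w \<in> extensional J"
  shows "(\<Prod>t\<in>J. indicator (A t) (w t)) = (indicator (\<Pi>\<^sub>E t\<in>J. A t) w :: ennreal)"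
  using assms by (auto simp: indicator_def PiE_iff prod_zero_iff) 

lemma emeasure_fdd:
  assumes J: "finite J" "J \<subseteq> {0..}" and A: "\<And>t. A t \<in> sets borel"
  shows "emeasure (fdd \<nu> J) (\<Pi>\<^sub>E t\<in>J. A t) = (\<integral>\<^sup>+x. iter (\<lambda>t. indicator (A t)) (sorted_list_of_set J) 0 x \<partial>\<nu>)"
proof -
  have "emeasure (fdd \<nu> J) (\<Pi>\<^sub>E t\<in>J. A t) = (\<integral>\<^sup>+w. indicator (\<Pi>\<^sub>E t\<in>J. A t) w \<partial>fdd \<nu> J)"
    using J A by (simp add: sets_fdd)
  also have "\<dots> = (\<integral>\<^sup>+w. (\<Prod>t\<in>J. indicator (A t) (w t)) \<partial>fdd \<nu> J)"
    using J(1) sets_eq_imp_space_eq[OF sets_fdd, of J]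
    by (intro nn_integral_cong prod_indicator_PiE[symmetric]) (auto simp: space_PiM PiE_iff)
  also have "\<dots> = (\<integral>\<^sup>+x. iter (\<lambda>t. indicator (A t)) (sorted_list_of_set J) 0 x \<partial>\<nu>)"
    using A by (intro nn_integral_fdd J) auto
  finally show ?thesis .
qed

text \<open>It suffices to compare boxes. A box over \<open>J\<close> becomes one over
  \<open>H\<close> with the whole space in the new coordinates, where the indicator factors are 1,
  so \<open>iter_filter\<close> applies.\<close>

lemma fdd_projective:
  assumes "J \<subseteq> H" and H: "finite H" "H \<subseteq> {0..}"
  shows "fdd \<nu> J = distr (fdd \<nu> H) (borel_PiM J) (\<lambda>w. restrict w J)"
proof (rule measure_eqI_PiM_finite[where A = "\<lambda>_. space (borel_PiM J)"])
  have J: "finite J" "J \<subseteq> {0..}" using assms finite_subset by auto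
  then show "finite J" by simp
  interpret prob_space "fdd \<nu> J" by (rule prob_space_fdd[OF J])
  show "range (\<lambda>_. space (borel_PiM J)) \<subseteq> prod_algebra J (\<lambda>_. borel)"
    using J by (auto simp: space_PiM intro!: prod_algebraI_finite)
  show "emeasure (fdd \<nu> J) (space (borel_PiM J)) \<noteq> \<infinity>" by simp
  fix A :: "real \<Rightarrow> 'a set" assume A: "\<And>i. i \<in> J \<Longrightarrow> A i \<in> sets borel"
  define B where "B t = (if t \<in> J then A t else UNIV)" for t
  have B: "B t \<in> sets borel" for t using A by (simp add: B_def)
  have "(\<lambda>w. restrict w J) -` (\<Pi>\<^sub>E t\<in>J. A t) \<inter> space (fdd \<nu> H) = (\<Pi>\<^sub>E t\<in>H. B t)"
    using sets_eq_imp_space_eq[OF sets_fdd, of H] subsetD[OF assms(1)]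
    by (auto simp: space_PiM B_def PiE_iff split: if_splits)
  then have "emeasure (distr (fdd \<nu> H) (borel_PiM J) (\<lambda>w. restrict w J)) (\<Pi>\<^sub>E t\<in>J. A t) = emeasure (fdd \<nu> H) (\<Pi>\<^sub>E t\<in>H. B t)"
    using A J measurable_restrict_subset[OF assms(1), of "\<lambda>_. borel"]
    by (subst emeasure_distr) (auto simp: measurable_cong_sets[OF sets_fdd refl])
  also have "\<dots> = (\<integral>\<^sup>+x. iter (\<lambda>t. indicator (B t)) (sorted_list_of_set H) 0 x \<partial>\<nu>)"
    by (rule emeasure_fdd[OF H B])
  also have "\<dots> = (\<integral>\<^sup>+x. iter (\<lambda>t. indicator (B t)) (sorted_list_of_set J) 0 x \<partial>\<nu>)"
    using iter_filter[OF times_sorted_list_of_set[OF H], of "\<lambda>t. indicator (B t)" J] B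
      filter_sorted_list_of_set[OF H(1) assms(1)] by (simp add: B_def indicator_def)
  also have "\<dots> = emeasure (fdd \<nu> J) (\<Pi>\<^sub>E t\<in>J. B t)"
    by (rule emeasure_fdd[OF J B, symmetric])
  also have "(\<Pi>\<^sub>E t\<in>J. B t) = (\<Pi>\<^sub>E t\<in>J. A t)" by (auto simp: B_def cong: PiE_cong)
  finally show "emeasure (fdd \<nu> J) (Pi\<^sub>E J A) = emeasure (distr (fdd \<nu> H) (borel_PiM J) (\<lambda>w. restrict w J)) (Pi\<^sub>E J A)" ..
qed (auto simp: sets_fdd)

lemma measure_fdd_single:
  assumes t: "0 \<le> t" and B: "B \<in> sets borel"
  shows "measure (fdd \<nu> {t}) {w \<in> space (fdd \<nu> {t}). w t \<in> B} = measure (\<nu> \<bind> kernel t) B"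
proof -
  note D = prob_in_MrhoD[OF \<nu>]
  have "{w \<in> space (fdd \<nu> {t}). w t \<in> B} = (\<Pi>\<^sub>E r\<in>{t}. B)"
    using sets_eq_imp_space_eq[OF sets_fdd, of "{t}"] by (auto simp: space_PiM PiE_iff extensional_def)
  then have "emeasure (fdd \<nu> {t}) {w \<in> space (fdd \<nu> {t}). w t \<in> B} = (\<integral>\<^sup>+x. emeasure (kernel t x) B \<partial>\<nu>)"
    using emeasure_fdd[of "{t}" "\<lambda>_. B"] t B by (simp add: sorted_list_of_set_insert_remove)
  also have "\<dots> = emeasure (\<nu> \<bind> kernel t) B"
    by (rule emeasure_bind_prob_algebra[OF nu_in_prob_algebra kernel_measurable[OF t] B, symmetric])
  finally show ?thesis by (simp add: measure_def)
qed

text \<open>The marginal at time \<open>t\<close> is \<open>\<nu> \<bind> kernel t\<close>, which is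
  Radon by \<open>prob_in_Mrho_bind_kernel\<close>.\<close>

lemma fdd_regular_projective: "regular_projective_family {0..} (fdd \<nu>)"
proof (intro regular_projective_family.intro projective_family.intro regular_projective_family_axioms.intro)
  show "J \<subseteq> H \<Longrightarrow> finite H \<Longrightarrow> H \<subseteq> {0..} \<Longrightarrow> fdd \<nu> J = distr (fdd \<nu> H) (borel_PiM J) (\<lambda>w. restrict w J)" for J H
    by (rule fdd_projective)
  show "finite J \<Longrightarrow> J \<subseteq> {0..} \<Longrightarrow> prob_space (fdd \<nu> J)" for J by (rule prob_space_fdd)
  show "Hausdorff_space (euclidean :: 'a topology)" using weighted_space by (simp add: weighted_space_def)
  fix t :: real and A :: "'a set" and e :: real assume t: "t \<in> {0..}" and A: "A \<in> sets borel" and e: "e > 0"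
  then have t0: "0 \<le> t" by simp
  note m = prob_in_Mrho_bind_kernel[OF \<nu> t0]
  interpret m: prob_space "\<nu> \<bind> kernel t" using prob_in_MrhoD(3)[OF m] .
  obtain K where K: "compact K" "K \<subseteq> A" "measure (\<nu> \<bind> kernel t) A < measure (\<nu> \<bind> kernel t) K + e"
    using prob_in_Mrho_approx[OF m A e] by blast
  have Kb: "K \<in> sets borel" using compact_imp_closed_Hausdorff[OF K(1)] by simp
  have "measure (\<nu> \<bind> kernel t) (A - K) < e"
    using m.finite_measure_Diff[of A K] K A Kb prob_in_MrhoD(1)[OF m] by simp
  then show "\<exists>K. compact K \<and> K \<subseteq> A \<and> measure (fdd \<nu> {t}) {w \<in> space (fdd \<nu> {t}). w t \<in> A - K} < e"
    using measure_fdd_single[OF t0, of "A - K"] A Kb K(1,2) by (intro exI[of _ K]) auto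
qed

text \<open>The path measure is passed on only through integrals of products, the form in which the
  Markov property is derived.\<close>

lemma path_measure_exists:
  "\<exists>M. prob_space M \<and> sets M = sets paths \<and>
    (\<forall>J g. finite J \<longrightarrow> J \<subseteq> {0..} \<longrightarrow> (\<forall>t. g t \<in> borel_measurable borel) \<longrightarrow>
      (\<integral>\<^sup>+w. (\<Prod>t\<in>J. g t (w t)) \<partial>M) = (\<integral>\<^sup>+x. iter g (sorted_list_of_set J) 0 x \<partial>\<nu>))"
proof -
  interpret F: regular_projective_family "{0..}" "fdd \<nu>" by (rule fdd_regular_projective)
  show ?thesis
  proof (intro exI[of _ F.lim] conjI allI impI)
    show "prob_space F.lim" by (rule F.prob_space_lim)
    show "sets F.lim = sets paths" by simp
    fix J :: "real set" and g :: "real \<Rightarrow> 'a \<Rightarrow> ennreal"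
    assume J: "finite J" "J \<subseteq> {0..}" and g: "\<forall>t. g t \<in> borel_measurable borel"
    have mJ: "(\<lambda>w. \<Prod>t\<in>J. g t (w t)) \<in> borel_measurable (borel_PiM J)"
      using g by (intro borel_measurable_prod_ennreal coordinate_compose_measurable) auto
    have "(\<integral>\<^sup>+x. iter g (sorted_list_of_set J) 0 x \<partial>\<nu>) = (\<integral>\<^sup>+w. (\<Prod>t\<in>J. g t (w t)) \<partial>fdd \<nu> J)"
      using g by (intro nn_integral_fdd[symmetric] J) auto
    also have "\<dots> = (\<integral>\<^sup>+w. (\<Prod>t\<in>J. g t (w t)) \<partial>distr F.lim (borel_PiM J) (\<lambda>w. restrict w J))"
      by (simp only: F.distr_lim[OF J])
    also have "\<dots> = (\<integral>\<^sup>+w. (\<Prod>t\<in>J. g t (restrict w J t)) \<partial>F.lim)"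
      using mJ measurable_restrict_subset[OF J(2), of "\<lambda>_. borel"]
      by (intro nn_integral_distr) (auto simp: measurable_cong_sets[OF F.sets_lim refl])
    also have "\<dots> = (\<integral>\<^sup>+w. (\<Prod>t\<in>J. g t (w t)) \<partial>F.lim)"
      by (intro nn_integral_cong prod.cong) auto
    finally show "(\<integral>\<^sup>+w. (\<Prod>t\<in>J. g t (w t)) \<partial>F.lim) = (\<integral>\<^sup>+x. iter g (sorted_list_of_set J) 0 x \<partial>\<nu>)" ..
  qed
qed

end

end

section \<open>Left approximation of the semigroup in norm\<close>

text \<open>Each point of \<open>S\<close> has a gap on its left. A rational in that gap lies above
  all smaller points of \<open>S\<close>, so distinct points receive distinct rationals.\<close>

lemma countable_left_isolated:
  fixes S :: "real set"
  assumes "\<And>r. r \<in> S \<Longrightarrow> \<exists>\<delta>>0. \<forall>h. 0 < h \<and> h < \<delta> \<longrightarrow> r - h \<notin> S"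
  shows "countable S"
proof -
  have "\<exists>q\<in>\<rat>. q < r \<and> (\<forall>s\<in>S. s < r \<longrightarrow> s < q)" if rS: "r \<in> S" for r
  proof -
    obtain \<delta> where \<delta>: "\<delta> > 0" "\<And>h. 0 < h \<Longrightarrow> h < \<delta> \<Longrightarrow> r - h \<notin> S" using assms[OF rS] by blast
    obtain q where q: "q \<in> \<rat>" "r - \<delta> < q" "q < r" using Rats_dense_in_real[of "r - \<delta>" r] \<delta>(1) by auto
    have "s < q" if "s \<in> S" "s < r" for s
      using \<delta>(2)[of "r - s"] that q(2) by force
    then show ?thesis using q by blast
  qed
  then obtain q where q: "\<And>r. r \<in> S \<Longrightarrow> q r \<in> \<rat>" "\<And>r. r \<in> S \<Longrightarrow> q r < r"
    "\<And>r s. r \<in> S \<Longrightarrow> s \<in> S \<Longrightarrow> s < r \<Longrightarrow> s < q r" by metis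
  have "inj_on q S"
  proof (rule linorder_inj_onI)
    fix r s assume "r < s" "r \<in> S" "s \<in> S"
    then show "q r \<noteq> q s" using q(2)[of r] q(3)[of s r] by simp
  qed auto
  moreover have "countable (q ` S)" using q(1) countable_rat by (intro countable_subset[of "q ` S" \<rat>]) auto
  ultimately show ?thesis by (rule countable_image_inj_on[rotated])
qed

text \<open>For each labelling and each label, the times isolated from the left within their class
  are countable. Over countably many labellings the exceptional times remain countable and cannot
  fill the interval.\<close>

lemma exists_left_accumulation:
  fixes c :: "nat \<Rightarrow> real \<Rightarrow> nat"
  assumes "a < b"
  shows "\<exists>r. a < r \<and> r < b \<and> (\<forall>k. \<forall>\<delta>>0. \<exists>h. 0 < h \<and> h < \<delta> \<and> c k (r - h) = c k r)"
proof -
  define S where "S k n = {r. c k r = n \<and> (\<exists>\<delta>>0. \<forall>h. 0 < h \<and> h < \<delta> \<longrightarrow> c k (r - h) \<noteq> n)}" for k n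
  have "countable (S k n)" for k n
    by (rule countable_left_isolated) (auto simp: S_def)
  then have "countable (\<Union>k. \<Union>n. S k n)" by auto
  moreover have "uncountable {a<..<b}" using assms by (rule uncountable_open_interval[THEN iffD2])
  ultimately obtain r where r: "a < r" "r < b" "r \<notin> (\<Union>k. \<Union>n. S k n)"
    by (metis countable_subset greaterThanLessThan_iff subsetI)
  then have "\<exists>h. 0 < h \<and> h < \<delta> \<and> c k (r - h) = c k r" if "\<delta> > 0" for k \<delta>
    using that by (auto simp: S_def)
  with r show ?thesis by blast
qed

text \<open>A family of continuous functions on a compact set which is pointwise right-continuous in the
  parameter is separable in the supremum norm: every member factors through the countably many
  members with rational parameter. The label of a member records how fine a rational grid
  controls its oscillation, and its rounded values on representatives of the cells of this grid.\<close>

lemma right_continuous_family_labels: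
  fixes F :: "real \<Rightarrow> 'a::topological_space \<Rightarrow> real"
  assumes K: "compact K" "closed K"
    and cont: "\<And>r. 0 \<le> r \<Longrightarrow> continuous_on K (F r)"
    and bound: "\<And>r x. 0 \<le> r \<Longrightarrow> \<bar>F r x\<bar> \<le> B"
    and right: "\<And>r x. 0 \<le> r \<Longrightarrow> ((\<lambda>h. F (r + h) x) \<longlongrightarrow> F r x) (at_right 0)"
    and \<eta>: "\<eta> > 0"
  obtains c :: "real \<Rightarrow> nat" where
    "\<And>r r' x. 0 \<le> r \<Longrightarrow> 0 \<le> r' \<Longrightarrow> c r = c r' \<Longrightarrow> x \<in> K \<Longrightarrow> \<bar>F r x - F r' x\<bar> \<le> 3 * \<eta>"
proof -
  define Q where "Q = {q \<in> \<rat>. (0::real) \<le> q}"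
  have "countable Q" using countable_rat by (intro countable_subset[of Q \<rat>]) (auto simp: Q_def)
  moreover have "Q \<noteq> {}" by (auto simp: Q_def intro!: exI[of _ 0])
  ultimately have rq: "range (from_nat_into Q) = Q" by (rule range_from_nat_into[rotated])
  define f where "f i = F (from_nat_into Q i)" for i
  have q0: "0 \<le> from_nat_into Q i" for i using rq by (auto simp: Q_def)
  \<comment> \<open>Rational times approach \<open>r\<close> from the right, so points that no
    rational member separates are not separated by \<open>F r\<close>.\<close>
  have sep: "F r x = F r y" if r: "0 \<le> r" and eq: "\<And>i. f i x = f i y" for r x y
  proof (rule ccontr)
    assume ne: "F r x \<noteq> F r y"
    define d where "d = \<bar>F r x - F r y\<bar> / 2"
    have d: "d > 0" using ne by (simp add: d_def)
    have "\<forall>\<^sub>F h in at_right 0. dist (F (r + h) x) (F r x) < d \<and> dist (F (r + h) y) (F r y) < d"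
      using tendstoD[OF right[OF r, of x] d] tendstoD[OF right[OF r, of y] d] by (rule eventually_conj)
    then obtain \<delta> where \<delta>: "\<delta> > 0" "\<And>h. 0 < h \<Longrightarrow> h < \<delta> \<Longrightarrow> dist (F (r + h) x) (F r x) < d \<and> dist (F (r + h) y) (F r y) < d"
      unfolding eventually_at_right_field by auto
    obtain q where q: "q \<in> \<rat>" "r < q" "q < r + \<delta>" using Rats_dense_in_real[of r "r + \<delta>"] \<delta>(1) by auto
    then have "q \<in> Q" using r by (auto simp: Q_def)
    then obtain i where "from_nat_into Q i = q" using rq by (metis imageE)
    then have "F q x = F q y" using eq[of i] by (simp add: f_def)
    moreover have "dist (F q x) (F r x) < d" "dist (F q y) (F r y) < d" using \<delta>(2)[of "q - r"] q by auto
    moreover have "\<bar>F r x - F r y\<bar> \<le> dist (F q y) (F r x) + dist (F q y) (F r y)"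
      unfolding dist_real_def by linarith
    ultimately show False by (simp add: d_def)
  qed
  have fine: "\<exists>m. \<forall>x\<in>K. \<forall>y\<in>K. (\<forall>i\<le>m. \<bar>f i x - f i y\<bar> \<le> 1 / real (Suc m)) \<longrightarrow> \<bar>F r x - F r y\<bar> < \<eta>"
    if r: "0 \<le> r" for r
  proof (rule ccontr)
    assume "\<not> ?thesis"
    then have no: "\<exists>x\<in>K. \<exists>y\<in>K. (\<forall>i\<le>m. \<bar>f i x - f i y\<bar> \<le> 1 / real (Suc m)) \<and> \<not> \<bar>F r x - F r y\<bar> < \<eta>" for m
      by blast
    have pr: "continuous_on (K \<times> K) (\<lambda>p. F s (fst p))" "continuous_on (K \<times> K) (\<lambda>p. F s (snd p))" if "0 \<le> s" for s
      using cont[OF that] by (auto intro!: continuous_on_compose2[OF cont[OF that]] continuous_intros)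
    have diff: "continuous_on (K \<times> K) (\<lambda>p. \<bar>F s (fst p) - F s (snd p)\<bar>)" if "0 \<le> s" for s
      using pr[OF that] by (intro continuous_intros)
    have KK: "closed (K \<times> K)" "compact (K \<times> K)" using K by (auto intro: closed_Times compact_Times)
    \<comment> \<open>Pairs on which \<open>F r\<close> differs by at least \<open>\<eta>\<close>
      although the first \<open>m + 1\<close> rational members nearly agree. A pair common to all
      \<open>E m\<close> contradicts \<open>sep\<close>.\<close>
    define E where "E m = ((K \<times> K) \<inter> (\<lambda>p. \<bar>F r (fst p) - F r (snd p)\<bar>) -` {\<eta>..}) \<inter>
      (\<Inter>i\<in>{..m}. (K \<times> K) \<inter> (\<lambda>p. \<bar>f i (fst p) - f i (snd p)\<bar>) -` {..1 / real (Suc m)})" for m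
    have "(K \<times> K) \<inter> (\<Inter>m. E m) \<noteq> {}"
    proof (rule compact_decseq_Inter_nonempty[OF KK(2)])
      fix m
      show "closed (E m)"
        unfolding E_def f_def
        by (intro closed_Int closed_INT ballI continuous_closed_preimage[OF diff KK(1)] closed_atLeast closed_atMost r q0)
      obtain x y where xy: "x \<in> K" "y \<in> K" "\<And>i. i \<le> m \<Longrightarrow> \<bar>f i x - f i y\<bar> \<le> 1 / real (Suc m)" "\<eta> \<le> \<bar>F r x - F r y\<bar>"
        using no[of m] unfolding not_less by blast
      then have "(x, y) \<in> (K \<times> K) \<inter> E m" by (simp add: E_def)
      then show "(K \<times> K) \<inter> E m \<noteq> {}" by blast
    next
      show "decseq E"
      proof (rule decseq_SucI, rule subsetI)
        fix m p assume p: "p \<in> E (Suc m)"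
        have "1 / real (Suc (Suc m)) \<le> 1 / real (Suc m)" by (simp add: frac_le)
        with p show "p \<in> E m" unfolding E_def by (auto intro: order_trans)
      qed
    qed
    then obtain p where "\<And>m. p \<in> E m" by blast
    then have xy: "(x, y) \<in> E m" if "x = fst p" "y = snd p" for m x y using that by simp
    define x y where "x = fst p" and "y = snd p"
    note xy = xy[OF this]
    have "f i x = f i y" for i
    proof (rule ccontr)
      assume "f i x \<noteq> f i y"
      then obtain m where m: "1 / real (Suc m) < \<bar>f i x - f i y\<bar>"
        using reals_Archimedean[of "\<bar>f i x - f i y\<bar>"] by (auto simp: inverse_eq_divide)
      have "1 / real (Suc (max i m)) \<le> 1 / real (Suc m)" by (intro divide_left_mono) auto
      moreover have "\<bar>f i x - f i y\<bar> \<le> 1 / real (Suc (max i m))" using xy[of "max i m"] by (auto simp: E_def)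
      ultimately show False using m by linarith
    qed
    then have "F r x = F r y" by (rule sep[OF r])
    then show False using xy[of 0] \<eta> by (auto simp: E_def)
  qed
  then have "\<forall>r. \<exists>m. 0 \<le> r \<longrightarrow> (\<forall>x\<in>K. \<forall>y\<in>K. (\<forall>i\<le>m. \<bar>f i x - f i y\<bar> \<le> 1 / real (Suc m)) \<longrightarrow> \<bar>F r x - F r y\<bar> < \<eta>)"
    by blast
  from choice[OF this] obtain \<mu> where
    \<mu>': "\<forall>r. 0 \<le> r \<longrightarrow> (\<forall>x\<in>K. \<forall>y\<in>K. (\<forall>i\<le>\<mu> r. \<bar>f i x - f i y\<bar> \<le> 1 / real (Suc (\<mu> r))) \<longrightarrow> \<bar>F r x - F r y\<bar> < \<eta>)" ..
  have \<mu>: "0 \<le> r \<Longrightarrow> x \<in> K \<Longrightarrow> y \<in> K \<Longrightarrow>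
      (\<And>i. i \<le> \<mu> r \<Longrightarrow> \<bar>f i x - f i y\<bar> \<le> 1 / real (Suc (\<mu> r))) \<Longrightarrow> \<bar>F r x - F r y\<bar> < \<eta>" for r x y
    using \<mu>' by simp
  \<comment> \<open>The cell of \<open>x\<close> on the grid of mesh 1/(m+1): equal keys force the
    values of \<open>f 0\<close>, ..., \<open>f m\<close> to differ by at most the mesh.\<close>
  define key where "key m x = map (\<lambda>i. \<lfloor>real (Suc m) * f i x\<rfloor>) [0..<Suc m]" for m x
  have key: "\<bar>f i x - f i y\<bar> \<le> 1 / real (Suc m)" if "key m x = key m y" "i \<le> m" for m x y i
  proof -
    have fl: "\<lfloor>real (Suc m) * f i x\<rfloor> = \<lfloor>real (Suc m) * f i y\<rfloor>"
      using that by (auto simp: key_def map_eq_conv simp del: upt_Suc)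
    have "\<bar>real (Suc m) * f i x - real (Suc m) * f i y\<bar> \<le> 1"
      using fl by linarith
    then have "real (Suc m) * \<bar>f i x - f i y\<bar> \<le> 1"
      by (simp add: abs_mult right_diff_distrib[symmetric] del: of_nat_Suc)
    then show ?thesis by (simp add: field_simps)
  qed
  have fin: "finite (key m ` K)" for m
  proof (rule finite_subset)
    define A where "A = {\<lfloor>real (Suc m) * (- B)\<rfloor>..\<lfloor>real (Suc m) * B\<rfloor>}"
    have "\<lfloor>real (Suc m) * f i x\<rfloor> \<in> A" for i x
    proof -
      have "- B \<le> f i x" "f i x \<le> B" using bound[OF q0[of i], of x] by (auto simp: f_def)
      then show ?thesis unfolding A_def atLeastAtMost_iff by (intro conjI floor_mono mult_left_mono) auto
    qed
    then show "key m ` K \<subseteq> {l. set l \<subseteq> A \<and> length l = Suc m}" by (auto simp: key_def simp del: upt_Suc)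
    show "finite {l. set l \<subseteq> A \<and> length l = Suc m}" by (intro finite_lists_length_eq) (simp add: A_def)
  qed
  have "\<forall>m. \<exists>l. set l = key m ` K" using finite_list[OF fin] by blast
  then obtain cells where cells: "\<And>m. set (cells m) = key m ` K" by metis
  define rep where "rep m v = (SOME x. x \<in> K \<and> key m x = v)" for m v
  have rep: "rep m (key m x) \<in> K" "key m (rep m (key m x)) = key m x" if "x \<in> K" for m x
    unfolding rep_def using someI[of "\<lambda>y. y \<in> K \<and> key m y = key m x" x] that by auto
  \<comment> \<open>The grid size \<open>\<mu> r\<close> and finitely many rounded values form a
    countable datum, encoded as a natural number.\<close>
  define c where "c r = to_nat (\<mu> r, map (\<lambda>v. \<lfloor>F r (rep (\<mu> r) v) / \<eta>\<rfloor>) (cells (\<mu> r)))" for r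
  show thesis
  proof (rule that)
    fix r r' x assume r: "0 \<le> r" "0 \<le> r'" and "c r = c r'" and x: "x \<in> K"
    then have eq: "\<mu> r = \<mu> r'" "map (\<lambda>v. \<lfloor>F r (rep (\<mu> r) v) / \<eta>\<rfloor>) (cells (\<mu> r)) = map (\<lambda>v. \<lfloor>F r' (rep (\<mu> r) v) / \<eta>\<rfloor>) (cells (\<mu> r))"
      by (auto simp: c_def)
    define y where "y = rep (\<mu> r) (key (\<mu> r) x)"
    have y: "y \<in> K" "key (\<mu> r) x = key (\<mu> r) y" using rep[OF x] by (auto simp: y_def)
    have 1: "\<bar>F r x - F r y\<bar> < \<eta>" by (intro \<mu> r x y key)
    have 2: "\<bar>F r' x - F r' y\<bar> < \<eta>" using eq(1) y(2) by (intro \<mu> r x y(1) key) auto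
    have "key (\<mu> r) x \<in> set (cells (\<mu> r))" using x cells by auto
    then have "\<lfloor>F r y / \<eta>\<rfloor> = \<lfloor>F r' y / \<eta>\<rfloor>" using eq(2) unfolding y_def map_eq_conv by blast
    then have "\<bar>F r y / \<eta> - F r' y / \<eta>\<bar> \<le> 1" by linarith
    then have "\<bar>F r y - F r' y\<bar> \<le> \<eta>"
      using \<eta> by (simp add: diff_divide_distrib[symmetric] abs_divide)
    \<comment> \<open>Moving from \<open>x\<close> to its representative costs \<open>\<eta>\<close>
      for each of the two members, and the rounding there another \<open>\<eta>\<close>.\<close>
    then show "\<bar>F r x - F r' x\<bar> \<le> 3 * \<eta>" using 1 2 by linarith
  qed
qed

context feller
begin

lemma P_right_tendsto:
  assumes "0 \<le> r" "f \<in> Brho \<rho>" shows "((\<lambda>h. P (r + h) f x) \<longlongrightarrow> P r f x) (at_right 0)"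
proof -
  have "((\<lambda>h. P h (P r f) x) \<longlongrightarrow> P r f x) (at_right 0)" by (rule P_tendsto[OF P_Brho[OF assms]])
  moreover have "\<forall>\<^sub>F h in at_right 0. P h (P r f) x = P (r + h) f x"
    using P_semigroup[OF assms] by (auto simp: eventually_at_filter)
  ultimately show ?thesis by (rule Lim_transform_eventually)
qed

text \<open>On the compact set where \<open>\<rho> \<le> R\<close> the labels are taken with
  \<open>3 * \<eta> = e * rho_min\<close>, which is at most \<open>e * \<rho> x\<close>. Where
  \<open>\<rho> > R\<close>, the uniform bound \<open>2 * B \<le> e * R\<close> is enough.\<close>

lemma P_labels:
  assumes f: "f \<in> Brho \<rho>" and B: "\<And>x. \<bar>f x\<bar> \<le> B" and e: "e > 0"
  shows "\<exists>c :: real \<Rightarrow> nat. \<forall>r r'. 0 \<le> r \<longrightarrow> 0 \<le> r' \<longrightarrow> c r = c r' \<longrightarrow> (\<forall>x. \<bar>P r f x - P r' f x\<bar> \<le> e * \<rho> x)"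
proof -
  have B0: "B \<ge> 0" using B by (meson abs_ge_zero order_trans)
  define R where "R = (2 * B + 1) / e"
  have R: "R > 0" "2 * B \<le> e * R" using e B0 by (auto simp: R_def)
  have bd: "\<bar>P r f x\<bar> \<le> B" if "0 \<le> r" for r x by (rule P_bounded[OF that f B])
  have \<eta>: "e * rho_min / 3 > 0" using e rho_min(1) by simp
  obtain c :: "real \<Rightarrow> nat" where c: "\<And>r r' x. 0 \<le> r \<Longrightarrow> 0 \<le> r' \<Longrightarrow> c r = c r' \<Longrightarrow> x \<in> {x. \<rho> x \<le> R} \<Longrightarrow>
      \<bar>P r f x - P r' f x\<bar> \<le> 3 * (e * rho_min / 3)"
    using right_continuous_family_labels[OF compact_sublevel closed_sublevel Brho_continuous_on[OF P_Brho[OF _ f]]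
        bd P_right_tendsto[OF _ f] \<eta>] by metis
  have "\<bar>P r f x - P r' f x\<bar> \<le> e * \<rho> x" if r: "0 \<le> r" "0 \<le> r'" "c r = c r'" for r r' x
  proof (cases "\<rho> x \<le> R")
    case True
    have "\<bar>P r f x - P r' f x\<bar> \<le> e * rho_min" using c[OF r, of x] True by simp
    also have "\<dots> \<le> e * \<rho> x" using e rho_min(2) by (intro mult_left_mono) auto
    finally show ?thesis .
  next
    case False
    have "\<bar>P r f x - P r' f x\<bar> \<le> 2 * B" using bd[OF r(1), of x] bd[OF r(2), of x] by linarith
    also have "\<dots> \<le> e * \<rho> x" using R(2) mult_left_mono[of R "\<rho> x" e] False e by linarith
    finally show ?thesis .
  qed
  then show ?thesis by blast
qed

text \<open>Left approximation in norm holds at some time \<open>r < T\<close>, because all but countably many times are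
  limits from the left of times with the same label; the bounded operator \<open>P (T - r)\<close> carries it to \<open>T\<close>.\<close>

lemma P_left_approx:
  assumes f: "f \<in> Brho \<rho>" and B: "\<And>x. \<bar>f x\<bar> \<le> B" and T: "T > 0" and e: "e > 0" and d: "d > 0"
  shows "\<exists>h. 0 < h \<and> h < d \<and> h < T \<and> (\<forall>x. \<bar>P (T - h) f x - P T f x\<bar> \<le> e * \<rho> x)"
proof -
  \<comment> \<open>One labelling for each tolerance 1/(k+1): the tolerance required depends on the
    bound \<open>C\<close> for \<open>P (T - r)\<close>, known only once \<open>r\<close> is fixed,
    so \<open>r\<close> must be good for all \<open>k\<close> at once.\<close>
  have "\<exists>c :: real \<Rightarrow> nat. \<forall>r r'. 0 \<le> r \<longrightarrow> 0 \<le> r' \<longrightarrow> c r = c r' \<longrightarrow> (\<forall>x. \<bar>P r f x - P r' f x\<bar> \<le> 1 / real (Suc k) * \<rho> x)" for k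
    by (rule P_labels[OF f B]) auto
  then obtain c :: "nat \<Rightarrow> real \<Rightarrow> nat" where c: "\<And>k r r' x. 0 \<le> r \<Longrightarrow> 0 \<le> r' \<Longrightarrow> c k r = c k r' \<Longrightarrow>
      \<bar>P r f x - P r' f x\<bar> \<le> 1 / real (Suc k) * \<rho> x" by metis
  obtain r where r: "0 < r" "r < T" "\<And>k \<delta>. \<delta> > 0 \<Longrightarrow> \<exists>h. 0 < h \<and> h < \<delta> \<and> c k (r - h) = c k r"
    using exists_left_accumulation[OF T, of c] by blast
  define a where "a = T - r"
  have a: "0 \<le> a" "T = r + a" using r by (auto simp: a_def)
  obtain C where C: "opbound a C" using opbound_exists[OF a(1)] by blast
  have C0: "C \<ge> 0" using C by (simp add: opbound_def)
  have "e / (C + 1) > 0" using e C0 by simp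
  then obtain k where k: "1 / real (Suc k) < e / (C + 1)" using reals_Archimedean unfolding inverse_eq_divide by blast
  obtain h where h: "0 < h" "h < min d r" "c k (r - h) = c k r" using r(3)[of "min d r" k] d r(1) by auto
  have rh: "0 \<le> r - h" "0 \<le> r" using h r by auto
  have le: "\<bar>P (r - h) f x - P r f x\<bar> \<le> 1 / real (Suc k) * \<rho> x" for x by (rule c[OF rh h(3)])
  have "\<bar>P (T - h) f x - P T f x\<bar> \<le> e * \<rho> x" for x
  proof -
    interpret weighted_functional \<rho> "\<lambda>f. P a f x" "C * \<rho> x" by (rule P_functional[OF a(1) C])
    have "P (T - h) f x = P a (P (r - h) f) x" "P T f x = P a (P r f) x"
      using P_semigroup[OF rh(1) f a(1)] P_semigroup[OF rh(2) f a(1)] a(2) by (auto simp: algebra_simps)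
    then have "\<bar>P (T - h) f x - P T f x\<bar> \<le> C * \<rho> x * (1 / real (Suc k))"
      using L_diff_le[OF P_Brho[OF rh(1) f] P_Brho[OF rh(2) f] _ le] by simp
    also have "\<dots> \<le> C * \<rho> x * (e / (C + 1))"
      using k C0 rho_pos[of x] by (intro mult_left_mono) auto
    also have "\<dots> = (C / (C + 1)) * (e * \<rho> x)" by simp
    also have "\<dots> \<le> 1 * (e * \<rho> x)" using C0 e rho_pos[of x] by (intro mult_right_mono) auto
    finally show ?thesis by simp
  qed
  then show ?thesis using h r by (intro exI[of _ h]) auto
qed

end

section \<open>The Markov property for the natural filtration\<close>

lemma sorted_list_of_set_snoc:
  fixes t :: real
  assumes "finite H" "\<And>r. r \<in> H \<Longrightarrow> r < t"
  shows "sorted_list_of_set (insert t H) = sorted_list_of_set H @ [t]"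
proof (rule sorted_distinct_set_unique)
  have "r \<le> t" if "r \<in> H" for r using assms(2)[OF that] by simp
  then show "sorted (sorted_list_of_set H @ [t])" using assms(1) by (simp add: sorted_append)
  have "t \<notin> H" using assms(2) by blast
  then show "distinct (sorted_list_of_set H @ [t])" using assms(1) by simp
  show "set (sorted_list_of_set (insert t H)) = set (sorted_list_of_set H @ [t])"
    using assms(1) set_sorted_list_of_set[of "insert t H"] by (simp del: sorted_list_of_set_insert_remove)
qed (rule sorted_sorted_list_of_set distinct_sorted_list_of_set)+

locale feller_path = feller \<rho> P
  for \<rho> :: "'a::topological_space \<Rightarrow> real" and P +
  fixes \<nu> :: "'a measure" and M :: "(real \<Rightarrow> 'a) measure"
  assumes nu: "prob_in_Mrho \<rho> \<nu>"
    and prob_space_M: "prob_space M"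
    and sets_M: "sets M = sets paths"
    and finite_dimensional: "\<And>J g. finite J \<Longrightarrow> J \<subseteq> {0..} \<Longrightarrow> (\<And>t. g t \<in> borel_measurable borel) \<Longrightarrow>
      (\<integral>\<^sup>+w. (\<Prod>t\<in>J. g t (w t)) \<partial>M) = (\<integral>\<^sup>+x. iter g (sorted_list_of_set J) 0 x \<partial>\<nu>)"
begin

sublocale prob_space M by (rule prob_space_M)

lemma coord_measurable:
  assumes "0 \<le> t" "g \<in> borel \<rightarrow>\<^sub>M N" shows "(\<lambda>w. g (w t)) \<in> M \<rightarrow>\<^sub>M N"
  unfolding measurable_cong_sets[OF sets_M refl]
  by (rule coordinate_compose_measurable[OF _ assms(2)]) (use assms(1) in simp)

text \<open>Integrating out the last time turns its factor into a function of the state at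
  \<open>s\<close>: the Markov property for iterated integrals.\<close>

lemma iter_snoc:
  assumes "times r (ts @ [s, t])"
  shows "iter g (ts @ [s, t]) r x =
    iter (fun_upd g s (\<lambda>y. g s y * (\<integral>\<^sup>+z. g t z \<partial>kernel (t - s) y))) (ts @ [s]) r x"
  using assms
proof (induction ts arbitrary: r x)
  case (Cons a ts)
  then have "times a (ts @ [s, t])" "a \<noteq> s" by (auto simp: times_Cons)
  then show ?case using Cons.IH by simp
qed simp

lemma markov_prod:
  assumes s: "0 \<le> s" "s \<le> t" and J: "finite J" "J \<subseteq> {0..s}"
    and g: "\<And>r. g r \<in> borel_measurable borel" and f: "f \<in> borel_measurable borel"
  shows "(\<integral>\<^sup>+w. f (w t) * (\<Prod>r\<in>J. g r (w r)) \<partial>M) =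
    (\<integral>\<^sup>+w. (\<integral>\<^sup>+z. f z \<partial>kernel (t - s) (w s)) * (\<Prod>r\<in>J. g r (w r)) \<partial>M)"
\<comment> \<open>The main case lists \<open>s\<close> and \<open>t\<close> as distinct times, hence
  the separate treatment of equality.\<close>
proof (cases "s = t")
  case True
  then show ?thesis using f by (simp add: kernel_0 nn_integral_return)
next
  case False
  then have st: "s < t" using s by simp
  define H where "H = insert s J"
  have H: "finite H" "H \<subseteq> {0..}" "\<And>r. r \<in> H \<Longrightarrow> r < t" "insert t H \<subseteq> {0..}" "t \<notin> H"
    using J s st by (auto simp: H_def)
  \<comment> \<open>The time \<open>s\<close> may be missing from \<open>J\<close>; the factor 1
    lets it be listed without changing the product.\<close>
  define g1 where "g1 r = (if r \<in> J then g r else (\<lambda>_. 1))" for r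
  have g1: "g1 r \<in> borel_measurable borel" for r using g by (simp add: g1_def)
  define k where "k y = (\<integral>\<^sup>+z. f z \<partial>kernel (t - s) y)" for y
  have k: "k \<in> borel_measurable borel" unfolding k_def using st f by (intro nn_integral_kernel_measurable) auto
  define g2 where "g2 = fun_upd g1 t f"
  define g3 where "g3 = fun_upd g2 s (\<lambda>y. g2 s y * (\<integral>\<^sup>+z. g2 t z \<partial>kernel (t - s) y))"
  have g2: "g2 r \<in> borel_measurable borel" for r using g1 f by (simp add: g2_def)
  have g3s: "g3 s = (\<lambda>y. g1 s y * k y)" using st by (simp add: g3_def g2_def k_def)
  have g3: "g3 r \<in> borel_measurable borel" for r
    using g2 g1 k g3s by (cases "r = s") (auto simp: g3_def)
  have prod1: "(\<Prod>r\<in>H. g1 r (w r)) = (\<Prod>r\<in>J. g r (w r))" for w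
  proof -
    have "(\<Prod>r\<in>J. g1 r (w r)) = (\<Prod>r\<in>J. g r (w r))" by (intro prod.cong) (auto simp: g1_def)
    then show ?thesis using J(1) by (cases "s \<in> J") (auto simp: H_def insert_absorb g1_def)
  qed
  have "(\<integral>\<^sup>+w. f (w t) * (\<Prod>r\<in>J. g r (w r)) \<partial>M) = (\<integral>\<^sup>+w. (\<Prod>r\<in>insert t H. g2 r (w r)) \<partial>M)"
  proof (intro nn_integral_cong)
    fix w
    have "(\<Prod>r\<in>H. g2 r (w r)) = (\<Prod>r\<in>H. g1 r (w r))" using H(5) by (intro prod.cong) (auto simp: g2_def)
    then show "f (w t) * (\<Prod>r\<in>J. g r (w r)) = (\<Prod>r\<in>insert t H. g2 r (w r))"
      using H(1,5) prod1 by (simp add: g2_def)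
  qed
  also have "\<dots> = (\<integral>\<^sup>+x. iter g2 (sorted_list_of_set (insert t H)) 0 x \<partial>\<nu>)"
    using H g2 by (intro finite_dimensional) auto
  also have "\<dots> = (\<integral>\<^sup>+x. iter g3 (sorted_list_of_set H) 0 x \<partial>\<nu>)"
  proof -
    define us where "us = sorted_list_of_set (H - {s})"
    have "r < s" if "r \<in> H - {s}" for r using that J(2) by (force simp: H_def)
    then have "sorted_list_of_set (insert s (H - {s})) = us @ [s]"
      unfolding us_def using H(1) by (intro sorted_list_of_set_snoc) auto
    then have us: "sorted_list_of_set H = us @ [s]" by (simp add: H_def insert_absorb del: sorted_list_of_set_insert_remove)
    have ust: "sorted_list_of_set (insert t H) = us @ [s, t]"
      using sorted_list_of_set_snoc[OF H(1,3)] us by simp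
    have "times 0 (us @ [s, t])"
      unfolding ust[symmetric] using H by (intro times_sorted_list_of_set) auto
    then show ?thesis unfolding us ust g3_def by (simp only: iter_snoc)
  qed
  also have "\<dots> = (\<integral>\<^sup>+w. (\<Prod>r\<in>H. g3 r (w r)) \<partial>M)"
    using H g3 by (intro finite_dimensional[symmetric]) auto
  also have "\<dots> = (\<integral>\<^sup>+w. k (w s) * (\<Prod>r\<in>J. g r (w r)) \<partial>M)"
  proof (intro nn_integral_cong)
    fix w
    have "(\<Prod>r\<in>H - {s}. g3 r (w r)) = (\<Prod>r\<in>H - {s}. g1 r (w r))"
      using H(5) by (intro prod.cong) (auto simp: g3_def g2_def)
    moreover have "s \<in> H" by (simp add: H_def)
    ultimately have "(\<Prod>r\<in>H. g3 r (w r)) = k (w s) * (\<Prod>r\<in>H. g1 r (w r))"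
      using H(1) by (simp add: prod.remove[of H s] g3s mult_ac)
    then show "(\<Prod>r\<in>H. g3 r (w r)) = k (w s) * (\<Prod>r\<in>J. g r (w r))" by (simp add: prod1)
  qed
  finally show ?thesis by (simp add: k_def)
qed

section \<open>Cylinder events and the natural filtration\<close>

definition cylinders :: "real \<Rightarrow> (real \<Rightarrow> 'a) set set" where
  "cylinders s = {{w \<in> space M. \<forall>r\<in>J. w r \<in> B r} | J B. finite J \<and> J \<subseteq> {0..s} \<and> (\<forall>r. B r \<in> sets borel)}"

definition natural :: "real \<Rightarrow> (real \<Rightarrow> 'a) set set" where
  "natural s = sigma_sets (space M) (cylinders s)"

lemma cylindersE:
  assumes "A \<in> cylinders s"
  obtains J B where "A = {w \<in> space M. \<forall>r\<in>J. w r \<in> B r}" "finite J" "J \<subseteq> {0..s}" "\<forall>r. B r \<in> sets borel"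
  using assms unfolding cylinders_def mem_Collect_eq by (elim exE conjE) (rule that)

lemma cylinders_Pow: "cylinders s \<subseteq> Pow (space M)"
  by (auto simp: cylinders_def)

lemma cylinder_single: "0 \<le> r \<Longrightarrow> r \<le> s \<Longrightarrow> B \<in> sets borel \<Longrightarrow> {w \<in> space M. w r \<in> B} \<in> cylinders s"
  unfolding cylinders_def by (intro CollectI exI[of _ "{r}"] exI[of _ "\<lambda>_. B"]) auto

lemma Int_stable_cylinders: "Int_stable (cylinders s)"
proof (rule Int_stableI)
  fix a b assume a: "a \<in> cylinders s" and b: "b \<in> cylinders s"
  from a obtain J B where A: "a = {w \<in> space M. \<forall>r\<in>J. w r \<in> B r}" "finite J" "J \<subseteq> {0..s}" "\<forall>r. B r \<in> sets borel"
    by (rule cylindersE)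
  from b obtain J' B' where B: "b = {w \<in> space M. \<forall>r\<in>J'. w r \<in> B' r}" "finite J'" "J' \<subseteq> {0..s}" "\<forall>r. B' r \<in> sets borel"
    by (rule cylindersE)
  define B'' where "B'' r = (if r \<in> J then B r else UNIV) \<inter> (if r \<in> J' then B' r else UNIV)" for r
  have "a \<inter> b = {w \<in> space M. \<forall>r\<in>J \<union> J'. w r \<in> B'' r}" by (auto simp: A(1) B(1) B''_def)
  moreover have "B'' r \<in> sets borel" for r using A(4) B(4) by (auto simp: B''_def)
  ultimately show "a \<inter> b \<in> cylinders s"
    unfolding cylinders_def using A(2,3) B(2,3) by (intro CollectI exI[of _ "J \<union> J'"] exI[of _ B'']) auto
qed

lemma cylinders_sets: "cylinders s \<subseteq> sets M"
proof
  fix A assume "A \<in> cylinders s"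
  then obtain J B where A: "A = {w \<in> space M. \<forall>r\<in>J. w r \<in> B r}" "finite J" "J \<subseteq> {0..s}" "\<forall>r. B r \<in> sets borel"
    by (rule cylindersE)
  have "{w \<in> space M. w r \<in> B r} \<in> sets M" if "r \<in> J" for r
  proof -
    have "0 \<le> r" using A(3) that by auto
    from measurable_sets[OF coord_measurable[OF this, of "\<lambda>x. x" borel], of "B r"] A(4)
    show ?thesis by (simp add: vimage_def Int_def conj_commute)
  qed
  then have "(\<Inter>r\<in>J. {w \<in> space M. w r \<in> B r}) \<inter> space M \<in> sets M"
    using A(2) by (cases "J = {}") (auto intro!: sets.finite_INT sets.Int)
  moreover have "A = (\<Inter>r\<in>J. {w \<in> space M. w r \<in> B r}) \<inter> space M" by (auto simp: A(1))
  ultimately show "A \<in> sets M" by simp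
qed

lemma natural_sets: "natural s \<subseteq> sets M"
  unfolding natural_def using cylinders_sets by (rule sets.sigma_sets_subset)

lemma natural_mono: "s \<le> t \<Longrightarrow> natural s \<subseteq> natural t"
  unfolding natural_def
proof (intro sigma_sets_mono' subsetI)
  fix A assume "s \<le> t" "A \<in> cylinders s"
  from this(2) obtain J B where J: "A = {w \<in> space M. \<forall>r\<in>J. w r \<in> B r}" "finite J" "J \<subseteq> {0..s}" "\<forall>r. B r \<in> sets borel"
    by (rule cylindersE)
  then have "J \<subseteq> {0..t}" using \<open>s \<le> t\<close> by auto
  with J show "A \<in> cylinders t" unfolding cylinders_def by blast
qed

lemma sigma_algebra_natural: "sigma_algebra (space M) (natural s)"
  unfolding natural_def by (rule sigma_algebra_sigma_sets[OF cylinders_Pow])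

text \<open>Cylinders form an intersection-stable generator, so Dynkin's argument extends
  \<open>markov_prod\<close>. The bound \<open>f \<le> 1\<close> keeps the integrals finite, which
  allows cancellation for complements.\<close>

lemma nn_markov_natural:
  assumes s: "0 \<le> s" "s \<le> t" and f: "f \<in> borel_measurable borel" "\<And>x. f x \<le> (1::ennreal)"
    and A: "A \<in> natural s"
  shows "(\<integral>\<^sup>+w. f (w t) * indicator A w \<partial>M) =
    (\<integral>\<^sup>+w. (\<integral>\<^sup>+z. f z \<partial>kernel (t - s) (w s)) * indicator A w \<partial>M)"
proof -
  define X where "X w = f (w t)" for w
  define Y where "Y w = (\<integral>\<^sup>+z. f z \<partial>kernel (t - s) (w s))" for w
  have t: "0 \<le> t" "0 \<le> t - s" using s by auto
  have X: "X \<in> borel_measurable M" unfolding X_def using f(1) t by (intro coord_measurable)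
  have Y: "Y \<in> borel_measurable M"
    unfolding Y_def using f(1) t s by (intro coord_measurable nn_integral_kernel_measurable)
  have X1: "X w \<le> 1" for w using f(2) by (simp add: X_def)
  have cyl: "(\<integral>\<^sup>+w. X w * indicator A w \<partial>M) = (\<integral>\<^sup>+w. Y w * indicator A w \<partial>M)" if Ac: "A \<in> cylinders s" for A
  proof -
    from Ac obtain J B where J: "A = {w \<in> space M. \<forall>r\<in>J. w r \<in> B r}" "finite J" "J \<subseteq> {0..s}" "\<forall>r. B r \<in> sets borel"
      by (rule cylindersE)
    have ind: "(indicator A w :: ennreal) = (\<Prod>r\<in>J. indicator (B r) (w r))" if "w \<in> space M" for w
      using that J(2) by (auto simp: J(1) indicator_def)
    have "(\<integral>\<^sup>+w. X w * indicator A w \<partial>M) = (\<integral>\<^sup>+w. f (w t) * (\<Prod>r\<in>J. indicator (B r) (w r)) \<partial>M)"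
      by (intro nn_integral_cong) (simp add: ind X_def)
    also have "\<dots> = (\<integral>\<^sup>+w. Y w * (\<Prod>r\<in>J. indicator (B r) (w r)) \<partial>M)"
      unfolding Y_def using J f by (intro markov_prod s) auto
    also have "\<dots> = (\<integral>\<^sup>+w. Y w * indicator A w \<partial>M)"
      by (intro nn_integral_cong) (simp add: ind)
    finally show ?thesis .
  qed
  have "space M \<in> cylinders s"
    unfolding cylinders_def by (intro CollectI exI[of _ "{}"] exI[of _ "\<lambda>_. UNIV"]) auto
  from cyl[OF this] have tot: "(\<integral>\<^sup>+w. X w \<partial>M) = (\<integral>\<^sup>+w. Y w \<partial>M)"
    by (simp add: indicator_def cong: nn_integral_cong)
  have X_le: "(\<integral>\<^sup>+w. X w * indicator A w \<partial>M) \<le> 1" for A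
  proof -
    have "(\<integral>\<^sup>+w. X w * indicator A w \<partial>M) \<le> (\<integral>\<^sup>+w. 1 \<partial>M)"
      using X1 by (intro nn_integral_mono) (auto simp: indicator_def)
    then show ?thesis by (simp add: emeasure_space_1)
  qed
  have "(\<integral>\<^sup>+w. X w * indicator A w \<partial>M) = (\<integral>\<^sup>+w. Y w * indicator A w \<partial>M)"
    using Int_stable_cylinders cylinders_Pow A[unfolded natural_def]
  proof (induction rule: sigma_sets_induct_disjoint)
    case (basic A) then show ?case by (rule cyl)
  next
    case (compl A)
    then have Am: "A \<in> sets M" using natural_sets by (auto simp: natural_def)
    have split: "(\<integral>\<^sup>+w. Z w * indicator A w \<partial>M) + (\<integral>\<^sup>+w. Z w * indicator (space M - A) w \<partial>M) = (\<integral>\<^sup>+w. Z w \<partial>M)"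
      if Z: "Z \<in> borel_measurable M" for Z
    proof -
      have "(\<integral>\<^sup>+w. Z w * indicator A w \<partial>M) + (\<integral>\<^sup>+w. Z w * indicator (space M - A) w \<partial>M) =
        (\<integral>\<^sup>+w. Z w * indicator A w + Z w * indicator (space M - A) w \<partial>M)"
        using Z Am by (intro nn_integral_add[symmetric]) auto
      also have "\<dots> = (\<integral>\<^sup>+w. Z w \<partial>M)" by (intro nn_integral_cong) (auto simp: indicator_def)
      finally show ?thesis .
    qed
    have fin: "(\<integral>\<^sup>+w. X w * indicator A w \<partial>M) \<noteq> \<infinity>" using X_le[of A] by (auto simp: top_unique)
    have "(\<integral>\<^sup>+w. X w * indicator A w \<partial>M) + (\<integral>\<^sup>+w. X w * indicator (space M - A) w \<partial>M) =
      (\<integral>\<^sup>+w. X w * indicator A w \<partial>M) + (\<integral>\<^sup>+w. Y w * indicator (space M - A) w \<partial>M)"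
      unfolding split[OF X] tot split[OF Y, symmetric] by (simp only: compl.IH)
    then show ?case using fin unfolding ennreal_add_left_cancel by blast
  next
    case (union A)
    then have Am: "A i \<in> sets M" for i using natural_sets by (auto simp: natural_def)
    have sum: "(\<integral>\<^sup>+w. Z w * indicator (\<Union>i. A i) w \<partial>M) = (\<Sum>i. \<integral>\<^sup>+w. Z w * indicator (A i) w \<partial>M)"
      if Z: "Z \<in> borel_measurable M" for Z
      using Z Am suminf_indicator[OF union.hyps(1)]
      by (subst nn_integral_suminf[symmetric]) (auto simp: ennreal_suminf_cmult intro!: nn_integral_cong)
    show ?case unfolding sum[OF X] sum[OF Y] using union.IH by simp
  qed simp
  then show ?thesis by (simp add: X_def Y_def)
qed

lemma nn_integral_kernel_ennreal:
  assumes "0 \<le> t" "f \<in> Brho \<rho>" "\<And>x. 0 \<le> f x"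
  shows "(\<integral>\<^sup>+z. ennreal (f z) \<partial>kernel t x) = ennreal (P t f x)"
proof -
  have "integrable (kernel t x) f"
    by (rule Brho_integrable[OF kernel_sets[OF assms(1)] integrable_rho_kernel[OF assms(1)] assms(2)])
  then have "(\<integral>\<^sup>+z. ennreal (f z) \<partial>kernel t x) = ennreal (\<integral>z. f z \<partial>kernel t x)"
    using assms(3) by (intro nn_integral_eq_integral AE_I2)
  then show ?thesis by (simp only: integral_kernel[OF assms(1,2)])
qed

lemma markov_natural:
  assumes s: "0 \<le> s" "s \<le> t" and f: "f \<in> Brho \<rho>" "\<And>x. 0 \<le> f x" "\<And>x. f x \<le> 1" and A: "A \<in> natural s"
  shows "(\<integral>w. f (w t) * indicator A w \<partial>M) = (\<integral>w. P (t - s) f (w s) * indicator A w \<partial>M)"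
proof -
  have ts: "0 \<le> t - s" "0 \<le> t" using s by auto
  have Am: "A \<in> sets M" using A natural_sets by blast
  have Pf: "P (t - s) f \<in> borel_measurable borel" by (intro Brho_borel P_Brho ts f)
  have [measurable]: "(\<lambda>w. f (w t)) \<in> borel_measurable M" "(\<lambda>w. P (t - s) f (w s)) \<in> borel_measurable M"
    by (intro coord_measurable Brho_borel f ts s Pf)+
  have nn: "0 \<le> P (t - s) f x" for x by (rule P_nonneg[OF ts(1) f(1,2)])
  have "(\<integral>\<^sup>+w. ennreal (f (w t)) * indicator A w \<partial>M) =
    (\<integral>\<^sup>+w. (\<integral>\<^sup>+z. ennreal (f z) \<partial>kernel (t - s) (w s)) * indicator A w \<partial>M)"
    using f Brho_borel[OF f(1)] by (intro nn_markov_natural s A) auto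
  then have eq: "(\<integral>\<^sup>+w. ennreal (f (w t) * indicator A w) \<partial>M) = (\<integral>\<^sup>+w. ennreal (P (t - s) f (w s) * indicator A w) \<partial>M)"
    using f nn nn_integral_kernel_ennreal[OF ts(1) f(1,2)] by (simp add: ennreal_mult'' ennreal_indicator)
  have "(\<integral>w. f (w t) * indicator A w \<partial>M) = enn2real (\<integral>\<^sup>+w. ennreal (f (w t) * indicator A w) \<partial>M)"
    using f(2) Am by (intro integral_eq_nn_integral) auto
  also have "\<dots> = (\<integral>w. P (t - s) f (w s) * indicator A w \<partial>M)"
    unfolding eq using nn Am by (intro integral_eq_nn_integral[symmetric]) auto
  finally show ?thesis .
qed

text \<open>A function weight instead of an indicator, for the cross term in the second moments
  below. Both sides are the real part of the same nonnegative integral.\<close>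

lemma markov_pair:
  assumes s: "0 \<le> s" "s \<le> t" and f: "f \<in> Brho \<rho>" "\<And>x. 0 \<le> f x" and b: "b \<in> borel_measurable borel" "\<And>x. 0 \<le> b x"
  shows "(\<integral>w. f (w t) * b (w s) \<partial>M) = (\<integral>w. P (t - s) f (w s) * b (w s) \<partial>M)"
proof -
  have ts: "0 \<le> t - s" "0 \<le> t" using s by auto
  have Pf: "P (t - s) f \<in> borel_measurable borel" by (intro Brho_borel P_Brho ts f)
  have [measurable]: "(\<lambda>w. f (w t)) \<in> borel_measurable M" "(\<lambda>w. P (t - s) f (w s)) \<in> borel_measurable M"
    "(\<lambda>w. b (w s)) \<in> borel_measurable M"
    by (intro coord_measurable Brho_borel f ts s Pf b)+
  have nn: "0 \<le> P (t - s) f x" for x by (rule P_nonneg[OF ts(1) f])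
  have "(\<integral>\<^sup>+w. ennreal (f (w t)) * (\<Prod>r\<in>{s}. ennreal (b (w r))) \<partial>M) =
    (\<integral>\<^sup>+w. (\<integral>\<^sup>+z. ennreal (f z) \<partial>kernel (t - s) (w s)) * (\<Prod>r\<in>{s}. ennreal (b (w r))) \<partial>M)"
    using f b Brho_borel[OF f(1)] s by (intro markov_prod) auto
  then have eq: "(\<integral>\<^sup>+w. ennreal (f (w t) * b (w s)) \<partial>M) = (\<integral>\<^sup>+w. ennreal (P (t - s) f (w s) * b (w s)) \<partial>M)"
    using f b nn nn_integral_kernel_ennreal[OF ts(1) f] by (simp add: ennreal_mult)
  have "(\<integral>w. f (w t) * b (w s) \<partial>M) = enn2real (\<integral>\<^sup>+w. ennreal (f (w t) * b (w s)) \<partial>M)"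
    using f(2) b(2) by (intro integral_eq_nn_integral) auto
  also have "\<dots> = (\<integral>w. P (t - s) f (w s) * b (w s) \<partial>M)"
    unfolding eq using nn b(2) by (intro integral_eq_nn_integral[symmetric]) auto
  finally show ?thesis .
qed

lemma distr_coord: assumes t: "0 \<le> t" shows "distr M borel (\<lambda>w. w t) = \<nu> \<bind> kernel t"
proof (rule measure_eqI)
  note D = prob_in_MrhoD[OF nu]
  show "sets (distr M borel (\<lambda>w. w t)) = sets (\<nu> \<bind> kernel t)" using sets_bind_kernel[OF D(1,3) t] by simp
  fix A assume "A \<in> sets (distr M borel (\<lambda>w. w t))"
  then have A: "A \<in> sets borel" by simp
  have m: "(\<lambda>w. w t) \<in> M \<rightarrow>\<^sub>M borel" using coord_measurable[OF t, of "\<lambda>x. x" borel] by simp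
  have "emeasure (distr M borel (\<lambda>w. w t)) A = (\<integral>\<^sup>+x. indicator A x \<partial>distr M borel (\<lambda>w. w t))" using A by simp
  also have "\<dots> = (\<integral>\<^sup>+w. (\<Prod>r\<in>{t}. indicator A (w r)) \<partial>M)" using A m by (subst nn_integral_distr) auto
  also have "\<dots> = (\<integral>\<^sup>+x. iter (\<lambda>_. indicator A) (sorted_list_of_set {t}) 0 x \<partial>\<nu>)"
    using A t by (intro finite_dimensional) auto
  also have "\<dots> = (\<integral>\<^sup>+x. emeasure (kernel t x) A \<partial>\<nu>)"
    using A t by (simp add: sorted_list_of_set_insert_remove)
  also have "\<dots> = emeasure (\<nu> \<bind> kernel t) A"
    by (rule emeasure_bind_prob_algebra[OF nu_in_prob_algebra[OF nu] kernel_measurable[OF t] A, symmetric])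
  finally show "emeasure (distr M borel (\<lambda>w. w t)) A = emeasure (\<nu> \<bind> kernel t) A" .
qed

section \<open>Moments of the weight and right continuity in mean square\<close>

lemma integrable_rho_coord: assumes t: "0 \<le> t" shows "integrable M (\<lambda>w. \<rho> (w t))"
proof -
  have m: "(\<lambda>w. w t) \<in> M \<rightarrow>\<^sub>M borel" using coord_measurable[OF t, of "\<lambda>x. x" borel] by simp
  have "integrable (distr M borel (\<lambda>w. w t)) \<rho>"
    unfolding distr_coord[OF t] by (rule prob_in_MrhoD(4)[OF prob_in_Mrho_bind_kernel[OF nu t]])
  then show ?thesis by (simp only: integrable_distr_eq[OF m rho_borel])
qed

lemma integrable_coord: assumes t: "0 \<le> t" and f: "f \<in> Brho \<rho>" shows "integrable M (\<lambda>w. f (w t))"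
proof (rule Bochner_Integration.integrable_bound)
  show "integrable M (\<lambda>w. wnorm \<rho> f * \<rho> (w t))" using integrable_rho_coord[OF t] by simp
  show "(\<lambda>w. f (w t)) \<in> borel_measurable M" by (intro coord_measurable t Brho_borel f)
  show "AE w in M. norm (f (w t)) \<le> norm (wnorm \<rho> f * \<rho> (w t))"
    using Brho_bound[OF f] by (intro AE_I2) (auto intro: order_trans[OF _ abs_ge_self])
qed

text \<open>From the local operator bound (P4). It makes a weighted-norm error small in mean along
  the moving state, uniformly in times just after \<open>s\<close>.\<close>

lemma rho_locally_bounded:
  assumes s: "0 \<le> s"
  shows "\<exists>\<epsilon>>0. \<exists>D\<ge>0. \<forall>u. s \<le> u \<and> u \<le> s + \<epsilon> \<longrightarrow> (\<integral>w. \<rho> (w u) \<partial>M) \<le> D"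
proof -
  from opbound_local obtain \<epsilon> C where e: "\<epsilon> > 0" "\<forall>t\<in>{0..\<epsilon>}. opbound t C" by (elim exE conjE)
  define I where "I = (\<integral>w. \<rho> (w s) \<partial>M)"
  have I: "I \<ge> 0" unfolding I_def using rho_pos by (intro integral_nonneg_AE AE_I2) (auto simp: less_imp_le)
  have C0: "C \<ge> 0" using e(2)[rule_format, of 0] e(1) by (simp add: opbound_def)
  define D where "D = C * (1 + 1 / rho_min) * I"
  have D: "D \<ge> 0" unfolding D_def using C0 I rho_min(1) by auto
  have nn: "(\<integral>\<^sup>+w. ennreal (\<rho> (w u)) \<partial>M) = ennreal (\<integral>w. \<rho> (w u) \<partial>M)" if "0 \<le> u" for u
    using rho_pos by (intro nn_integral_eq_integral integrable_rho_coord that AE_I2) (auto simp: less_imp_le)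
  have "(\<integral>w. \<rho> (w u) \<partial>M) \<le> D" if u: "s \<le> u" "u \<le> s + \<epsilon>" for u
  proof -
    have "(\<integral>\<^sup>+w. ennreal (\<rho> (w u)) \<partial>M) =
      (\<integral>\<^sup>+w. (\<integral>\<^sup>+z. ennreal (\<rho> z) \<partial>kernel (u - s) (w s)) \<partial>M)"
      using markov_prod[OF s u(1), of "{}" "\<lambda>_ _. 1" "\<lambda>x. ennreal (\<rho> x)"] by simp
    also have "\<dots> \<le> (\<integral>\<^sup>+w. ennreal (C * (1 + 1 / rho_min)) * ennreal (\<rho> (w s)) \<partial>M)"
    proof -
      have "opbound (u - s) C" using e(2)[rule_format, of "u - s"] u by simp
      then have "(\<integral>\<^sup>+z. ennreal (\<rho> z) \<partial>kernel (u - s) x) \<le> ennreal (C * (1 + 1 / rho_min)) * ennreal (\<rho> x)" for x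
        using u by (intro nn_integral_rho_kernel) auto
      then show ?thesis by (intro nn_integral_mono) simp
    qed
    also have "\<dots> = ennreal (C * (1 + 1 / rho_min)) * (\<integral>\<^sup>+w. ennreal (\<rho> (w s)) \<partial>M)"
      using coord_measurable[OF s rho_borel] by (intro nn_integral_cmult) auto
    also have "\<dots> = ennreal D"
      unfolding nn[OF s] D_def I_def using C0 rho_min(1) I by (intro ennreal_mult[symmetric]) (auto simp: I_def)
    finally have "ennreal (\<integral>w. \<rho> (w u) \<partial>M) \<le> ennreal D" using nn[of u] s u by simp
    then show ?thesis using D by (simp add: ennreal_le_iff)
  qed
  then show ?thesis using e(1) D by (intro exI[of _ \<epsilon>] exI[of _ D] conjI) auto
qed

text \<open>Expanding the square and conditioning at time \<open>s\<close> leaves the mean of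
  \<open>\<phi> n (w s)\<close>, which tends to 0 pointwise by (P3) applied to \<open>g\<close> and
  to its square.\<close>

lemma right_stochastic_continuity:
  assumes s: "0 \<le> s" and g: "g \<in> Brho \<rho>" "\<And>x. 0 \<le> g x" "\<And>x. g x \<le> 1"
    and h: "\<And>n. 0 < h n" "h \<longlonglongrightarrow> 0"
  shows "(\<lambda>n. \<integral>w. (g (w (s + h n)) - g (w s))\<^sup>2 \<partial>M) \<longlonglongrightarrow> 0"
proof -
  have g1: "\<bar>g x\<bar> \<le> 1" for x using g(2,3) by (auto simp: abs_le_iff intro: order_trans[of _ 0])
  have g2: "(\<lambda>x. (g x)\<^sup>2) \<in> Brho \<rho>" by (rule Brho_square[OF g(1) g1])
  have g2': "\<bar>(g x)\<^sup>2\<bar> \<le> 1" for x using g1[of x] by (simp add: power2_eq_square mult_le_one g)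
  have hf: "filterlim h (at_right 0) sequentially" using h by (auto simp: filterlim_at less_imp_neq[symmetric])
  have m: "f \<in> Brho \<rho> \<Longrightarrow> 0 \<le> u \<Longrightarrow> (\<lambda>w. f (w u)) \<in> borel_measurable M" for f u
    by (intro coord_measurable Brho_borel)
  define \<phi> where "\<phi> n x = P (h n) (\<lambda>x. (g x)\<^sup>2) x - 2 * (P (h n) g x * g x) + (g x)\<^sup>2" for n x
  have hn: "0 \<le> h n" for n using h(1)[of n] by simp
  have "(\<integral>w. (g (w (s + h n)) - g (w s))\<^sup>2 \<partial>M) = (\<integral>w. \<phi> n (w s) \<partial>M)" for n
  proof -
    have u: "0 \<le> s + h n" "s \<le> s + h n" using s hn[of n] by auto
    have [measurable]: "(\<lambda>w. g (w (s + h n))) \<in> borel_measurable M" "(\<lambda>w. g (w s)) \<in> borel_measurable M"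
      "(\<lambda>w. P (h n) g (w s)) \<in> borel_measurable M" "(\<lambda>w. P (h n) (\<lambda>x. (g x)\<^sup>2) (w s)) \<in> borel_measurable M"
      by (intro m g P_Brho hn g2 u s)+
    have pg: "\<bar>P (h n) g x\<bar> \<le> 1" "\<bar>P (h n) (\<lambda>x. (g x)\<^sup>2) x\<bar> \<le> 1" for x
      by (intro P_bounded hn g g1 g2 g2')+
    have prod1: "\<bar>a * b\<bar> \<le> 1" if "\<bar>a\<bar> \<le> 1" "\<bar>b\<bar> \<le> 1" for a b :: real
      using that by (simp add: abs_mult mult_le_one)
    have i: "integrable M (\<lambda>w. (g (w (s + h n)))\<^sup>2)" "integrable M (\<lambda>w. g (w (s + h n)) * g (w s))"
      "integrable M (\<lambda>w. (g (w s))\<^sup>2)" "integrable M (\<lambda>w. P (h n) g (w s) * g (w s))"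
      "integrable M (\<lambda>w. P (h n) (\<lambda>x. (g x)\<^sup>2) (w s))"
      using g1 g2' pg prod1 by (auto intro!: integrable_const_bound[of _ 1])
    have "(\<integral>w. (g (w (s + h n)) - g (w s))\<^sup>2 \<partial>M) =
      (\<integral>w. ((g (w (s + h n)))\<^sup>2 - 2 * (g (w (s + h n)) * g (w s))) + (g (w s))\<^sup>2 \<partial>M)"
      by (intro Bochner_Integration.integral_cong) (auto simp: power2_diff)
    also have "\<dots> = (\<integral>w. (g (w (s + h n)))\<^sup>2 \<partial>M) - 2 * (\<integral>w. g (w (s + h n)) * g (w s) \<partial>M) + (\<integral>w. (g (w s))\<^sup>2 \<partial>M)"
      using i by simp
    also have "(\<integral>w. g (w (s + h n)) * g (w s) \<partial>M) = (\<integral>w. P (h n) g (w s) * g (w s) \<partial>M)"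
      using markov_pair[OF s u(2) g(1,2) Brho_borel[OF g(1)] g(2)] by simp
    also have "(\<integral>w. (g (w (s + h n)))\<^sup>2 \<partial>M) = (\<integral>w. P (h n) (\<lambda>x. (g x)\<^sup>2) (w s) \<partial>M)"
      using markov_pair[OF s u(2) g2, of "\<lambda>_. 1"] by simp
    also have "(\<integral>w. P (h n) (\<lambda>x. (g x)\<^sup>2) (w s) \<partial>M) - 2 * (\<integral>w. P (h n) g (w s) * g (w s) \<partial>M) + (\<integral>w. (g (w s))\<^sup>2 \<partial>M)
      = (\<integral>w. \<phi> n (w s) \<partial>M)"
      unfolding \<phi>_def using i by simp
    finally show ?thesis .
  qed
  moreover have "(\<lambda>n. \<integral>w. \<phi> n (w s) \<partial>M) \<longlonglongrightarrow> (\<integral>w. 0 \<partial>M)"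
  \<comment> \<open>The bound is 1 + 2 + 1 from the three terms of \<open>\<phi>\<close>.\<close>
  proof (rule integral_dominated_convergence[where w = "\<lambda>_. 4"])
    show "(\<lambda>w. \<phi> n (w s)) \<in> borel_measurable M" for n
      unfolding \<phi>_def using m[OF g(1) s] m[OF P_Brho[OF hn g(1)] s, of n] m[OF P_Brho[OF hn g2] s, of n] by measurable
    show "AE w in M. norm (\<phi> n (w s)) \<le> 4" for n
    proof (intro AE_I2)
      fix w
      have "\<bar>P (h n) g (w s) * g (w s)\<bar> \<le> 1"
        using P_bounded[OF hn[of n] g(1) g1, of "w s"] g1[of "w s"] by (simp add: abs_mult mult_le_one)
      then show "norm (\<phi> n (w s)) \<le> 4"
        using P_bounded[OF hn[of n] g2 g2', of "w s"] g2'[of "w s"] unfolding \<phi>_def real_norm_def by linarith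
    qed
    show "AE w in M. (\<lambda>n. \<phi> n (w s)) \<longlonglongrightarrow> 0"
    proof (intro AE_I2)
      fix w
      have "(\<lambda>n. P (h n) g (w s)) \<longlonglongrightarrow> g (w s)" "(\<lambda>n. P (h n) (\<lambda>x. (g x)\<^sup>2) (w s)) \<longlonglongrightarrow> (g (w s))\<^sup>2"
        using filterlim_compose[OF P_tendsto[OF g(1)] hf] filterlim_compose[OF P_tendsto[OF g2] hf] by auto
      then have "(\<lambda>n. \<phi> n (w s)) \<longlonglongrightarrow> (g (w s))\<^sup>2 - 2 * (g (w s) * g (w s)) + (g (w s))\<^sup>2"
        unfolding \<phi>_def by (intro tendsto_intros)
      then show "(\<lambda>n. \<phi> n (w s)) \<longlonglongrightarrow> 0" by (simp add: power2_eq_square)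
    qed
  qed auto
  ultimately show ?thesis by simp
qed

section \<open>The right-continuous completed filtration\<close>

text \<open>The augmentation by null sets, described through a representative in the natural
  filtration, to which \<open>markov_natural\<close> can be applied.\<close>

definition completed :: "real \<Rightarrow> (real \<Rightarrow> 'a) set set" where
  "completed u = {A \<in> sets (completion M). \<exists>B\<in>natural u. AE w in M. w \<in> A \<longleftrightarrow> w \<in> B}"

definition augmented :: "real \<Rightarrow> (real \<Rightarrow> 'a) set set" where
  "augmented s = (\<Inter>u\<in>{s<..}. completed u)"

text \<open>Packaged as a measure because \<open>subalgebra\<close> and \<open>real_cond_exp\<close>
  expect one; only its sigma-algebra matters.\<close>

definition augmented_filtration :: "real \<Rightarrow> (real \<Rightarrow> 'a) measure" where
  "augmented_filtration s = sigma (space M) (augmented s)"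

lemma sigma_algebra_completed: "sigma_algebra (space M) (completed u)"
  unfolding sigma_algebra_iff2
proof (intro conjI ballI allI impI)
  interpret N: sigma_algebra "space M" "natural u" by (rule sigma_algebra_natural)
  show "completed u \<subseteq> Pow (space M)"
    using sets.sets_into_space[of _ "completion M"] by (auto simp: completed_def)
  show "{} \<in> completed u" unfolding completed_def by (auto intro!: bexI[of _ "{}"])
  fix A assume A: "A \<in> completed u"
  then obtain B where B: "B \<in> natural u" "AE w in M. w \<in> A \<longleftrightarrow> w \<in> B" by (auto simp: completed_def)
  from B(2) have "AE w in M. w \<in> space M - A \<longleftrightarrow> w \<in> space M - B" by eventually_elim auto
  moreover have "space M - A \<in> sets (completion M)"
    using A sets.compl_sets[of A "completion M"] by (simp add: completed_def)
  ultimately show "space M - A \<in> completed u"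
    using N.compl_sets[OF B(1)] unfolding completed_def by (intro CollectI conjI bexI[of _ "space M - B"])
next
  interpret N: sigma_algebra "space M" "natural u" by (rule sigma_algebra_natural)
  fix A :: "nat \<Rightarrow> _" assume A: "range A \<subseteq> completed u"
  have Ai: "A i \<in> completed u" for i using A by blast
  then have "\<forall>i. \<exists>B. B \<in> natural u \<and> (AE w in M. w \<in> A i \<longleftrightarrow> w \<in> B)"
    unfolding completed_def by blast
  from choice[OF this] obtain B where B: "\<forall>i. B i \<in> natural u \<and> (AE w in M. w \<in> A i \<longleftrightarrow> w \<in> B i)" ..
  then have "AE w in M. \<forall>i. w \<in> A i \<longleftrightarrow> w \<in> B i" by (simp add: AE_all_countable)
  then have "AE w in M. w \<in> (\<Union>i. A i) \<longleftrightarrow> w \<in> (\<Union>i. B i)" by eventually_elim auto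
  moreover have "(\<Union>i. B i) \<in> natural u" using B by (intro N.countable_UN) auto
  moreover have "(\<Union>i. A i) \<in> sets (completion M)" using Ai unfolding completed_def by (intro sets.countable_UN) blast
  ultimately show "(\<Union>i. A i) \<in> completed u"
    unfolding completed_def by (intro CollectI conjI bexI[of _ "\<Union>i. B i"])
qed

lemma augmentedI: "(\<And>u. s < u \<Longrightarrow> A \<in> completed u) \<Longrightarrow> A \<in> augmented s"
  by (simp add: augmented_def)

lemma augmentedD: "A \<in> augmented s \<Longrightarrow> s < u \<Longrightarrow> A \<in> completed u"
  by (simp add: augmented_def)

lemma augmented_sets: "augmented s \<subseteq> sets (completion M)"
  using augmentedD[of _ s "s + 1"] by (auto simp: completed_def)

lemma augmented_Pow: "augmented s \<subseteq> Pow (space M)"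
  using augmented_sets[of s] sets.space_closed[of "completion M"] by simp

lemma sigma_algebra_augmented: "sigma_algebra (space M) (augmented s)"
  unfolding sigma_algebra_iff2
proof (intro conjI ballI allI impI augmented_Pow augmentedI)
  fix u assume u: "s < u"
  interpret U: sigma_algebra "space M" "completed u" by (rule sigma_algebra_completed)
  show "{} \<in> completed u" by (rule U.empty_sets)
  show "space M - A \<in> completed u" if "A \<in> augmented s" for A
    by (rule U.compl_sets[OF augmentedD[OF that u]])
  show "(\<Union>i. A i) \<in> completed u" if "range A \<subseteq> augmented s" for A :: "nat \<Rightarrow> _"
    using that augmentedD[OF _ u] by (intro U.countable_UN) blast
qed

lemma sets_augmented: "sets (augmented_filtration s) = augmented s"
  using sigma_algebra_augmented[of s] unfolding augmented_filtration_def
  by (simp add: sigma_algebra.sets_measure_of_eq)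

lemma space_augmented: "space (augmented_filtration s) = space M"
  by (simp add: augmented_filtration_def space_measure_of[OF augmented_Pow])

lemma natural_completed: "natural u \<subseteq> completed u"
proof
  fix A assume A: "A \<in> natural u"
  then have "A \<in> sets M" using natural_sets by blast
  then show "A \<in> completed u" unfolding completed_def by (intro CollectI conjI bexI[OF _ A]) auto
qed

lemma natural_augmented: "natural s \<subseteq> augmented s"
proof (intro subsetI augmentedI)
  fix A u assume "A \<in> natural s" "s < u"
  then show "A \<in> completed u" using natural_mono[of s u] natural_completed[of u] by auto
qed

section \<open>The Markov property for the completed and the augmented filtration\<close>

abbreviation "cint f t A \<equiv> \<integral>w. f (w t) * indicator A w \<partial>completion M"

text \<open>The set \<open>B\<close> is obtained before \<open>h\<close>, so that one representative
  serves both sides of the Markov identity.\<close>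

lemma completed_integral:
  assumes "A \<in> completed u"
  obtains B where "B \<in> natural u"
    "\<And>h :: _ \<Rightarrow> real. h \<in> borel_measurable M \<Longrightarrow>
      (\<integral>w. h w * indicator A w \<partial>completion M) = (\<integral>w. h w * indicator B w \<partial>M)"
proof -
  obtain B where B: "B \<in> natural u" "AE w in M. w \<in> A \<longleftrightarrow> w \<in> B" and A: "A \<in> sets (completion M)"
    using assms by (auto simp: completed_def)
  have Bm: "B \<in> sets M" using B(1) natural_sets by blast
  have "(\<integral>w. h w * indicator A w \<partial>completion M) = (\<integral>w. h w * indicator B w \<partial>M)"
    if h: "h \<in> borel_measurable M" for h :: "_ \<Rightarrow> real"
  proof -
    have "(\<integral>w. h w * indicator A w \<partial>completion M) = (\<integral>w. h w * indicator B w \<partial>completion M)"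
    proof (rule integral_cong_AE)
      show "(\<lambda>w. h w * indicator A w) \<in> borel_measurable (completion M)"
        using measurable_completion[OF h] A by (intro borel_measurable_times borel_measurable_indicator)
      show "(\<lambda>w. h w * indicator B w) \<in> borel_measurable (completion M)"
        using measurable_completion[OF h] Bm by (intro borel_measurable_times borel_measurable_indicator) auto
      show "AE w in completion M. h w * indicator A w = h w * indicator B w"
        using AE_completion[OF B(2)] by eventually_elim (auto simp: indicator_def)
    qed
    also have "\<dots> = (\<integral>w. h w * indicator B w \<partial>M)"
      using h Bm by (intro integral_completion) auto
    finally show ?thesis .
  qed
  with B(1) show thesis by (rule that)
qed

text \<open>Lets convergence in mean pass to integrals over a fixed set of the completion.\<close>

lemma integral_indicator_diff_le:
  fixes X Y :: "_ \<Rightarrow> real"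
  assumes X: "integrable M X" and Y: "integrable M Y" and A: "A \<in> sets (completion M)"
  shows "\<bar>(\<integral>w. X w * indicator A w \<partial>completion M) - (\<integral>w. Y w * indicator A w \<partial>completion M)\<bar>
    \<le> (\<integral>w. \<bar>X w - Y w\<bar> \<partial>M)"
proof -
  have c: "integrable (completion M) X" "integrable (completion M) Y"
    using X Y borel_measurable_integrable[OF X] borel_measurable_integrable[OF Y] by (simp_all add: integrable_completion)
  have iA: "integrable (completion M) (\<lambda>w. Z w * indicator A w)" if "integrable (completion M) Z" for Z :: "_ \<Rightarrow> real"
    using integrable_mult_indicator[OF A that] by (simp add: mult.commute)
  have "(\<integral>w. X w * indicator A w \<partial>completion M) - (\<integral>w. Y w * indicator A w \<partial>completion M) =
    (\<integral>w. X w * indicator A w - Y w * indicator A w \<partial>completion M)"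
    using c by (intro Bochner_Integration.integral_diff[symmetric] iA)
  also have "\<bar>\<dots>\<bar> \<le> (\<integral>w. \<bar>X w * indicator A w - Y w * indicator A w\<bar> \<partial>completion M)"
    by (rule integral_abs_bound)
  also have "\<dots> \<le> (\<integral>w. \<bar>X w - Y w\<bar> \<partial>completion M)"
    using c iA by (intro integral_mono integrable_abs Bochner_Integration.integrable_diff) (auto simp: indicator_def)
  also have "\<dots> = (\<integral>w. \<bar>X w - Y w\<bar> \<partial>M)"
    using borel_measurable_integrable[OF X] borel_measurable_integrable[OF Y] by (intro integral_completion) auto
  finally show ?thesis .
qed

lemma markov_completed:
  assumes s: "0 \<le> s" "s \<le> t" and f: "f \<in> Brho \<rho>" "\<And>x. 0 \<le> f x" "\<And>x. f x \<le> 1" and A: "A \<in> completed s"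
  shows "(cint f t A) = (cint (P (t - s) f) s A)"
proof -
  obtain B where B: "B \<in> natural s" "\<And>h :: _ \<Rightarrow> real. h \<in> borel_measurable M \<Longrightarrow>
      (\<integral>w. h w * indicator A w \<partial>completion M) = (\<integral>w. h w * indicator B w \<partial>M)"
    using completed_integral[OF A] by metis
  have "(\<lambda>w. f (w t)) \<in> borel_measurable M" "(\<lambda>w. P (t - s) f (w s)) \<in> borel_measurable M"
    using s by (auto intro!: coord_measurable Brho_borel P_Brho f(1))
  then show ?thesis using markov_natural[OF s f B(1)] B(2) by simp
qed

text \<open>Passes from mean square to mean convergence without the Cauchy-Schwarz
  inequality.\<close>

lemma abs_le_add_square: "0 < \<delta> \<Longrightarrow> \<bar>z :: real\<bar> \<le> \<delta> + z\<^sup>2 / \<delta>"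
proof (cases "\<bar>z\<bar> \<le> \<delta>")
  case False
  assume "0 < \<delta>"
  have "\<delta> * \<bar>z\<bar> \<le> \<bar>z\<bar> * \<bar>z\<bar>" using False by (intro mult_right_mono) auto
  then have "\<bar>z\<bar> \<le> z\<^sup>2 / \<delta>" using \<open>0 < \<delta>\<close> by (simp add: power2_eq_square pos_le_divide_eq mult.commute)
  then show ?thesis using \<open>0 < \<delta>\<close> by simp
qed (auto intro: order_trans)

text \<open>A set of the augmented filtration at time \<open>s\<close> is completed-measurable at every later time, so the Markov
  property holds from \<open>s + h n\<close> for any \<open>h n > 0\<close>; choosing \<open>h n\<close> by left approximation of the semigroup in norm
  and using right stochastic continuity of the process, \<open>h n \<longrightarrow> 0\<close> gives the property at \<open>s\<close>.\<close>

lemma markov_augmented_unit: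
  assumes s: "0 \<le> s" "s \<le> t" and f: "f \<in> Brho \<rho>" "\<And>x. 0 \<le> f x" "\<And>x. f x \<le> 1" and A: "A \<in> augmented s"
  shows "(cint f t A) = (cint (P (t - s) f) s A)"
proof (cases "s = t")
  case True
  then show ?thesis using P_0[OF f(1)] by simp
next
  case False
  define T where "T = t - s"
  have T: "0 < T" using False s by (simp add: T_def)
  define g where "g = P T f"
  have f1: "\<bar>f x\<bar> \<le> 1" for x using f(2)[of x] f(3)[of x] by auto
  have gB: "g \<in> Brho \<rho>" unfolding g_def using T by (intro P_Brho f) auto
  have g0: "0 \<le> g x" and g1: "g x \<le> 1" for x
    using P_nonneg[OF _ f(1,2), of T x] P_bounded[OF _ f(1) f1, of T x] T by (auto simp: g_def)
  from rho_locally_bounded[OF s(1)] obtain \<epsilon> D where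
    \<epsilon>: "\<epsilon> > 0" "D \<ge> 0" and D: "\<forall>u. s \<le> u \<and> u \<le> s + \<epsilon> \<longrightarrow> (\<integral>w. \<rho> (w u) \<partial>M) \<le> D" by (elim exE conjE)
  \<comment> \<open>The bound by \<open>\<epsilon>\<close> keeps the weight moments below
    \<open>D\<close>, the bound by 1/(n+1) makes the times decrease to \<open>s\<close>, and
    \<open>h < T\<close> keeps them before \<open>t\<close>.\<close>
  have "\<forall>n. \<exists>h. 0 < h \<and> h < min \<epsilon> (1 / real (Suc n)) \<and> h < T \<and> (\<forall>x. \<bar>P (T - h) f x - P T f x\<bar> \<le> 1 / real (Suc n) * \<rho> x)"
    using \<epsilon>(1) by (intro allI P_left_approx[OF f(1) f1 T]) auto
  from choice[OF this] obtain h where h: "\<forall>n. 0 < h n \<and> h n < min \<epsilon> (1 / real (Suc n)) \<and> h n < T \<and>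
      (\<forall>x. \<bar>P (T - h n) f x - P T f x\<bar> \<le> 1 / real (Suc n) * \<rho> x)" ..
  have h0: "0 < h n" "h n < \<epsilon>" "h n < 1 / real (Suc n)" "h n < T"
    "\<bar>P (T - h n) f x - g x\<bar> \<le> 1 / real (Suc n) * \<rho> x" for n x
    using h by (auto simp: g_def)
  have hlim: "h \<longlonglongrightarrow> 0"
    using h0(1,3) by (intro tendsto_sandwich[OF _ _ tendsto_const LIMSEQ_Suc[OF lim_1_over_n]]) (auto intro!: always_eventually less_imp_le)
  define q where "q n = (\<integral>w. (g (w (s + h n)) - g (w s))\<^sup>2 \<partial>M)" for n
  have q: "q \<longlonglongrightarrow> 0"
    unfolding q_def[abs_def] by (rule right_stochastic_continuity[OF s(1) gB g0 g1 h0(1) hlim])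
  define L where "L = \<bar>(cint f t A) - (cint g s A)\<bar>"
  have Am: "A \<in> sets (completion M)" using A augmented_sets by blast
  \<comment> \<open>At \<open>u = s + h n\<close> the state stays and the operator time changes from
    \<open>T - h n\<close> to \<open>T\<close>, costing a norm error times \<open>D\<close>; then
    the state changes from time \<open>u\<close> to \<open>s\<close>, costing the mean-square
    term.\<close>
  have step: "L \<le> 1 / real (Suc n) * D + (\<delta> + q n / \<delta>)" if \<delta>: "0 < \<delta>" for n \<delta>
  proof -
    define u where "u = s + h n"
    have u: "0 \<le> u" "s \<le> u" "s < u" "u \<le> t" "u \<le> s + \<epsilon>" "t - u = T - h n" "0 \<le> T - h n"
      using s h0(1,2,4)[of n] by (auto simp: u_def T_def)
    define k where "k = P (T - h n) f"
    have kB: "k \<in> Brho \<rho>" unfolding k_def using u by (intro P_Brho f) auto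
    have kg: "\<bar>k x - g x\<bar> \<le> 1 / real (Suc n) * \<rho> x" for x unfolding k_def by (rule h0(5))
    have int: "integrable M (\<lambda>w. k (w u))" "integrable M (\<lambda>w. g (w u))" "integrable M (\<lambda>w. g (w s))"
      by (intro integrable_coord kB gB u s)+
    have "A \<in> completed u" using A u(3) by (auto simp: augmented_def)
    from markov_completed[OF u(1,4) f this]
    have "(cint f t A) = (cint k u A)"
      by (simp only: u(6) k_def)
    then have "L \<le> (\<integral>w. \<bar>k (w u) - g (w s)\<bar> \<partial>M)"
      unfolding L_def using integral_indicator_diff_le[OF int(1,3) Am] by simp
    also have "\<dots> \<le> (\<integral>w. \<bar>k (w u) - g (w u)\<bar> + \<bar>g (w u) - g (w s)\<bar> \<partial>M)"
      using int by (intro integral_mono) auto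
    also have "\<dots> = (\<integral>w. \<bar>k (w u) - g (w u)\<bar> \<partial>M) + (\<integral>w. \<bar>g (w u) - g (w s)\<bar> \<partial>M)"
      using int by (intro Bochner_Integration.integral_add) auto
    also have "(\<integral>w. \<bar>k (w u) - g (w u)\<bar> \<partial>M) \<le> (\<integral>w. 1 / real (Suc n) * \<rho> (w u) \<partial>M)"
      using int kg integrable_rho_coord[OF u(1)] by (intro integral_mono integrable_mult_right integrable_abs Bochner_Integration.integrable_diff)
    also have "\<dots> \<le> 1 / real (Suc n) * D"
      using D u(2,5) by (simp add: divide_right_mono)
    also have "(\<integral>w. \<bar>g (w u) - g (w s)\<bar> \<partial>M) \<le> (\<integral>w. \<delta> + (g (w u) - g (w s))\<^sup>2 / \<delta> \<partial>M)"
    proof (rule integral_mono)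
      have m: "(\<lambda>w. g (w u) - g (w s)) \<in> borel_measurable M"
        using int(2,3) by (intro borel_measurable_diff borel_measurable_integrable)
      have "\<bar>(g x - g y)\<^sup>2\<bar> \<le> 1" for x y
        using g0[of x] g1[of x] g0[of y] g1[of y] by (simp add: abs_square_le_1 abs_le_iff)
      then show "integrable M (\<lambda>w. \<delta> + (g (w u) - g (w s))\<^sup>2 / \<delta>)"
        using m by (intro Bochner_Integration.integrable_add integrable_divide integrable_const integrable_const_bound[of _ 1]) auto
      show "\<bar>g (w u) - g (w s)\<bar> \<le> \<delta> + (g (w u) - g (w s))\<^sup>2 / \<delta>" for w by (rule abs_le_add_square[OF \<delta>])
    qed (use int in auto)
    also have "\<dots> = \<delta> + q n / \<delta>"
    proof -
      have m: "(\<lambda>w. g (w u) - g (w s)) \<in> borel_measurable M"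
        using int(2,3) by (intro borel_measurable_diff borel_measurable_integrable)
      have "\<bar>(g x - g y)\<^sup>2\<bar> \<le> 1" for x y
        using g0[of x] g1[of x] g0[of y] g1[of y] by (simp add: abs_square_le_1 abs_le_iff)
      then have "integrable M (\<lambda>w. (g (w u) - g (w s))\<^sup>2)"
        using m by (intro integrable_const_bound[of _ 1]) auto
      then show ?thesis unfolding q_def u_def by (simp add: prob_space)
    qed
    finally show ?thesis by simp
  qed
  \<comment> \<open>First \<open>n\<close> tends to infinity with \<open>\<delta>\<close> fixed;
    only afterwards is \<open>\<delta>\<close> arbitrary, because \<open>q n\<close> is divided by
    it.\<close>
  have "L \<le> 0 + \<delta>" if \<delta>: "0 < \<delta>" for \<delta>
  proof (rule LIMSEQ_le_const)
    have "(\<lambda>n. 1 / real (Suc n) * D + (\<delta> + q n / \<delta>)) \<longlonglongrightarrow> 0 * D + (\<delta> + 0 / \<delta>)"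
      using \<delta> by (intro tendsto_intros q LIMSEQ_Suc[OF lim_1_over_n]) auto
    then show "(\<lambda>n. 1 / real (Suc n) * D + (\<delta> + q n / \<delta>)) \<longlonglongrightarrow> 0 + \<delta>" by simp
    show "\<exists>N. \<forall>n\<ge>N. L \<le> 1 / real (Suc n) * D + (\<delta> + q n / \<delta>)" using step[OF \<delta>] by blast
  qed
  then have "L \<le> 0" by (rule field_le_epsilon)
  then show ?thesis by (simp add: L_def g_def T_def)
qed

text \<open>Reduces to [0, 1]-valued functions by the affine map
  \<open>1 / (2 * B) * f x + 1 / 2\<close>; constants are preserved since
  \<open>P t 1 = 1\<close>.\<close>

lemma markov_augmented_Cb:
  assumes s: "0 \<le> s" "s \<le> t" and f: "f \<in> Cb" and A: "A \<in> augmented s"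
  shows "(cint f t A) = (cint (P (t - s) f) s A)"
proof -
  obtain B where B: "B > 0" "\<And>x. \<bar>f x\<bar> \<le> B" using Cb_abs_bound[OF f] by blast
  have ts: "0 \<le> t - s" "0 \<le> t" using s by auto
  note fB = Cb_Brho[OF f]
  define k where "k = (\<lambda>x. 1 / (2 * B) * f x + 1 / 2)"
  have kB: "k \<in> Brho \<rho>" unfolding k_def by (intro Brho_add Brho_cmult Brho_const fB)
  have k: "0 \<le> k x" "k x \<le> 1" for x
    using B(1) abs_le_D1[OF B(2)[of x]] abs_le_D2[OF B(2)[of x]] by (auto simp: k_def field_simps)
  have Pk: "P (t - s) k x = 1 / (2 * B) * P (t - s) f x + 1 / 2" for x
    unfolding k_def P_add[OF ts(1) Brho_cmult[OF fB] Brho_const] P_cmult[OF ts(1) fB] P_const[OF ts(1)] ..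
  have Am: "A \<in> sets (completion M)" using A augmented_sets by blast
  have c: "integrable (completion M) (\<lambda>w. h (w u) * indicator A w)" if "h \<in> Brho \<rho>" "0 \<le> u" for h u
  proof -
    have "integrable (completion M) (\<lambda>w. h (w u))"
      using integrable_coord[OF that(2,1)] by (simp add: integrable_completion[OF borel_measurable_integrable])
    from integrable_mult_indicator[OF Am this] show ?thesis by (simp add: mult.commute)
  qed
  interpret C: prob_space "completion M" by (rule prob_space_completion)
  have i1: "integrable (completion M) (\<lambda>w. indicator A w :: real)"
    using Am by (simp add: C.emeasure_eq_measure)
  have lin: "(\<integral>w. (1 / (2 * B) * h (w u) + 1 / 2) * indicator A w \<partial>completion M) =
     1 / (2 * B) * (cint h u A) + 1 / 2 * (\<integral>w. indicator A w \<partial>completion M)"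
    if h: "h \<in> Brho \<rho>" "0 \<le> u" for h u
  proof -
    have "(\<integral>w. (1 / (2 * B) * h (w u) + 1 / 2) * indicator A w \<partial>completion M) =
      (\<integral>w. 1 / (2 * B) * (h (w u) * indicator A w) + 1 / 2 * indicator A w \<partial>completion M)"
      by (intro Bochner_Integration.integral_cong) (auto simp: algebra_simps)
    also have "\<dots> = (\<integral>w. 1 / (2 * B) * (h (w u) * indicator A w) \<partial>completion M) + (\<integral>w. 1 / 2 * indicator A w \<partial>completion M)"
      by (intro Bochner_Integration.integral_add integrable_mult_right c[OF h] i1)
    finally show ?thesis by (simp only: integral_mult_right_zero)
  qed
  from markov_augmented_unit[OF s kB k A]
  have "1 / (2 * B) * (cint f t A) =
    1 / (2 * B) * (cint (P (t - s) f) s A)"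
    unfolding Pk unfolding k_def lin[OF fB ts(2)] lin[OF P_Brho[OF ts(1) fB] s(1)] by simp
  then show ?thesis using B(1) by simp
qed

text \<open>Both sides depend continuously on \<open>f\<close> in the weighted norm, through the
  weight moments at \<open>t\<close> and at \<open>s\<close>, so approximation by \<open>Cb\<close>
  is enough.\<close>

lemma markov_augmented:
  assumes s: "0 \<le> s" "s \<le> t" and f: "f \<in> Brho \<rho>" and A: "A \<in> augmented s"
  shows "(cint f t A) = (cint (P (t - s) f) s A)"
proof -
  have ts: "0 \<le> t - s" "0 \<le> t" using s by auto
  obtain C where C: "opbound (t - s) C" using opbound_exists[OF ts(1)] by blast
  have C0: "C \<ge> 0" using C by (simp add: opbound_def)
  have Am: "A \<in> sets (completion M)" using A augmented_sets by blast
  define I where "I u = (\<integral>w. \<rho> (w u) \<partial>M)" for u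
  have I: "I u \<ge> 0" for u unfolding I_def using rho_pos by (intro integral_nonneg_AE AE_I2) (auto simp: less_imp_le)
  have near: "\<bar>(cint h u A) - (cint k u A)\<bar> \<le> d * I u"
    if h: "h \<in> Brho \<rho>" "k \<in> Brho \<rho>" "0 \<le> u" "\<And>x. \<bar>h x - k x\<bar> \<le> d * \<rho> x" for h k u d
  proof -
    note i = integrable_coord[OF h(3,1)] integrable_coord[OF h(3,2)] integrable_rho_coord[OF h(3)]
    have "(\<integral>w. \<bar>h (w u) - k (w u)\<bar> \<partial>M) \<le> (\<integral>w. d * \<rho> (w u) \<partial>M)"
      by (intro integral_mono integrable_abs Bochner_Integration.integrable_diff integrable_mult_right i h(4))
    then show ?thesis using integral_indicator_diff_le[OF i(1,2) Am] by (simp add: I_def)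
  qed
  have "\<bar>(cint f t A) - (cint (P (t - s) f) s A)\<bar> \<le> 0 + e"
    if e: "e > 0" for e
  proof -
    \<comment> \<open>Balances the errors \<open>d * I t\<close> on the left and
      \<open>C * d * I s\<close> on the right; the summand 1 keeps the denominator positive.\<close>
    define d where "d = e / (I t + C * I s + 1)"
    have den: "0 \<le> I t + C * I s" using I C0 by (intro add_nonneg_nonneg mult_nonneg_nonneg)
    then have d: "d > 0" using e by (simp add: d_def)
    have de: "d * I t + C * d * I s \<le> e"
    proof -
      have "d * (I t + C * I s) \<le> d * (I t + C * I s + 1)" using d by (intro mult_left_mono) auto
      also have "\<dots> = e" using den by (simp add: d_def)
      finally show ?thesis by (simp add: algebra_simps)
    qed
    obtain k where k: "k \<in> Cb" "\<And>x. \<bar>f x - k x\<bar> \<le> d * \<rho> x" using Brho_approx[OF f d] by blast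
    note kB = Cb_Brho[OF k(1)]
    have Pfk: "\<bar>P (t - s) f x - P (t - s) k x\<bar> \<le> C * d * \<rho> x" for x
    proof -
      interpret weighted_functional \<rho> "\<lambda>f. P (t - s) f x" "C * \<rho> x" by (rule P_functional[OF ts(1) C])
      show ?thesis using L_diff_le[OF f kB _ k(2)] d by (simp add: mult_ac)
    qed
    have "\<bar>(cint f t A) - (cint k t A)\<bar> \<le> d * I t"
      by (rule near[OF f kB ts(2) k(2)])
    moreover have "\<bar>(cint (P (t - s) f) s A) - (cint (P (t - s) k) s A)\<bar> \<le> C * d * I s"
      by (rule near[OF P_Brho[OF ts(1) f] P_Brho[OF ts(1) kB] s(1) Pfk])
    ultimately show ?thesis using markov_augmented_Cb[OF s k(1) A] de by linarith
  qed
  then have "\<bar>(cint f t A) - (cint (P (t - s) f) s A)\<bar> \<le> 0"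
    by (rule field_le_epsilon)
  then show ?thesis by simp
qed

section \<open>Adaptedness, completeness, right continuity and conditional expectations\<close>

lemma subalgebra_augmented: "subalgebra (completion M) (augmented_filtration s)"
  using augmented_sets[of s] by (simp add: subalgebra_def space_augmented sets_augmented)

lemma coord_preimage_augmented:
  assumes "0 \<le> r" "r \<le> s" "B \<in> sets borel"
  shows "(\<lambda>w. w r) -` B \<inter> space M \<in> augmented s"
proof -
  have "{w \<in> space M. w r \<in> B} \<in> natural s"
    unfolding natural_def by (intro sigma_sets.Basic cylinder_single assms)
  moreover have "(\<lambda>w. w r) -` B \<inter> space M = {w \<in> space M. w r \<in> B}" by blast
  ultimately show ?thesis using natural_augmented by auto
qed

lemma coord_augmented_measurable:
  assumes "0 \<le> s" shows "(\<lambda>w. w s) \<in> augmented_filtration s \<rightarrow>\<^sub>M borel"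
  using coord_preimage_augmented[OF assms order_refl]
  by (intro measurableI) (auto simp: space_augmented sets_augmented)

lemma null_sets_augmented: "null_sets (completion M) \<subseteq> augmented s"
proof
  fix N assume N: "N \<in> null_sets (completion M)"
  interpret S: sigma_algebra "space M" "natural u" for u by (rule sigma_algebra_natural)
  have "AE w in M. w \<in> N \<longleftrightarrow> w \<in> {}" using AE_not_in[OF N] by (simp add: AE_completion_iff)
  moreover have "{} \<in> natural u" for u by (rule S.empty_sets)
  ultimately have "N \<in> completed u" for u
    unfolding completed_def using null_setsD2[OF N] by (intro CollectI conjI bexI[of _ "{}"])
  then show "N \<in> augmented s" by (rule augmentedI)
qed

lemma augmented_right_continuous: "augmented t = (\<Inter>u\<in>{t<..}. augmented u)"
proof
  show "augmented t \<subseteq> (\<Inter>u\<in>{t<..}. augmented u)" by (auto simp: augmented_def)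
  show "(\<Inter>u\<in>{t<..}. augmented u) \<subseteq> augmented t"
  proof
    fix A assume A: "A \<in> (\<Inter>u\<in>{t<..}. augmented u)"
    show "A \<in> augmented t"
    proof (rule augmentedI)
      fix v assume "t < v"
      from dense[OF this] obtain u where u: "t < u" "u < v" by blast
      then have "A \<in> augmented u" using A by blast
      then show "A \<in> completed v" by (rule augmentedD[OF _ u(2)])
    qed
  qed
qed

lemma cond_exp_augmented:
  assumes s: "0 \<le> s" "s \<le> t" and f: "f \<in> Brho \<rho>"
  shows "AE w in completion M. real_cond_exp (completion M) (augmented_filtration s) (\<lambda>w. f (w t)) w = P (t - s) f (w s)"
proof -
  have ts: "0 \<le> t - s" "0 \<le> t" using s by auto
  interpret C: prob_space "completion M" by (rule prob_space_completion)
  interpret C: finite_measure_subalgebra "completion M" "augmented_filtration s"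
    by (intro finite_measure_subalgebra.intro finite_measure_subalgebra_axioms.intro
        C.finite_measure_axioms subalgebra_augmented)
  show ?thesis
  proof (rule C.real_cond_exp_charact)
    show "integrable (completion M) (\<lambda>w. f (w t))" "integrable (completion M) (\<lambda>w. P (t - s) f (w s))"
      using integrable_coord[OF ts(2) f] integrable_coord[OF s(1) P_Brho[OF ts(1) f]]
      by (simp_all add: integrable_completion[OF borel_measurable_integrable])
    show "(\<lambda>w. P (t - s) f (w s)) \<in> borel_measurable (augmented_filtration s)"
      by (rule measurable_compose[OF coord_augmented_measurable[OF s(1)] Brho_borel[OF P_Brho[OF ts(1) f]]])
    fix A assume "A \<in> sets (augmented_filtration s)"
    then have "A \<in> augmented s" by (simp add: sets_augmented)
    from markov_augmented[OF s f this]
    show "(\<integral>w\<in>A. f (w t) \<partial>completion M) = (\<integral>w\<in>A. P (t - s) f (w s) \<partial>completion M)"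
      by (simp add: set_lebesgue_integral_def mult.commute)
  qed
qed

lemma initial_law: "distr M borel (\<lambda>w. w 0) = \<nu>"
proof -
  have "kernel 0 = return borel" using kernel_0 by (intro ext)
  then show ?thesis
    using distr_coord[of 0] bind_return''[of \<nu> borel] prob_in_MrhoD(1)[OF nu] by simp
qed

end

theorem mainTheorem5:
  fixes \<rho> :: "'a::topological_space \<Rightarrow> real"
    and P :: "real \<Rightarrow> ('a \<Rightarrow> real) \<Rightarrow> ('a \<Rightarrow> real)"
    and \<nu> :: "'a measure"
  assumes "weighted_space \<rho>"
    and "gen_feller_semigroup \<rho> P"
    and "\<forall>t\<ge>0. P t (\<lambda>x. 1) = (\<lambda>x. 1)"
    and "prob_in_Mrho \<rho> \<nu>"
  shows "\<exists>(Pnu :: (real \<Rightarrow> 'a) measure) (F :: real \<Rightarrow> (real \<Rightarrow> 'a) measure).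
     prob_space Pnu \<and>
     sets Pnu = sets (\<Pi>\<^sub>M t\<in>{0::real..}. (borel :: 'a measure)) \<and>
     \<comment> \<open>filtration of sub-sigma-algebras of the completed measure\<close>
     (\<forall>t\<ge>0. subalgebra (completion Pnu) (F t)) \<and>
     (\<forall>s t. 0 \<le> s \<and> s \<le> t \<longrightarrow> sets (F s) \<subseteq> sets (F t)) \<and>
     \<comment> \<open>complete\<close>
     (\<forall>t\<ge>0. null_sets (completion Pnu) \<subseteq> sets (F t)) \<and>
     \<comment> \<open>right-continuous\<close>
     (\<forall>t\<ge>0. sets (F t) = (\<Inter>u\<in>{t<..}. sets (F u))) \<and>
     \<comment> \<open>contains the natural filtration of the coordinate process\<close>
     (\<forall>t\<ge>0. sigma_sets (space Pnu) (\<Union>r\<in>{0..t}. {(\<lambda>\<omega>. \<omega> r) -` B \<inter> space Pnu | B. B \<in> sets borel})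
              \<subseteq> sets (F t)) \<and>
     \<comment> \<open>adapted\<close>
     (\<forall>t\<ge>0. (\<lambda>\<omega>. \<omega> t) \<in> measurable (F t) borel) \<and>
     \<comment> \<open>initial law\<close>
     distr Pnu borel (\<lambda>\<omega>. \<omega> 0) = \<nu> \<and>
     \<comment> \<open>Markov property\<close>
     (\<forall>s t f. 0 \<le> s \<and> s \<le> t \<and> f \<in> Brho \<rho> \<longrightarrow>
        integrable (completion Pnu) (\<lambda>\<omega>. f (\<omega> t)) \<and>
        (AE \<omega> in completion Pnu.
           real_cond_exp (completion Pnu) (F s) (\<lambda>\<omega>. f (\<omega> t)) \<omega> = P (t - s) f (\<omega> s)))"
proof -
  have feller: "feller \<rho> P"
    by (intro feller.intro weighted.intro feller_axioms.intro assms(1,2) assms(3)[rule_format])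
  then interpret feller \<rho> P .
  from path_measure_exists[OF assms(4)] obtain M where M: "prob_space M" "sets M = sets paths"
    "\<forall>J g. finite J \<longrightarrow> J \<subseteq> {0..} \<longrightarrow> (\<forall>t. g t \<in> borel_measurable borel) \<longrightarrow>
      (\<integral>\<^sup>+w. (\<Prod>t\<in>J. g t (w t)) \<partial>M) = (\<integral>\<^sup>+x. iter g (sorted_list_of_set J) 0 x \<partial>\<nu>)"
    by (elim exE conjE)
  have "feller_path \<rho> P \<nu> M"
    by (intro feller_path.intro feller_path_axioms.intro feller assms(4) M(1,2) M(3)[rule_format])
  then interpret feller_path \<rho> P \<nu> M .
  have natural: "sigma_sets (space M) (\<Union>r\<in>{0..t}. {(\<lambda>w. w r) -` B \<inter> space M | B. B \<in> sets borel}) \<subseteq> augmented t" for t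
    by (intro sigma_algebra.sigma_sets_subset[OF sigma_algebra_augmented]) (auto intro: coord_preimage_augmented)
  have mono: "augmented s \<subseteq> augmented t" if "s \<le> t" for s t
    using that by (auto simp: augmented_def)
  have int: "integrable (completion M) (\<lambda>w. f (w t))" if "0 \<le> t" "f \<in> Brho \<rho>" for t f
    using integrable_coord[OF that] by (simp add: integrable_completion[OF borel_measurable_integrable])
  show ?thesis
    by (intro exI[of _ M] exI[of _ augmented_filtration] conjI allI impI)
      (simp_all add: M(1,2) sets_augmented mono null_sets_augmented natural subalgebra_augmented
        coord_augmented_measurable initial_law int cond_exp_augmented flip: augmented_right_continuous)
qed

end
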